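(* Let $k$ be an algebraically closed field with $\operatorname{char}(k)\notin\{2,5,7\}$. Let $G$ be the automorphism group of the curve $y^4=\varphi_4(x)$ over $k$, where $\varphi_4(x)=x^4-4x^2+2$ is the Chebyshev polynomial of degree $4$. Then $G$ has order $16$ and contains a normal subgroup $N\cong\mathbb{Z}/4\mathbb{Z}$ of order $4$ such that $G/N\cong\mathbb{Z}/2\mathbb{Z}\times\mathbb{Z}/2\mathbb{Z}$.
   Context: The curve is the smooth projective plane curve obtained as the closure in $\mathbb{P}^2$ of the given affine curve. The Chebyshev polynomial $\varphi_d$ is the unique monic polynomial with $\varphi_d(t+t^{-1})=t^d+t^{-d}$ in $k[t,t^{-1}]$. *)

theory Defs
  imports
    "HOL-Analysis.Analysis"
    "HOL-Computational_Algebra.Computational_Algebra"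
    "HOL-Algebra.Bij"
    "HOL-Algebra.Elementary_Groups"
begin

section \<open>Classical projective plane geometry over a field\<close>

text \<open>Points of the projective plane are the lines through the origin of the
  three-dimensional vector space; \<open>proj v\<close> is the point with homogeneous coordinates \<open>v\<close>.\<close>

definition proj :: "'k::field ^ 3 \<Rightarrow> ('k ^ 3) set" where
  "proj v = vec.span {v}"

definition proj_plane :: "('k::field ^ 3) set set" where
  "proj_plane = proj ` {v. v \<noteq> 0}"

text \<open>Homogeneous polynomials of degree \<open>d\<close> in three variables (including zero), as functions
  of the coordinates. Over an infinite field, in particular over an algebraically closed one,
  polynomials and polynomial functions are the same thing.\<close>

definition ternary_form :: "nat \<Rightarrow> ('k::field ^ 3 \<Rightarrow> 'k) \<Rightarrow> bool" where
  "ternary_form d F \<longleftrightarrow> (\<exists>c :: nat \<Rightarrow> nat \<Rightarrow> 'k. \<forall>v. F v =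
     (\<Sum>i\<le>d. \<Sum>j\<le>d - i. c i j * (v $ 1) ^ i * (v $ 2) ^ j * (v $ 3) ^ (d - i - j)))"

definition zero_locus :: "('k::field ^ 3 \<Rightarrow> 'k) set \<Rightarrow> ('k ^ 3) set set" where
  "zero_locus \<F> = {p \<in> proj_plane. \<forall>F \<in> \<F>. \<forall>v \<in> p. F v = 0}"

definition zariski_closed :: "('k::field ^ 3) set set \<Rightarrow> bool" where
  "zariski_closed A \<longleftrightarrow> (\<exists>\<F>. (\<forall>F \<in> \<F>. \<exists>d. ternary_form d F) \<and> A = zero_locus \<F>)"

definition zariski_open :: "('k::field ^ 3) set set \<Rightarrow> bool" where
  "zariski_open U \<longleftrightarrow> U \<subseteq> proj_plane \<and> zariski_closed (proj_plane - U)"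

text \<open>A morphism between projective plane sets is locally, in the Zariski topology, given by a
  triple of forms of the same degree without common zeros.\<close>

definition proj_morphism ::
    "('k::field ^ 3) set set \<Rightarrow> ('k ^ 3) set set \<Rightarrow> (('k ^ 3) set \<Rightarrow> ('k ^ 3) set) \<Rightarrow> bool" where
  "proj_morphism X Y f \<longleftrightarrow> f \<in> X \<rightarrow> Y \<and>
     (\<forall>p \<in> X. \<exists>U d F. zariski_open U \<and> p \<in> U \<and>
        (\<forall>i :: 3. ternary_form d (\<lambda>v. F v $ i)) \<and>
        (\<forall>v. v \<noteq> 0 \<and> proj v \<in> U \<inter> X \<longrightarrow> F v \<noteq> 0 \<and> f (proj v) = proj (F v)))"

text \<open>The group of automorphisms of \<open>X\<close> over the ground field: bijections that are morphisms in
  both directions, under composition. As in \<^const>\<open>BijGroup\<close>, maps are made extensional, so that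
  each automorphism is represented exactly once.\<close>

definition variety_aut :: "('k::field ^ 3) set set \<Rightarrow> (('k ^ 3) set \<Rightarrow> ('k ^ 3) set) set" where
  "variety_aut X = {f \<in> Bij X. proj_morphism X X f \<and> proj_morphism X X (inv_into X f)}"

definition VarietyAutGroup ::
    "('k::field ^ 3) set set \<Rightarrow> (('k ^ 3) set \<Rightarrow> ('k ^ 3) set) monoid" where
  "VarietyAutGroup X = BijGroup X \<lparr>carrier := variety_aut X\<rparr>"


section \<open>Chebyshev polynomials and their curves\<close>

text \<open>The Laurent polynomial ring in \<open>t\<close> is regarded as a subring of the formal Laurent series,
  with \<open>t\<close> being \<^const>\<open>fls_X\<close>. The monic polynomial exists only for \<open>d \<ge> 1\<close>, so
  \<open>chebyshev 0\<close> is unspecified.\<close>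

definition is_chebyshev :: "nat \<Rightarrow> 'k::field poly \<Rightarrow> bool" where
  "is_chebyshev d p \<longleftrightarrow> lead_coeff p = 1 \<and>
     poly (map_poly fls_const p) (fls_X + fls_X_inv) = fls_X ^ d + fls_X_inv ^ d"

definition chebyshev :: "nat \<Rightarrow> 'k::field poly" where
  "chebyshev d = (THE p. is_chebyshev d p)"

lemma fls_laurent_eval_subdegree:
  fixes p :: "'k::field poly"
  assumes "p \<noteq> 0"
  shows "poly (map_poly fls_const p) (fls_X + fls_X_inv) \<noteq> 0 \<and>
         fls_subdegree (poly (map_poly fls_const p) (fls_X + fls_X_inv)) = - int (degree p)"
  using assms
proof (induction p)
  case 0
  then show ?case by simp
next
  case (pCons a p)
  define w where "w = (fls_X + fls_X_inv :: 'k fls)"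
  have w0: "fls_nth w (-1) = 1" by (simp add: w_def)
  have sw: "fls_subdegree w = -1"
    by (rule fls_subdegree_eqI) (auto simp: w_def)
  have wn: "w \<noteq> 0" using w0 by auto
  show ?case
  proof (cases "p = 0")
    case True
    then show ?thesis using pCons.hyps by (simp add: map_poly_pCons)
  next
    case False
    define q where "q = poly (map_poly fls_const p) w"
    have q: "q \<noteq> 0" "fls_subdegree q = - int (degree p)"
      using pCons.IH[OF False] by (auto simp: q_def w_def)
    have wq: "w * q \<noteq> 0" "fls_subdegree (w * q) = - int (degree p) - 1"
      using q wn sw by auto
    have e: "poly (map_poly fls_const (pCons a p)) w = fls_const a + w * q"
      using pCons.hyps by (simp add: map_poly_pCons q_def)
    have s: "fls_subdegree (fls_const a + w * q) = - int (degree p) - 1"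
    proof (rule fls_subdegree_eqI)
      show "fls_nth (fls_const a + w * q) (- int (degree p) - 1) \<noteq> 0"
        using nth_fls_subdegree_nonzero[OF wq(1)] by (simp only: wq(2)) simp
      show "fls_nth (fls_const a + w * q) k = 0" if "k < - int (degree p) - 1" for k
        using that fls_eq0_below_subdegree[of k "w * q"] wq(2) by (simp only: wq(2)) simp
    qed
    have "fls_const a + w * q \<noteq> 0"
    proof
      assume "fls_const a + w * q = 0"
      then show False using s by simp
    qed
    then show ?thesis using e s False by (simp add: w_def)
  qed
qed

lemma is_chebyshev_unique:
  fixes p q :: "'k::field poly"
  assumes "is_chebyshev d p" "is_chebyshev d q"
  shows "p = q"
proof (rule ccontr)
  assume "p \<noteq> q"
  then have "poly (map_poly fls_const (p - q)) (fls_X + fls_X_inv) \<noteq> 0"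
    using fls_laurent_eval_subdegree[of "p - q"] by simp
  moreover have "map_poly fls_const (p - q) = map_poly fls_const p - map_poly fls_const q"
    by (rule poly_eqI) (simp add: coeff_map_poly fls_minus_const)
  ultimately show False using assms by (simp add: is_chebyshev_def)
qed

lemma chebyshev_eqI:
  "is_chebyshev d p \<Longrightarrow> chebyshev d = p"
  unfolding chebyshev_def using is_chebyshev_unique by blast

lemma chebyshev_4:
  "(chebyshev 4 :: 'k::field poly) = [:2, 0, -4, 0, 1:]"
proof (rule chebyshev_eqI)
  define x y where "x = (fls_X :: 'k fls)" and "y = (fls_X_inv :: 'k fls)"
  have xy: "x * y = 1" by (simp add: x_def y_def fls_X_times_conv_shift)
  have "poly [:2, 0, -4, 0, 1:] (x + y) = x ^ 4 + y ^ 4" using xy by simp algebra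
  moreover have "map_poly fls_const [:2, 0, -4, 0, 1 :: 'k:] = [:2, 0, -4, 0, 1:]"
    by (simp add: map_poly_pCons)
  ultimately show "is_chebyshev 4 [:2, 0, -4, 0, 1 :: 'k:]"
    by (simp add: is_chebyshev_def x_def y_def)
qed

text \<open>The Zariski closure in the projective plane of the affine curve \<open>y ^ n = f x\<close>, with the
  affine plane embedded by \<open>(x, y) \<mapsto> (x : y : 1)\<close>.\<close>

definition proj_curve :: "nat \<Rightarrow> 'k::field poly \<Rightarrow> ('k ^ 3) set set" where
  "proj_curve n f = zariski_closed hull {proj (vector [x, y, 1]) |x y. y ^ n = poly f x}"

end

theory Submission
  imports Defs
begin

text \<open>The curve is the smooth plane quartic \<open>F = y\<^sup>4 - (x\<^sup>4 - 4 x\<^sup>2 z\<^sup>2 + 2 z\<^sup>4) = 0\<close>. On the cone over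
  it, a point \<open>v\<close> and a tangent vector \<open>w\<close> satisfy \<open>v \<times> w = \<omega>(v, w) grad F(v)\<close> for a form \<open>\<omega>\<close>. If an
  automorphism is given near a point by a triple \<open>G\<close> of forms, the ratio \<open>h\<close> of the pullback of \<open>\<omega>\<close>
  along \<open>G\<close> to \<open>\<omega>\<close> scales inversely to \<open>G\<close>, so \<open>h G\<close> does not depend on the local choice of \<open>G\<close>: it is
  a regular function on the cone, homogeneous of degree one, and therefore linear. This replaces
  the uniqueness of the canonical embedding.

  A linear automorphism fixes \<open>(0 : 1 : 0)\<close>, the only point whose polar cubic is a cube, and so is
  the product of a scalar and a symmetry of the binary quartic \<open>x\<^sup>4 - 4 x\<^sup>2 z\<^sup>2 + 2 z\<^sup>4\<close>. Those
  symmetries are diagonal or antidiagonal, eight of each kind; the scalar ones among them form the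
  central subgroup of order 4, which contains all squares.\<close>

section \<open>Polynomial functions and their differentials\<close>

text \<open>Why the lift has degree one: \<open>cross\<close> is bilinear and \<open>grad\<close> is
  cubic, so replacing \<open>G\<close> by \<open>c G\<close> multiplies the ratio by c^2 / c^3. For
  a plane curve of degree n the exponent would be 3 - n; only quartics make the canonical embedding
  the given one. The main obstacle is that relations are known only on open pieces of the curve,
  while derivatives are formal. A relation can be differentiated along the curve only once it is
  written as a multiple of \<open>quartic\<close>, so division with remainder in y takes the place
  of the Nullstellensatz. The ratio may vanish in positive characteristic (it does for Frobenius);
  that it does not here comes from the inverse automorphism. The characteristics 2, 5, 7 are read
  off the binary quartic: its invariants are I = 12 a e + c^2 = 40 and J = 72 a c e - 2 c^3 = -448,
  its discriminant is 2^11. In characteristic 5 its roots are equianharmonic and gain symmetries. In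
  characteristic 7 they are harmonic: the curve becomes the Fermat quartic, and (0 : 1 : 0) is no
  longer the only point whose polar cubic is a cube.\<close>

no_notation fps_nth (infixl "$" 75)

lemma infinite_UNIV_alg_closed: "infinite (UNIV :: 'k::alg_closed_field set)"
proof
  assume fin: "finite (UNIV :: 'k set)"
  define p :: "'k poly" where "p = (\<Prod>a\<in>UNIV. [:- a, 1:])"
  have "degree p = (\<Sum>a\<in>(UNIV :: 'k set). degree [:- a, 1:])"
    unfolding p_def by (rule degree_prod_eq_sum_degree) simp
  then have "degree p = card (UNIV :: 'k set)" by simp
  then have "degree p > 0" using fin by (simp add: card_gt_0_iff)
  then have "degree (1 + p) > 0" by (simp add: degree_add_eq_right)
  then obtain x where "poly (1 + p) x = 0" using alg_closed_imp_poly_has_root by blast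
  moreover have "poly p x = 0"
    using fin by (auto simp: p_def poly_prod)
  ultimately show False by simp
qed

lemma poly_ext_alg_closed:
  fixes p q :: "'k::alg_closed_field poly"
  assumes "\<And>x. poly p x = poly q x"
  shows "p = q"
proof (rule ccontr)
  assume "p \<noteq> q"
  then have "finite {x. poly (p - q) x = 0}" by (intro poly_roots_finite) simp
  then show False using assms infinite_UNIV_alg_closed[where 'k='k] by simp
qed

text \<open>In \<open>polyfun P dP\<close>, the value \<open>dP v w\<close> is the formal derivative of \<open>P\<close> at \<open>v\<close> in direction \<open>w\<close>.\<close>

inductive polyfun :: "('k::field ^ 3 \<Rightarrow> 'k) \<Rightarrow> ('k ^ 3 \<Rightarrow> 'k ^ 3 \<Rightarrow> 'k) \<Rightarrow> bool" where
  const: "polyfun (\<lambda>_. c) (\<lambda>_ _. 0)"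
| coord: "polyfun (\<lambda>v. v $ i) (\<lambda>_ w. w $ i)"
| add: "polyfun P dP \<Longrightarrow> polyfun Q dQ \<Longrightarrow> polyfun (\<lambda>v. P v + Q v) (\<lambda>v w. dP v w + dQ v w)"
| mult: "polyfun P dP \<Longrightarrow> polyfun Q dQ \<Longrightarrow>
    polyfun (\<lambda>v. P v * Q v) (\<lambda>v w. P v * dQ v w + dP v w * Q v)"

lemma polyfun_cmult: "polyfun P dP \<Longrightarrow> polyfun (\<lambda>v. c * P v) (\<lambda>v w. c * dP v w)"
  using polyfun.mult[OF polyfun.const[of c]] by fastforce

lemma polyfun_uminus: "polyfun P dP \<Longrightarrow> polyfun (\<lambda>v. - P v) (\<lambda>v w. - dP v w)"
  using polyfun_cmult[of P dP "-1"] by simp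

lemma polyfun_diff:
  "polyfun P dP \<Longrightarrow> polyfun Q dQ \<Longrightarrow> polyfun (\<lambda>v. P v - Q v) (\<lambda>v w. dP v w - dQ v w)"
  using polyfun.add[OF _ polyfun_uminus, of P dP Q dQ] by simp

definition polynomial_fun :: "('k::field ^ 3 \<Rightarrow> 'k) \<Rightarrow> bool" where
  "polynomial_fun P \<longleftrightarrow> (\<exists>dP. polyfun P dP)"

lemma polynomial_fun_const: "polynomial_fun (\<lambda>_. c)"
  and polynomial_fun_coord: "polynomial_fun (\<lambda>v. v $ i)"
  unfolding polynomial_fun_def by (blast intro: polyfun.intros)+

lemma polynomial_fun_add:
    "polynomial_fun P \<Longrightarrow> polynomial_fun Q \<Longrightarrow> polynomial_fun (\<lambda>v. P v + Q v)"
  and polynomial_fun_mult: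
    "polynomial_fun P \<Longrightarrow> polynomial_fun Q \<Longrightarrow> polynomial_fun (\<lambda>v. P v * Q v)"
  and polynomial_fun_uminus:
    "polynomial_fun P \<Longrightarrow> polynomial_fun (\<lambda>v. - P v)"
  and polynomial_fun_diff:
    "polynomial_fun P \<Longrightarrow> polynomial_fun Q \<Longrightarrow> polynomial_fun (\<lambda>v. P v - Q v)"
  unfolding polynomial_fun_def
  by (blast intro: polyfun.intros polyfun_uminus polyfun_diff)+

lemma polynomial_fun_power:
  assumes "polynomial_fun P"
  shows "polynomial_fun (\<lambda>v. P v ^ n)"
proof (induction n)
  case 0
  show ?case using polynomial_fun_const[of 1] by simp
next
  case (Suc n)
  then show ?case using polynomial_fun_mult[OF assms] by simp
qed

lemma polynomial_fun_sum:
  "(\<And>i. i \<in> I \<Longrightarrow> polynomial_fun (P i)) \<Longrightarrow> polynomial_fun (\<lambda>v. \<Sum>i\<in>I. P i v)"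
proof (induction I rule: infinite_finite_induct)
  case (insert i I)
  then show ?case using polynomial_fun_add[of "P i"] by simp
qed (simp_all add: polynomial_fun_const)

lemmas polynomial_fun_intros = polynomial_fun_const polynomial_fun_coord polynomial_fun_add
  polynomial_fun_mult polynomial_fun_uminus polynomial_fun_diff polynomial_fun_power
  polynomial_fun_sum

lemma polyfun_linear:
  "polyfun P dP \<Longrightarrow> dP v (a *s x + b *s y) = a * dP v x + b * dP v y"
  by (induction rule: polyfun.induct) (simp_all add: algebra_simps)

lemma polyfun_compose:
  assumes "polyfun P dP" and "\<And>i. polyfun (\<lambda>v. G v $ i) (\<lambda>v w. dG v w $ i)"
  shows "polyfun (\<lambda>v. P (G v)) (\<lambda>v w. dP (G v) (dG v w))"
  using assms(1)
proof (induction rule: polyfun.induct)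
  case (mult P dP Q dQ)
  from polyfun.mult[OF mult.IH] show ?case .
qed (auto intro: polyfun.intros assms(2))

text \<open>This ties the derivative to the values of \<open>P\<close>: \<open>dP\<close> comes from
  the way \<open>P\<close> was built, whereas the linear coefficient of the restriction to a line
  depends, over an infinite field, on the function alone.\<close>

lemma polyfun_line:
  "polyfun P dP \<Longrightarrow> \<exists>q. (\<forall>t. P (v + t *s w) = poly q t) \<and> coeff q 1 = dP v w"
proof (induction rule: polyfun.induct)
  case (const c)
  show ?case by (rule exI[of _ "[:c:]"]) simp
next
  case (coord i)
  show ?case by (rule exI[of _ "[:v $ i, w $ i:]"]) simp
next
  case (add P dP Q dQ)
  then obtain p q where "\<forall>t. P (v + t *s w) = poly p t" "coeff p 1 = dP v w"
    "\<forall>t. Q (v + t *s w) = poly q t" "coeff q 1 = dQ v w" by auto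
  then show ?case by (intro exI[of _ "p + q"]) simp
next
  case (mult P dP Q dQ)
  then obtain p q where p: "\<forall>t. P (v + t *s w) = poly p t" "coeff p 1 = dP v w"
    and q: "\<forall>t. Q (v + t *s w) = poly q t" "coeff q 1 = dQ v w" by auto
  have "P v = coeff p 0" "Q v = coeff q 0"
    using p(1)[THEN spec, of 0] q(1)[THEN spec, of 0] by (auto simp: poly_0_coeff_0)
  then show ?case using p q
    by (intro exI[of _ "p * q"]) (simp add: coeff_mult)
qed

lemma polyfun_deriv_unique:
  fixes P :: "'k::alg_closed_field ^ 3 \<Rightarrow> 'k"
  assumes "polyfun P dP" "polyfun P dP'"
  shows "dP v w = dP' v w"
proof -
  obtain p where p: "\<forall>t. P (v + t *s w) = poly p t" "coeff p 1 = dP v w"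
    using polyfun_line[OF assms(1)] by blast
  obtain q where q: "\<forall>t. P (v + t *s w) = poly q t" "coeff q 1 = dP' v w"
    using polyfun_line[OF assms(2)] by blast
  have "p = q" using p(1) q(1) by (intro poly_ext_alg_closed) simp
  then show ?thesis using p q by simp
qed

text \<open>Restricted to the line through \<open>v0\<close> and \<open>v\<close>, the product is a
  zero product of univariate polynomials, and the factor from \<open>Q\<close> is nonzero at t = 0.
  It serves to cancel a factor that is not identically zero.\<close>

lemma polyfun_mult_eq_0:
  fixes P Q :: "'k::alg_closed_field ^ 3 \<Rightarrow> 'k"
  assumes "polyfun P dP" "polyfun Q dQ" "\<And>v. P v * Q v = 0" "Q v0 \<noteq> 0"
  shows "P v = 0"
proof -
  obtain p where p: "\<And>t. P (v0 + t *s (v - v0)) = poly p t"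
    using polyfun_line[OF assms(1)] by metis
  obtain q where q: "\<And>t. Q (v0 + t *s (v - v0)) = poly q t"
    using polyfun_line[OF assms(2)] by metis
  have "p * q = 0"
    by (rule poly_ext_alg_closed) (simp add: assms(3) flip: p q)
  moreover have "q \<noteq> 0" using q[of 0] assms(4) by auto
  ultimately show ?thesis using p[of 1] by simp
qed

lemma ternary_form_polynomial_fun:
  assumes "ternary_form d F"
  shows "polynomial_fun F"
proof -
  obtain c where "F = (\<lambda>v. \<Sum>i\<le>d. \<Sum>j\<le>d - i. c i j * (v $ 1) ^ i * (v $ 2) ^ j * (v $ 3) ^ (d - i - j))"
    using assms by (auto simp: ternary_form_def fun_eq_iff)
  then show ?thesis by (simp add: polynomial_fun_intros)
qed

lemma ternary_form_scale:
  assumes "ternary_form d F"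
  shows "F (a *s v) = a ^ d * F v"
proof -
  obtain c where F: "\<And>v. F v = (\<Sum>i\<le>d. \<Sum>j\<le>d - i. c i j * (v $ 1) ^ i * (v $ 2) ^ j * (v $ 3) ^ (d - i - j))"
    using assms by (auto simp: ternary_form_def)
  have "c i j * (a * x) ^ i * (a * y) ^ j * (a * z) ^ (d - i - j)
    = a ^ d * (c i j * x ^ i * y ^ j * z ^ (d - i - j))" if "i \<le> d" "j \<le> d - i" for i j x y z
  proof -
    have "a ^ i * a ^ j * a ^ (d - i - j) = a ^ d"
      using that by (simp flip: power_add)
    then show ?thesis by (simp add: power_mult_distrib flip: mult.assoc)
  qed
  then show ?thesis unfolding F sum_distrib_left
    by (intro sum.cong refl) (simp)
qed

section \<open>The quartic and its cone\<close>

definition cheb_form :: "'k::field \<Rightarrow> 'k \<Rightarrow> 'k" where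
  "cheb_form x z = x ^ 4 - 4 * x ^ 2 * z ^ 2 + 2 * z ^ 4"

definition quartic :: "'k::field ^ 3 \<Rightarrow> 'k" where
  "quartic v = (v $ 2) ^ 4 - cheb_form (v $ 1) (v $ 3)"

definition grad :: "'k::field ^ 3 \<Rightarrow> 'k ^ 3" where
  "grad v = vector [8 * v $ 1 * (v $ 3) ^ 2 - 4 * (v $ 1) ^ 3, 4 * (v $ 2) ^ 3,
     8 * (v $ 1) ^ 2 * v $ 3 - 8 * (v $ 3) ^ 3]"

definition dotp :: "'k::field ^ 3 \<Rightarrow> 'k ^ 3 \<Rightarrow> 'k" where
  "dotp a b = a $ 1 * b $ 1 + a $ 2 * b $ 2 + a $ 3 * b $ 3"

definition cross :: "'k::field ^ 3 \<Rightarrow> 'k ^ 3 \<Rightarrow> 'k ^ 3" where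
  "cross a b = vector [a $ 2 * b $ 3 - a $ 3 * b $ 2, a $ 3 * b $ 1 - a $ 1 * b $ 3,
     a $ 1 * b $ 2 - a $ 2 * b $ 1]"

lemma vec3_eqI: "a $ 1 = b $ 1 \<Longrightarrow> a $ 2 = b $ 2 \<Longrightarrow> a $ 3 = b $ 3 \<Longrightarrow> (a :: 'a ^ 3) = b"
  by (simp add: vec_eq_iff forall_3)

lemma vec3_nonzero: "(v :: 'a::zero ^ 3) \<noteq> 0 \<longleftrightarrow> v $ 1 \<noteq> 0 \<or> v $ 2 \<noteq> 0 \<or> v $ 3 \<noteq> 0"
  by (simp add: vec_eq_iff forall_3)

lemma polyfun_quartic: "polyfun quartic (\<lambda>v w. dotp (grad v) w)"
proof -
  define sq where "sq i = (\<lambda>v::'a^3. v $ i * v $ i)" for i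
  define dsq where "dsq i = (\<lambda>v w::'a^3. v $ i * w $ i + w $ i * v $ i)" for i
  have sq: "polyfun (sq i) (dsq i)" for i
    unfolding sq_def dsq_def by (intro polyfun.intros)
  have "polyfun (\<lambda>v. sq 2 v * sq 2 v - (sq 1 v * sq 1 v - 4 * (sq 1 v * sq 3 v) + 2 * (sq 3 v * sq 3 v)))
    (\<lambda>v w. (sq 2 v * dsq 2 v w + dsq 2 v w * sq 2 v) - ((sq 1 v * dsq 1 v w + dsq 1 v w * sq 1 v)
       - 4 * (sq 1 v * dsq 3 v w + dsq 1 v w * sq 3 v) + 2 * (sq 3 v * dsq 3 v w + dsq 3 v w * sq 3 v)))"
    by (intro polyfun.intros polyfun_diff polyfun_cmult sq)
  moreover have "(\<lambda>v. sq 2 v * sq 2 v - (sq 1 v * sq 1 v - 4 * (sq 1 v * sq 3 v) + 2 * (sq 3 v * sq 3 v))) = quartic"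
    by (simp add: sq_def fun_eq_iff quartic_def cheb_form_def) algebra
  moreover have "(\<lambda>v w. (sq 2 v * dsq 2 v w + dsq 2 v w * sq 2 v) - ((sq 1 v * dsq 1 v w + dsq 1 v w * sq 1 v)
       - 4 * (sq 1 v * dsq 3 v w + dsq 1 v w * sq 3 v) + 2 * (sq 3 v * dsq 3 v w + dsq 3 v w * sq 3 v)))
    = (\<lambda>v w. dotp (grad v) w)"
    by (simp add: sq_def dsq_def fun_eq_iff dotp_def grad_def) algebra
  ultimately show ?thesis by simp
qed

text \<open>Smoothness. The y-partial forces y = 0; the other two leave z = 0 or both x^2 = z^2 and
  (x = 0 or x^2 = 2 z^2), each of which again gives z = 0, and then x = 0.\<close>

lemma grad_nonzero:
  assumes "(2::'k::field) \<noteq> 0" "(v :: 'k ^ 3) \<noteq> 0"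
  shows "grad v \<noteq> 0"
proof
  assume "grad v = 0"
  then have e: "8 * v $ 1 * (v $ 3) ^ 2 - 4 * (v $ 1) ^ 3 = 0" "4 * (v $ 2) ^ 3 = 0"
     "8 * (v $ 1) ^ 2 * v $ 3 - 8 * (v $ 3) ^ 3 = 0"
    by (simp_all add: grad_def vec_eq_iff forall_3)
  have 4: "(4::'k) \<noteq> 0" "(8::'k) \<noteq> 0"
    using assms(1) by (metis mult_eq_0_iff mult_2 numeral_Bit0)+
  have "v $ 2 = 0" using e(2) 4 by simp
  moreover have "4 * (v $ 1 * (2 * v $ 3 ^ 2 - v $ 1 ^ 2)) = 0" using e(1) by algebra
  then have 1: "v $ 1 = 0 \<or> v $ 1 ^ 2 = 2 * v $ 3 ^ 2" using 4 by auto
  have "8 * (v $ 3 * (v $ 1 ^ 2 - v $ 3 ^ 2)) = 0" using e(3) by algebra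
  then have 3: "v $ 3 = 0 \<or> v $ 1 ^ 2 = v $ 3 ^ 2" using 4 by auto
  have "v $ 3 = 0"
  proof (rule ccontr)
    assume "v $ 3 \<noteq> 0"
    then have 3: "v $ 1 ^ 2 = v $ 3 ^ 2" using 3 by simp
    have "v $ 3 ^ 2 = 0" using 1
    proof
      assume "v $ 1 ^ 2 = 2 * v $ 3 ^ 2"
      then show ?thesis using 3 by algebra
    qed (use 3 in simp)
    then show False using \<open>v $ 3 \<noteq> 0\<close> by simp
  qed
  moreover have "v $ 1 = 0" using 1 calculation by auto
  ultimately show False using assms(2) by (simp add: vec3_nonzero)
qed

section \<open>Polynomials vanishing on the curve: division by the quartic\<close>

definition yfree :: "('k::field ^ 3 \<Rightarrow> 'k) \<Rightarrow> bool" where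
  "yfree R \<longleftrightarrow> polynomial_fun R \<and> (\<forall>v y. R (vector [v $ 1, y, v $ 3]) = R v)"

lemma yfree_intros:
  "yfree (\<lambda>_. c)" "yfree (\<lambda>v. v $ 1)" "yfree (\<lambda>v. v $ 3)"
  "yfree P \<Longrightarrow> yfree Q \<Longrightarrow> yfree (\<lambda>v. P v + Q v)"
  "yfree P \<Longrightarrow> yfree Q \<Longrightarrow> yfree (\<lambda>v. P v * Q v)"
  by (simp_all add: yfree_def polynomial_fun_intros)

lemma yfree_cheb_form: "yfree (\<lambda>v. cheb_form (v $ 1) (v $ 3))"
  unfolding cheb_form_def yfree_def by (simp add: polynomial_fun_intros)

lemma y_power_4: "(v $ 2) ^ 4 = quartic v + cheb_form (v $ 1) (v $ 3)"
  by (simp add: quartic_def)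

lemma polynomial_fun_quartic: "polynomial_fun quartic"
  using polyfun_quartic polynomial_fun_def by blast

text \<open>\<open>quartic\<close> is monic of degree 4 in y, so y^4 may be replaced by
  \<open>cheb_form\<close> modulo \<open>quartic\<close>. The induction follows the construction of
  \<open>H\<close> as a polynomial function; only products need work.\<close>

lemma division_by_quartic:
  assumes "polynomial_fun H"
  shows "\<exists>Q R0 R1 R2 R3. polynomial_fun Q \<and> yfree R0 \<and> yfree R1 \<and> yfree R2 \<and> yfree R3 \<and>
    (\<forall>v. H v = Q v * quartic v + R0 v + R1 v * v $ 2 + R2 v * v $ 2 ^ 2 + R3 v * v $ 2 ^ 3)"
proof -
  obtain dH where "polyfun H dH" using assms polynomial_fun_def by blast
  then show ?thesis
  proof (induction rule: polyfun.induct)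
    case (const c)
    show ?case
      by (rule exI[of _ "\<lambda>_. 0"], rule exI[of _ "\<lambda>_. c"], (rule exI[of _ "\<lambda>_. 0"])+)
        (simp add: yfree_intros polynomial_fun_intros)
  next
    case (coord i)
    consider "i = 1" | "i = 2" | "i = 3" using exhaust_3 by blast
    then show ?case
    proof cases
      case 1
      show ?thesis
        by (rule exI[of _ "\<lambda>_. 0"], rule exI[of _ "\<lambda>v. v $ 1"], (rule exI[of _ "\<lambda>_. 0"])+)
          (simp add: 1 yfree_intros polynomial_fun_intros)
    next
      case 2
      show ?thesis
        by (rule exI[of _ "\<lambda>_. 0"], rule exI[of _ "\<lambda>_. 0"], rule exI[of _ "\<lambda>_. 1"], (rule exI[of _ "\<lambda>_. 0"])+)
          (simp add: 2 yfree_intros polynomial_fun_intros)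
    next
      case 3
      show ?thesis
        by (rule exI[of _ "\<lambda>_. 0"], rule exI[of _ "\<lambda>v. v $ 3"], (rule exI[of _ "\<lambda>_. 0"])+)
          (simp add: 3 yfree_intros polynomial_fun_intros)
    qed
  next
    case (add P dP P' dP')
    obtain Q R0 R1 R2 R3 where 1: "polynomial_fun Q" "yfree R0" "yfree R1" "yfree R2" "yfree R3"
      and P: "\<And>v. P v = Q v * quartic v + R0 v + R1 v * v $ 2 + R2 v * v $ 2 ^ 2 + R3 v * v $ 2 ^ 3"
      using add.IH(1) by blast
    obtain Q' S0 S1 S2 S3 where 2: "polynomial_fun Q'" "yfree S0" "yfree S1" "yfree S2" "yfree S3"
      and P': "\<And>v. P' v = Q' v * quartic v + S0 v + S1 v * v $ 2 + S2 v * v $ 2 ^ 2 + S3 v * v $ 2 ^ 3"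
      using add.IH(2) by blast
    show ?case
      by (rule exI[of _ "\<lambda>v. Q v + Q' v"], rule exI[of _ "\<lambda>v. R0 v + S0 v"], rule exI[of _ "\<lambda>v. R1 v + S1 v"],
          rule exI[of _ "\<lambda>v. R2 v + S2 v"], rule exI[of _ "\<lambda>v. R3 v + S3 v"])
        (simp add: 1 2 yfree_intros polynomial_fun_intros P P' algebra_simps)
  next
    case (mult P dP P' dP')
    obtain Q R0 R1 R2 R3 where 1: "polynomial_fun Q" "yfree R0" "yfree R1" "yfree R2" "yfree R3"
      and P: "\<And>v. P v = Q v * quartic v + R0 v + R1 v * v $ 2 + R2 v * v $ 2 ^ 2 + R3 v * v $ 2 ^ 3"
      using mult.IH(1) by blast
    obtain Q' S0 S1 S2 S3 where 2: "polynomial_fun Q'" "yfree S0" "yfree S1" "yfree S2" "yfree S3"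
      and P': "\<And>v. P' v = Q' v * quartic v + S0 v + S1 v * v $ 2 + S2 v * v $ 2 ^ 2 + S3 v * v $ 2 ^ 3"
      using mult.IH(2) by blast
    have 3: "polynomial_fun R1" "polynomial_fun R2" "polynomial_fun R3"
      "polynomial_fun S1" "polynomial_fun S2" "polynomial_fun S3" "polynomial_fun P" "polynomial_fun P'"
      using 1 2 mult.hyps yfree_def polynomial_fun_def by blast+
    \<comment> \<open>The coefficients of y^4, y^5, y^6 in the product of the two remainders. By
      \<open>y_power_4\<close>, each term c y^(4+j) sends c y^j into the quotient and c
      \<open>cheb_form\<close> y^j into the new remainder.\<close>
    define c4 where "c4 v = R1 v * S3 v + R2 v * S2 v + R3 v * S1 v" for v
    define c5 where "c5 v = R2 v * S3 v + R3 v * S2 v" for v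
    define c6 where "c6 v = R3 v * S3 v" for v
    note c = c4_def[abs_def] c5_def[abs_def] c6_def[abs_def]
    show ?case
    proof (intro exI conjI allI)
      show "polynomial_fun (\<lambda>v. Q v * P' v + (P v - Q v * quartic v) * Q' v + (c4 v + c5 v * v $ 2 + c6 v * v $ 2 ^ 2))"
        unfolding c by (intro polynomial_fun_intros 1 2 3 polynomial_fun_quartic)
      show "yfree (\<lambda>v. R0 v * S0 v + c4 v * cheb_form (v $ 1) (v $ 3))"
        unfolding c by (intro yfree_intros yfree_cheb_form 1 2)
      show "yfree (\<lambda>v. R0 v * S1 v + R1 v * S0 v + c5 v * cheb_form (v $ 1) (v $ 3))"
        unfolding c by (intro yfree_intros yfree_cheb_form 1 2)
      show "yfree (\<lambda>v. R0 v * S2 v + R1 v * S1 v + R2 v * S0 v + c6 v * cheb_form (v $ 1) (v $ 3))"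
        unfolding c by (intro yfree_intros yfree_cheb_form 1 2)
      show "yfree (\<lambda>v. R0 v * S3 v + R1 v * S2 v + R2 v * S1 v + R3 v * S0 v)"
        by (intro yfree_intros 1 2)
      fix v
      have *: "(QQ * t + r0 + r1 * y + r2 * y\<^sup>2 + r3 * y ^ 3) * (QQ' * t + s0 + s1 * y + s2 * y\<^sup>2 + s3 * y ^ 3) =
        (QQ * (QQ' * t + s0 + s1 * y + s2 * y\<^sup>2 + s3 * y ^ 3) + (r0 + r1 * y + r2 * y\<^sup>2 + r3 * y ^ 3) * QQ' +
         ((r1 * s3 + r2 * s2 + r3 * s1) + (r2 * s3 + r3 * s2) * y + (r3 * s3) * y\<^sup>2)) * t +
        (r0 * s0 + (r1 * s3 + r2 * s2 + r3 * s1) * f) +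
        (r0 * s1 + r1 * s0 + (r2 * s3 + r3 * s2) * f) * y +
        (r0 * s2 + r1 * s1 + r2 * s0 + (r3 * s3) * f) * y\<^sup>2 +
        (r0 * s3 + r1 * s2 + r2 * s1 + r3 * s0) * y ^ 3"
        if "y ^ 4 = t + f" for QQ QQ' t f y r0 r1 r2 r3 s0 s1 s2 s3 :: 'a
      proof -
        have t: "t = y ^ 4 - f" using that by simp
        show ?thesis unfolding t by algebra
      qed
      show "P v * P' v =
        (Q v * P' v + (P v - Q v * quartic v) * Q' v + (c4 v + c5 v * v $ 2 + c6 v * v $ 2 ^ 2)) * quartic v +
        (R0 v * S0 v + c4 v * cheb_form (v $ 1) (v $ 3)) +
        (R0 v * S1 v + R1 v * S0 v + c5 v * cheb_form (v $ 1) (v $ 3)) * v $ 2 +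
        (R0 v * S2 v + R1 v * S1 v + R2 v * S0 v + c6 v * cheb_form (v $ 1) (v $ 3)) * v $ 2 ^ 2 +
        (R0 v * S3 v + R1 v * S2 v + R2 v * S1 v + R3 v * S0 v) * v $ 2 ^ 3"
        using *[OF y_power_4[of v], of "Q v" "R0 v" "R1 v" "R2 v" "R3 v" "Q' v" "S0 v" "S1 v" "S2 v" "S3 v"]
        by (simp add: P P' c add.assoc)
    qed
  qed
qed

text \<open>Outside characteristic 2 a nonzero \<open>c\<close> has four distinct fourth roots, too
  many for a nonzero cubic. Explicitly, y -> -y separates even from odd powers, and comparing
  \<open>b\<close> with \<open>i * b\<close> then separates the two coefficients within each
  part.\<close>

lemma cubic_vanishing_at_fourth_roots:
  fixes c :: "'k::alg_closed_field"
  assumes "(2::'k) \<noteq> 0" "c \<noteq> 0"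
    and "\<And>y. y ^ 4 = c \<Longrightarrow> r0 + r1 * y + r2 * y ^ 2 + r3 * y ^ 3 = 0"
  shows "r0 = 0 \<and> r1 = 0 \<and> r2 = 0 \<and> r3 = 0"
proof -
  obtain b where b: "b ^ 4 = c" using nth_root_exists[of 4 c] by auto
  obtain i :: 'k where i: "i ^ 2 = -1" using nth_root_exists[of 2 "-1 :: 'k"] by auto
  have "b \<noteq> 0" using b assms(2) by auto
  have i4: "i ^ 4 = 1" and i3: "i ^ 3 = - i"
    using i by (simp_all add: power4_eq_xxxx power3_eq_cube power2_eq_square)
  have split: "r0 + r2 * y ^ 2 = 0" "r1 * y + r3 * y ^ 3 = 0" if "y ^ 4 = c" for y
  proof -
    have "r0 + r1 * y + r2 * y ^ 2 + r3 * y ^ 3 = 0" "r0 + r1 * (- y) + r2 * (- y) ^ 2 + r3 * (- y) ^ 3 = 0"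
      using that by (intro assms(3); simp)+
    then have "2 * (r0 + r2 * y ^ 2) = 0" "2 * (r1 * y + r3 * y ^ 3) = 0" by algebra+
    then show "r0 + r2 * y ^ 2 = 0" "r1 * y + r3 * y ^ 3 = 0"
      unfolding mult_eq_0_iff using assms(1) by blast+
  qed
  have ib: "(i * b) ^ 4 = c" using b i4 by (simp add: power_mult_distrib)
  have 1: "r0 + r2 * b ^ 2 = 0" "r0 - r2 * b ^ 2 = 0"
    using split(1)[OF b] split(1)[OF ib] i by (simp_all add: power_mult_distrib)
  have "i * (r1 * b - r3 * b ^ 3) = 0"
    using split(2)[OF ib] i3 by (simp add: power_mult_distrib algebra_simps)
  moreover have "i \<noteq> 0" using i by auto
  ultimately have 2: "r1 * b - r3 * b ^ 3 = 0" "r1 * b + r3 * b ^ 3 = 0"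
    using split(2)[OF b] by auto
  have "2 * r0 = 0" "2 * (r2 * b ^ 2) = 0" "2 * (r1 * b) = 0" "2 * (r3 * b ^ 3) = 0"
    using 1 2 by algebra+
  then show ?thesis using assms(1) \<open>b \<noteq> 0\<close> by simp
qed

text \<open>A Nullstellensatz for the ideal of \<open>quartic\<close>. Over each (x, z) with
  \<open>Z\<close> and \<open>cheb_form\<close> nonzero the remainder is a cubic in y vanishing at
  four fourth roots, so its coefficients vanish there, and cancelling the two factors makes them
  vanish everywhere. With \<open>Z\<close> a coordinate, vanishing has to be known only off a
  line.\<close>

lemma quartic_divides:
  fixes H :: "'k::alg_closed_field ^ 3 \<Rightarrow> 'k"
  assumes "(2::'k) \<noteq> 0" "polynomial_fun H" "yfree Z" "Z v0 \<noteq> 0"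
    and "\<And>v. quartic v = 0 \<Longrightarrow> Z v \<noteq> 0 \<Longrightarrow> H v = 0"
  shows "\<exists>Q. polynomial_fun Q \<and> (\<forall>v. H v = Q v * quartic v)"
proof -
  obtain Q R0 R1 R2 R3 where Q: "polynomial_fun Q" and R: "yfree R0" "yfree R1" "yfree R2" "yfree R3"
    and H: "\<And>v. H v = Q v * quartic v + R0 v + R1 v * v $ 2 + R2 v * v $ 2 ^ 2 + R3 v * v $ 2 ^ 3"
    using division_by_quartic[OF assms(2)] by blast
  have van: "R0 v = 0 \<and> R1 v = 0 \<and> R2 v = 0 \<and> R3 v = 0" if "Z v \<noteq> 0" "cheb_form (v $ 1) (v $ 3) \<noteq> 0" for v
  proof (rule cubic_vanishing_at_fourth_roots[OF assms(1) that(2)])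
    fix y assume y: "y ^ 4 = cheb_form (v $ 1) (v $ 3)"
    define u where "u = (vector [v $ 1, y, v $ 3] :: 'k ^ 3)"
    have u: "u $ 1 = v $ 1" "u $ 2 = y" "u $ 3 = v $ 3" by (simp_all add: u_def)
    have qu: "quartic u = 0" using y by (simp add: u quartic_def)
    have yf: "R u = R v" if "yfree R" for R :: "'k ^ 3 \<Rightarrow> 'k"
      using that by (simp add: yfree_def u_def)
    have "Z u \<noteq> 0" using that(1) yf[OF assms(3)] by simp
    then have "H u = 0" using assms(5) qu by blast
    then have "R0 u + R1 u * y + R2 u * y\<^sup>2 + R3 u * y ^ 3 = 0"
      using H[of u] qu by (simp add: u)
    then show "R0 v + R1 v * y + R2 v * y\<^sup>2 + R3 v * y ^ 3 = 0"
      by (simp add: R[THEN yf])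
  qed
  have pZ: "polynomial_fun Z" and pB: "polynomial_fun (\<lambda>v::'k^3. cheb_form (v $ 1) (v $ 3))"
    using assms(3) yfree_cheb_form yfree_def by blast+
  have zero: "R v = 0" if "yfree R" "\<And>v. Z v \<noteq> 0 \<Longrightarrow> cheb_form (v $ 1) (v $ 3) \<noteq> 0 \<Longrightarrow> R v = 0" for R v
  proof -
    obtain dR dZ dB where d: "polyfun R dR" "polyfun Z dZ" "polyfun (\<lambda>v::'k^3. cheb_form (v $ 1) (v $ 3)) dB"
      using \<open>yfree R\<close> pZ pB unfolding yfree_def polynomial_fun_def by blast
    have b: "cheb_form ((axis 1 1 :: 'k ^ 3) $ 1) ((axis 1 1 :: 'k ^ 3) $ 3) \<noteq> 0"
      by (simp add: cheb_form_def axis_def)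
    have "R v * Z v = 0" for v
    proof (rule polyfun_mult_eq_0[OF polyfun.mult[OF d(1,2)] d(3) _ b])
      show "R v * Z v * cheb_form (v $ 1) (v $ 3) = 0" for v using that(2)[of v] by auto
    qed
    then show ?thesis
      by (rule polyfun_mult_eq_0[OF d(1,2) _ assms(4)])
  qed
  have "R0 v = 0" "R1 v = 0" "R2 v = 0" "R3 v = 0" for v
    by (rule zero[OF R(1)] zero[OF R(2)] zero[OF R(3)] zero[OF R(4)]; use van in blast)+
  then show ?thesis using Q H by auto
qed

text \<open>\<open>L * H\<close> vanishes on the whole cone, hence equals
  \<open>Q * quartic\<close>. Differentiating both sides at \<open>v\<close>, where \<open>H\<close>
  and \<open>quartic\<close> are zero, leaves L v * dH v w = Q v * (grad v . w) = 0. Relations valid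
  on an open piece of the curve may thus be differentiated along it.\<close>

lemma tangential_derivative_zero:
  fixes H L :: "'k::alg_closed_field ^ 3 \<Rightarrow> 'k"
  assumes "(2::'k) \<noteq> 0" "polyfun H dH" "polyfun L dL"
    and van: "\<And>v. v \<noteq> 0 \<Longrightarrow> quartic v = 0 \<Longrightarrow> L v \<noteq> 0 \<Longrightarrow> H v = 0"
    and v: "v \<noteq> 0" "quartic v = 0" "L v \<noteq> 0" and w: "dotp (grad v) w = 0"
  shows "dH v w = 0"
proof -
  note LH = polyfun.mult[OF assms(3,2)]
  have "\<exists>Q. polynomial_fun Q \<and> (\<forall>v. L v * H v = Q v * quartic v)"
  proof (rule quartic_divides[OF assms(1)])
    show "polynomial_fun (\<lambda>v. L v * H v)" using LH polynomial_fun_def by blast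
    \<comment> \<open>Localising at x keeps away from the origin, about which \<open>van\<close>
      says nothing.\<close>
    show "yfree (\<lambda>v::'k^3. v $ 1)" by (rule yfree_intros)
    show "(axis 1 1 :: 'k ^ 3) $ 1 \<noteq> 0" by simp
    show "L v * H v = 0" if "quartic v = 0" "v $ 1 \<noteq> 0" for v
      using van[of v] that by (cases "L v = 0") (auto simp: vec3_nonzero)
  qed
  then obtain Q dQ where Q: "polyfun Q dQ" "(\<lambda>v. L v * H v) = (\<lambda>v. Q v * quartic v)"
    unfolding polynomial_fun_def fun_eq_iff by blast
  have "polyfun (\<lambda>v. L v * H v) (\<lambda>v w. Q v * dotp (grad v) w + dQ v w * quartic v)"
    unfolding Q(2) by (rule polyfun.mult[OF Q(1) polyfun_quartic])
  from polyfun_deriv_unique[OF LH this]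
  have "L v * dH v w + dL v w * H v = Q v * dotp (grad v) w + dQ v w * quartic v" .
  then show ?thesis using v w van[of v] by simp
qed

section \<open>The projective curve as closure of the affine one\<close>

lemma proj_eq_range: "proj v = range (\<lambda>c. c *s v)"
  by (simp add: proj_def vec.span_singleton)

lemma proj_self: "v \<in> proj v"
  unfolding proj_eq_range by (rule range_eqI[of _ _ 1]) simp

lemma proj_scale:
  assumes "c \<noteq> 0"
  shows "proj (c *s v) = proj v"
proof -
  have "a *s v \<in> range (\<lambda>b. b *s (c *s v))" for a
    by (rule range_eqI[of _ _ "a / c"]) (simp add: assms vector_smult_assoc)
  then show ?thesis unfolding proj_eq_range by (auto simp: vector_smult_assoc)
qed

lemma proj_eqD:
  assumes "proj u = proj v" "u \<noteq> 0"
  shows "\<exists>c. c \<noteq> 0 \<and> u = c *s v"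
proof -
  have "u \<in> proj v" using assms(1) proj_self by blast
  then obtain c where "u = c *s v" by (auto simp: proj_eq_range)
  moreover have "c \<noteq> 0" using calculation assms(2) by auto
  ultimately show ?thesis by blast
qed

lemma ternary_form_quartic: "ternary_form 4 quartic"
proof -
  define c :: "nat \<Rightarrow> nat \<Rightarrow> 'a" where "c i j = (if (i, j) = (0, 4) then 1 else if (i, j) = (4, 0) then -1
    else if (i, j) = (2, 0) then 4 else if (i, j) = (0, 0) then -2 else 0)" for i j
  have *: "{..4} = {0, 1, 2, 3, 4::nat}" "{..3} = {0, 1, 2, 3::nat}" "{..2} = {0, 1, 2::nat}" "{..1} = {0, 1::nat}"
    by auto
  show ?thesis
    unfolding ternary_form_def
  proof (intro exI[of _ c] allI)
    fix v
    show "quartic v = (\<Sum>i\<le>4. \<Sum>j\<le>4 - i. c i j * (v $ 1) ^ i * (v $ 2) ^ j * (v $ 3) ^ (4 - i - j))"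
      by (simp add: * c_def quartic_def cheb_form_def)
  qed
qed

lemma proj_mem_zero_locus:
  assumes "\<And>F. F \<in> \<F> \<Longrightarrow> \<exists>d. ternary_form d F" "v \<noteq> 0"
  shows "proj v \<in> zero_locus \<F> \<longleftrightarrow> (\<forall>F\<in>\<F>. F v = 0)"
proof
  show "\<forall>F\<in>\<F>. F v = 0" if "proj v \<in> zero_locus \<F>"
    using that proj_self[of v] by (auto simp: zero_locus_def)
next
  assume F: "\<forall>F\<in>\<F>. F v = 0"
  have "F u = 0" if "F \<in> \<F>" "u \<in> proj v" for F u
  proof -
    obtain d where "ternary_form d F" using assms(1) \<open>F \<in> \<F>\<close> by blast
    then show ?thesis using \<open>u \<in> proj v\<close> F \<open>F \<in> \<F>\<close>
      by (auto simp: proj_eq_range ternary_form_scale[of d])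
  qed
  then show "proj v \<in> zero_locus \<F>"
    using assms(2) by (auto simp: zero_locus_def proj_plane_def)
qed

text \<open>The closure has to pick up the points at infinity and nothing else. A form vanishing on
  the affine part vanishes at all cone points with z nonzero by homogeneity, so
  \<open>quartic\<close> divides it (with \<open>Z\<close> = z), and it vanishes at z = 0 as
  well.\<close>

lemma chebyshev_curve:
  assumes "(2::'k::alg_closed_field) \<noteq> 0"
  shows "proj_curve 4 (chebyshev 4) = {proj v | v :: 'k ^ 3. v \<noteq> 0 \<and> quartic v = 0}"
    (is "_ = ?C")
proof (rule antisym)
  let ?A = "{proj (vector [x, y, 1]) |x y. y ^ 4 = poly (chebyshev 4 :: 'k poly) x}"
  have affine: "y ^ 4 = poly (chebyshev 4) x \<longleftrightarrow> quartic (vector [x, y, 1]) = 0" for x y :: 'k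
    by (simp add: chebyshev_4 quartic_def cheb_form_def algebra_simps power4_eq_xxxx power2_eq_square)
  have "zero_locus {quartic} = ?C"
    using proj_mem_zero_locus[of "{quartic}"] ternary_form_quartic
    by (auto simp: zero_locus_def proj_plane_def)
  then have "zariski_closed ?C"
    using ternary_form_quartic unfolding zariski_closed_def by (metis singletonD)
  moreover have "?A \<subseteq> ?C"
    unfolding affine by (auto simp: vec3_nonzero)
  ultimately show "proj_curve 4 (chebyshev 4) \<subseteq> ?C"
    unfolding proj_curve_def by (intro hull_minimal)
  show "?C \<subseteq> proj_curve 4 (chebyshev 4)"
    unfolding proj_curve_def hull_def
  proof clarify
    fix v :: "'k ^ 3" and T
    assume v: "v \<noteq> 0" "quartic v = 0" and T: "?A \<subseteq> T" "zariski_closed T"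
    obtain \<F> where \<F>: "\<And>F. F \<in> \<F> \<Longrightarrow> \<exists>d. ternary_form d F" "T = zero_locus \<F>"
      using T(2) unfolding zariski_closed_def by blast
    have "F v = 0" if F: "F \<in> \<F>" for F
    proof -
      have "\<exists>Q. polynomial_fun Q \<and> (\<forall>v. F v = Q v * quartic v)"
      proof (rule quartic_divides[OF assms])
        show "polynomial_fun F" using \<F>(1)[OF F] ternary_form_polynomial_fun by blast
        show "yfree (\<lambda>v::'k^3. v $ 3)" by (rule yfree_intros)
        show "(axis 3 1 :: 'k ^ 3) $ 3 \<noteq> 0" by simp
        fix u :: "'k ^ 3" assume u: "quartic u = 0" "u $ 3 \<noteq> 0"
        define u' where "u' = (vector [u $ 1 / u $ 3, u $ 2 / u $ 3, 1] :: 'k ^ 3)"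
        have uu: "u = (u $ 3) *s u'" using u(2) by (intro vec3_eqI) (simp_all add: u'_def)
        obtain d where d: "ternary_form d F" using \<F>(1)[OF F] by blast
        have "u $ 3 ^ 4 * quartic u' = 0"
          using u(1) uu ternary_form_scale[OF ternary_form_quartic] by metis
        then have "proj u' \<in> T" using T(1) u(2) affine unfolding u'_def by auto
        moreover have "u' \<noteq> 0" by (simp add: u'_def vec3_nonzero)
        ultimately have "F u' = 0" using proj_mem_zero_locus[OF \<F>(1)] \<F>(2) F by blast
        then show "F u = 0" using ternary_form_scale[OF d] uu by (metis mult_zero_right)
      qed
      then show ?thesis using v by auto
    qed
    then show "proj v \<in> T" using proj_mem_zero_locus[OF \<F>(1)] \<F>(2) v by blast
  qed
qed

section \<open>Lifting morphisms to the cone\<close>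

definition curve_cone :: "('k::field ^ 3) set" where
  "curve_cone = {v. v \<noteq> 0 \<and> quartic v = 0}"

lemma dotp_nondegenerate:
  assumes "v \<noteq> 0"
  shows "\<exists>e. dotp v e \<noteq> 0"
proof -
  obtain i where "v $ i \<noteq> 0" using assms by (auto simp: vec_eq_iff)
  then have "dotp v (axis i 1) \<noteq> 0"
    using exhaust_3[of i] by (auto simp: dotp_def axis_def)
  then show ?thesis by blast
qed

lemma cross_eq_0_imp_parallel:
  assumes "cross v w = 0" "v \<noteq> 0"
  shows "\<exists>c. w = c *s v"
proof -
  have e: "v $ 2 * w $ 3 = v $ 3 * w $ 2" "v $ 3 * w $ 1 = v $ 1 * w $ 3" "v $ 1 * w $ 2 = v $ 2 * w $ 1"
    using assms(1) by (simp_all add: cross_def vec_eq_iff forall_3)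
  obtain i where i: "v $ i \<noteq> 0" using assms(2) by (auto simp: vec_eq_iff)
  have "w = (w $ i / v $ i) *s v"
    using i exhaust_3[of i] e by (intro vec3_eqI) (auto simp: field_simps)
  then show ?thesis by blast
qed

text \<open>By the triple product expansion g x (a x b) = (g . b) a - (g . a) b = 0. This is the
  source of the proportionality factor in the tangent plane.\<close>

lemma cross_parallel_normal:
  assumes "g \<noteq> 0" "dotp g a = 0" "dotp g b = 0"
  shows "\<exists>s. cross a b = s *s g"
proof -
  have "cross g (cross a b) = 0"
    using assms(2,3) by (simp add: cross_def dotp_def vec_eq_iff forall_3) algebra
  then show ?thesis using cross_eq_0_imp_parallel assms(1) by blast
qed

lemma cross_scale: "cross (a *s v) w = a *s cross v w" "cross v (a *s w) = a *s cross v w"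
  by (auto intro!: vec3_eqI simp: cross_def algebra_simps)

lemma cross_add: "cross v (x + y) = cross v x + cross v y"
  by (auto intro!: vec3_eqI simp: cross_def algebra_simps)

lemma cross_self: "cross v v = 0"
  by (auto intro!: vec3_eqI simp: cross_def algebra_simps)

lemma grad_scale: "grad (a *s v) = a ^ 3 *s grad v"
  by (auto intro!: vec3_eqI simp: grad_def algebra_simps power2_eq_square power3_eq_cube)

lemma dotp_grad_self: "dotp (grad v) v = 4 * quartic v"
  by (simp add: dotp_def grad_def quartic_def cheb_form_def) algebra

lemma dotp_grad_cross: "dotp (grad v) (cross (grad v) e) = 0"
  by (simp add: dotp_def cross_def algebra_simps)

text \<open>In v x (g x e) = (v . e) g - (v . g) e the last term dies on the cone, since v . grad v
  = 4 \<open>quartic\<close> v.\<close>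

lemma cross_cross_grad:
  assumes "quartic v = 0"
  shows "cross v (cross (grad v) e) = dotp v e *s grad v"
proof -
  have "dotp (grad v) v = 0" using assms by (simp add: dotp_grad_self)
  then show ?thesis
    by (intro vec3_eqI; simp add: cross_def dotp_def; algebra)
qed

lemma quartic_scale: "quartic (a *s v) = a ^ 4 * quartic v"
  by (rule ternary_form_scale[OF ternary_form_quartic])

lemma curve_cone_scale: "a \<noteq> 0 \<Longrightarrow> v \<in> curve_cone \<Longrightarrow> a *s v \<in> curve_cone"
  by (simp add: curve_cone_def quartic_scale)

lemma dotp_scale: "dotp (a *s v) w = a * dotp v w"
  by (simp add: dotp_def algebra_simps)

lemma dotp_scale_right: "dotp v (a *s w) = a * dotp v w"
  and dotp_diff: "dotp v (x - y) = dotp v x - dotp v y"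
  by (simp_all add: dotp_def algebra_simps)

text \<open>Along the line v + t v = (1 + t) v the function is (1 + t)^d P v, with linear
  coefficient d. Its use: the derivative of a triple \<open>G\<close> sends the radial direction to
  a multiple of \<open>G v\<close>, which the cross product with \<open>G v\<close> kills.\<close>

lemma polyfun_euler:
  fixes P :: "'k::alg_closed_field ^ 3 \<Rightarrow> 'k"
  assumes "polyfun P dP" "\<And>a v. P (a *s v) = a ^ d * P v"
  shows "dP v v = of_nat d * P v"
proof -
  obtain q where q: "\<And>t. P (v + t *s v) = poly q t" "coeff q 1 = dP v v"
    using polyfun_line[OF assms(1)] by blast
  have "v + t *s v = (1 + t) *s v" for t :: 'k by (simp add: vec_eq_iff algebra_simps)
  then have "poly q t = (1 + t) ^ d * P v" for t
    using q(1)[of t] assms(2)[of "1 + t" v] by simp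
  then have "q = smult (P v) ([:1, 1:] ^ d)"
    by (intro poly_ext_alg_closed) (simp add: poly_power mult.commute add.commute)
  moreover have "coeff ([:1, 1:] ^ d :: 'k poly) 1 = of_nat d"
  proof -
    have "coeff ([:1, 1:] ^ d :: 'k poly) 1 = coeff (pderiv ([:1, 1:] ^ d)) 0"
      by (simp add: coeff_pderiv)
    also have "\<dots> = poly (pderiv ([:1, 1:] ^ d)) 0" by (simp add: poly_0_coeff_0)
    also have "\<dots> = of_nat d" by (simp add: pderiv_power pderiv_pCons)
    finally show ?thesis .
  qed
  ultimately show ?thesis using q(2) by (simp add: mult.commute)
qed

lemma polyfun_deriv_scale:
  fixes P :: "'k::alg_closed_field ^ 3 \<Rightarrow> 'k"
  assumes "polyfun P dP" "\<And>a v. P (a *s v) = a ^ d * P v"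
  shows "a * dP (a *s v) w = a ^ d * dP v w"
proof -
  have "polyfun (\<lambda>v. P (a *s v)) (\<lambda>v w. dP (a *s v) (a *s w))"
    by (rule polyfun_compose[OF assms(1)]) (simp add: polyfun_cmult polyfun.coord)
  moreover have "polyfun (\<lambda>v. P (a *s v)) (\<lambda>v w. a ^ d * dP v w)"
    unfolding assms(2) by (rule polyfun_cmult[OF assms(1)])
  ultimately have "dP (a *s v) (a *s w) = a ^ d * dP v w" by (rule polyfun_deriv_unique)
  then show ?thesis using polyfun_linear[OF assms(1), of "a *s v" a w 0 0] by simp
qed

lemma polyfun_deriv_polynomial_fun:
  assumes "polyfun P dP" "\<And>i. polynomial_fun (\<lambda>v. W v $ i)"
  shows "polynomial_fun (\<lambda>v. dP v (W v))"
  using assms(1)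
proof (induction rule: polyfun.induct)
  case (mult P dP Q dQ)
  moreover have "polynomial_fun P" "polynomial_fun Q"
    using mult.hyps polynomial_fun_def by blast+
  ultimately show ?case by (intro polynomial_fun_intros)
qed (simp_all add: polynomial_fun_intros assms(2))

text \<open>The open neighbourhood is the principal open set L nonzero. The point \<open>v\<close>
  enters only through \<open>L v \<noteq> 0\<close>, so the same data represent \<open>f\<close> at
  every point of that set.\<close>

definition local_rep :: "(('k::field ^ 3) set \<Rightarrow> ('k ^ 3) set) \<Rightarrow> 'k ^ 3 \<Rightarrow> nat \<Rightarrow>
    ('k ^ 3 \<Rightarrow> 'k) \<Rightarrow> ('k ^ 3 \<Rightarrow> 'k ^ 3) \<Rightarrow> ('k ^ 3 \<Rightarrow> 'k ^ 3 \<Rightarrow> 'k ^ 3) \<Rightarrow> bool" where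
  "local_rep f v d L G dG \<longleftrightarrow> L v \<noteq> 0 \<and> polynomial_fun L \<and> (\<exists>m. \<forall>a v. L (a *s v) = a ^ m * L v) \<and>
     (\<forall>i. polyfun (\<lambda>v. G v $ i) (\<lambda>v w. dG v w $ i)) \<and> (\<forall>a v. G (a *s v) = a ^ d *s G v) \<and>
     (\<forall>u\<in>curve_cone. L u \<noteq> 0 \<longrightarrow> G u \<in> curve_cone \<and> f (proj u) = proj (G u))"

text \<open>For \<open>w = grad v \<times> e\<close> one has \<open>v \<times> w = (v \<bullet> e) grad v\<close> on the cone, that is \<open>\<omega>(v, w) = v \<bullet> e\<close>;
  the multiplier is the ratio of the pullback of \<open>\<omega>\<close> along \<open>G\<close> to \<open>\<omega>\<close>.\<close>

definition multiplier :: "'k::field ^ 3 \<Rightarrow> ('k ^ 3 \<Rightarrow> 'k ^ 3) \<Rightarrow> ('k ^ 3 \<Rightarrow> 'k ^ 3 \<Rightarrow> 'k ^ 3) \<Rightarrow> 'k \<Rightarrow> bool" where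
  "multiplier v G dG h \<longleftrightarrow>
     (\<forall>e. cross (G v) (dG v (cross (grad v) e)) = (h * dotp v e) *s grad (G v))"

lemma local_rep_deriv_linear:
  assumes "local_rep f v d L G dG"
  shows "dG u (a *s x + b *s y) = a *s dG u x + b *s dG u y"
proof -
  have "dG u (a *s x + b *s y) $ i = (a *s dG u x + b *s dG u y) $ i" for i
    using polyfun_linear[of "\<lambda>v. G v $ i" "\<lambda>v w. dG v w $ i" u a x b y] assms
    by (simp add: local_rep_def)
  then show ?thesis by (simp add: vec_eq_iff)
qed

lemma local_rep_euler:
  fixes v :: "'k::alg_closed_field ^ 3"
  assumes "local_rep f v d L G dG"
  shows "dG u u = of_nat d *s G u"
proof -
  have "dG u u $ i = (of_nat d *s G u) $ i" for i
    using polyfun_euler[of "\<lambda>v. G v $ i" "\<lambda>v w. dG v w $ i" d u] assms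
    by (simp add: local_rep_def)
  then show ?thesis by (simp add: vec_eq_iff)
qed

lemma local_rep_deriv_scale:
  fixes v :: "'k::alg_closed_field ^ 3"
  assumes "local_rep f v d L G dG"
  shows "a *s dG (a *s u) w = a ^ d *s dG u w"
proof -
  have "(a *s dG (a *s u) w) $ i = (a ^ d *s dG u w) $ i" for i
    using polyfun_deriv_scale[of "\<lambda>v. G v $ i" "\<lambda>v w. dG v w $ i" d a u w] assms
    by (simp add: local_rep_def)
  then show ?thesis by (simp add: vec_eq_iff)
qed

lemma local_rep_near:
  "local_rep f v d L G dG \<Longrightarrow> L u \<noteq> 0 \<Longrightarrow> local_rep f u d L G dG"
  by (simp add: local_rep_def)

text \<open>The composite of \<open>quartic\<close> with \<open>G\<close> vanishes on the cone where
  \<open>L\<close> does not; its derivative, given by the chain rule, therefore vanishes in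
  tangential directions.\<close>

lemma local_rep_tangent:
  fixes v :: "'k::alg_closed_field ^ 3"
  assumes "(2::'k) \<noteq> 0" "v \<in> curve_cone" "local_rep f v d L G dG" "dotp (grad v) w = 0"
  shows "dotp (grad (G v)) (dG v w) = 0"
proof -
  have "polynomial_fun L" using assms(3) local_rep_def by blast
  then obtain dL where L: "polyfun L dL" using polynomial_fun_def by blast
  have H: "polyfun (\<lambda>v. quartic (G v)) (\<lambda>v w. dotp (grad (G v)) (dG v w))"
    using assms(3) by (intro polyfun_compose[OF polyfun_quartic]) (simp add: local_rep_def)
  show ?thesis
    by (rule tangential_derivative_zero[OF assms(1) H L _ _ _ _ assms(4)])
      (use assms(2,3) in \<open>auto simp: local_rep_def curve_cone_def\<close>)
qed

text \<open>The tangent plane of the cone modulo the radial direction is one-dimensional, so a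
  single \<open>e0\<close> with v . e0 nonzero determines the factor for all
  \<open>e\<close>.\<close>

lemma multiplier_exists:
  fixes v :: "'k::alg_closed_field ^ 3"
  assumes "(2::'k) \<noteq> 0" "v \<in> curve_cone" and rep: "local_rep f v d L G dG"
  shows "\<exists>h. multiplier v G dG h"
proof -
  note lin = local_rep_deriv_linear[OF rep, of v]
  have v: "v \<noteq> 0" "quartic v = 0" using assms(2) by (auto simp: curve_cone_def)
  have G: "G v \<noteq> 0" "quartic (G v) = 0" using rep assms(2) by (auto simp: curve_cone_def local_rep_def)
  obtain e0 where e0: "dotp v e0 \<noteq> 0" using dotp_nondegenerate v(1) by blast
  have "\<exists>s. cross (G v) (dG v (cross (grad v) e0)) = s *s grad (G v)"
    using local_rep_tangent[OF assms(1,2) rep dotp_grad_cross] G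
    by (intro cross_parallel_normal grad_nonzero assms(1)) (simp_all add: dotp_grad_self)
  then obtain s where s: "cross (G v) (dG v (cross (grad v) e0)) = s *s grad (G v)" by blast
  show ?thesis
    unfolding multiplier_def
  proof (intro exI allI)
    fix e
    \<comment> \<open>Subtracting \<open>c *s e0\<close> makes the rest \<open>e'\<close> orthogonal
      to \<open>v\<close>; then grad v x e' is radial and contributes nothing, by Euler's
      relation.\<close>
    define c where "c = dotp v e / dotp v e0"
    define e' where "e' = e - c *s e0"
    have "dotp v e' = 0" using e0 by (simp add: e'_def c_def dotp_diff dotp_scale_right)
    then have "cross v (cross (grad v) e') = 0" using cross_cross_grad[OF v(2)] by simp
    then obtain m where m: "cross (grad v) e' = m *s v" using cross_eq_0_imp_parallel v(1) by blast
    have "dG v (m *s v) = m *s dG v v" using lin[of m v 0 0] by simp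
    then have 0: "cross (G v) (dG v (cross (grad v) e')) = 0"
      by (simp add: m local_rep_euler[OF rep] cross_scale cross_self)
    have "cross (grad v) e = 1 *s cross (grad v) e' + c *s cross (grad v) e0"
      by (intro vec3_eqI) (simp_all add: e'_def cross_def algebra_simps)
    then have "dG v (cross (grad v) e) = dG v (cross (grad v) e') + c *s dG v (cross (grad v) e0)"
      using lin[of 1 "cross (grad v) e'" c "cross (grad v) e0"] by simp
    then show "cross (G v) (dG v (cross (grad v) e)) = (s / dotp v e0 * dotp v e) *s grad (G v)"
      by (simp add: cross_add cross_scale 0 s c_def vector_smult_assoc)
  qed
qed

text \<open>The two triples are proportional, but the factor is not given as a polynomial; instead
  the minors G_i G'_j - G_j G'_i are differentiated along the curve. With G' v = c G v this gives G
  v x dG' w = c (G v x dG w). Comparing c^2 from the cross product with c^3 from \<open>grad\<close>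
  yields c h' = h.\<close>

lemma lift_unique:
  fixes v :: "'k::alg_closed_field ^ 3"
  assumes 2: "(2::'k) \<noteq> 0" and vc: "v \<in> curve_cone"
    and rep: "local_rep f v d L G dG" "local_rep f v d' L' G' dG'"
    and mult: "multiplier v G dG h" "multiplier v G' dG' h'"
  shows "h *s G v = h' *s G' v"
proof -
  have v: "v \<noteq> 0" "quartic v = 0" using vc by (auto simp: curve_cone_def)
  have G: "G v \<noteq> 0" using rep vc by (auto simp: curve_cone_def local_rep_def)
  have "proj (G' v) = proj (G v)" "G' v \<noteq> 0"
    using rep vc by (auto simp: curve_cone_def local_rep_def)
  then obtain c where c: "c \<noteq> 0" "G' v = c *s G v" using proj_eqD by blast
  obtain e where e: "dotp v e \<noteq> 0" using dotp_nondegenerate v(1) by blast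
  define w where "w = cross (grad v) e"
  have p: "polyfun (\<lambda>v. G v $ i) (\<lambda>v w. dG v w $ i)" "polyfun (\<lambda>v. G' v $ i) (\<lambda>v w. dG' v w $ i)" for i
    using rep by (auto simp: local_rep_def)
  have "polynomial_fun (\<lambda>v. L v * L' v)"
    using rep by (intro polynomial_fun_intros) (auto simp: local_rep_def)
  then obtain dM where M: "polyfun (\<lambda>v. L v * L' v) dM" unfolding polynomial_fun_def by blast
  have der: "G v $ i * dG' v w $ j + dG v w $ i * G' v $ j - (G v $ j * dG' v w $ i + dG v w $ j * G' v $ i) = 0"
    for i j
  proof -
    have H: "polyfun (\<lambda>v. G v $ i * G' v $ j - G v $ j * G' v $ i) (\<lambda>v w. G v $ i * dG' v w $ j + dG v w $ i * G' v $ j - (G v $ j * dG' v w $ i + dG v w $ j * G' v $ i))"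
      by (intro polyfun_diff polyfun.mult p)
    have "G u $ i * G' u $ j - G u $ j * G' u $ i = 0"
      if u: "u \<noteq> 0" "quartic u = 0" "L u * L' u \<noteq> 0" for u
    proof -
      have "proj (G' u) = proj (G u)" "G' u \<noteq> 0"
        using u rep by (auto simp: curve_cone_def local_rep_def)
      then obtain b where "G' u = b *s G u" using proj_eqD by blast
      then show ?thesis by simp
    qed
    from tangential_derivative_zero[OF 2 H M this v] show ?thesis
      using rep by (simp add: w_def dotp_grad_cross local_rep_def)
  qed
  have "cross (G v) (dG' v w) = c *s cross (G v) (dG v w)"
    using der[of 2 3] der[of 3 1] der[of 1 2]
    by (intro vec3_eqI; simp add: cross_def c(2) algebra_simps)
  also have "\<dots> = (c * (h * dotp v e)) *s grad (G v)"
    using mult(1) by (simp add: multiplier_def w_def)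
  finally have "cross (G v) (dG' v w) = (c * (h * dotp v e)) *s grad (G v)" .
  moreover have "cross (G' v) (dG' v w) = (h' * dotp v e) *s grad (c *s G v)"
    using mult(2) by (simp add: multiplier_def w_def c(2))
  ultimately have *: "(h' * dotp v e * c ^ 3) *s grad (G v) = (c * (c * (h * dotp v e))) *s grad (G v)"
    by (metis (no_types, opaque_lifting) c(2) cross_scale(1) grad_scale vector_smult_assoc)
  obtain i where "grad (G v) $ i \<noteq> 0"
    using grad_nonzero[OF 2 G] by (auto simp: vec_eq_iff)
  then have "h' * dotp v e * c ^ 3 = c * (c * (h * dotp v e))"
    using arg_cong[OF *, of "\<lambda>x. x $ i"] by simp
  then have "c * h' = h" using c(1) e by (simp add: power3_eq_cube mult.commute)
  then show ?thesis by (auto simp: c(2) vector_smult_assoc mult.commute)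
qed

section \<open>The lift to the cone: homogeneity, composition, regularity\<close>

definition lift :: "(('k::field ^ 3) set \<Rightarrow> ('k ^ 3) set) \<Rightarrow> 'k ^ 3 \<Rightarrow> 'k ^ 3" where
  "lift f v = (SOME a. \<exists>d L G dG h. local_rep f v d L G dG \<and> multiplier v G dG h \<and> a = h *s G v)"

lemma lift_eq:
  fixes v :: "'k::alg_closed_field ^ 3"
  assumes "(2::'k) \<noteq> 0" "v \<in> curve_cone" "local_rep f v d L G dG" "multiplier v G dG h"
  shows "lift f v = h *s G v"
  unfolding lift_def
proof (rule some_equality)
  show "a = h *s G v" if "\<exists>d L G dG h. local_rep f v d L G dG \<and> multiplier v G dG h \<and> a = h *s G v" for a
    using that lift_unique[OF assms(1,2) assms(3) _ assms(4)] by metis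
qed (use assms in blast)

lemma lift_scale:
  fixes v :: "'k::alg_closed_field ^ 3"
  assumes 2: "(2::'k) \<noteq> 0" and v: "v \<in> curve_cone" and rep: "local_rep f v d L G dG" and "a \<noteq> 0"
  shows "lift f (a *s v) = a *s lift f v"
proof -
  obtain h where h: "multiplier v G dG h" using multiplier_exists[OF 2 v rep] by blast
  have "L (a *s v) \<noteq> 0" using rep \<open>a \<noteq> 0\<close> unfolding local_rep_def by (metis no_zero_divisors power_not_zero)
  then have rep': "local_rep f (a *s v) d L G dG" using local_rep_near[OF rep] by blast
  have G: "G (a *s v) = a ^ d *s G v" using rep by (simp add: local_rep_def)
  \<comment> \<open>The exponent 1 - d: the left side scales by a^d from \<open>G\<close>, a^(d-1)
    from \<open>dG\<close> and a^3 from \<open>grad v\<close>, the right side by a from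
    \<open>dotp v e\<close> and a^(3d) from \<open>grad (G v)\<close>.\<close>
  have "multiplier (a *s v) G dG (h * a / a ^ d)"
    unfolding multiplier_def
  proof
    fix e
    define w where "w = cross (grad v) e"
    have "cross (grad (a *s v)) e = a ^ 3 *s w" by (simp add: grad_scale cross_scale w_def)
    moreover have "dG (a *s v) (a ^ 3 *s w) = a ^ 2 *s (a *s dG (a *s v) w)"
      using local_rep_deriv_linear[OF rep, of "a *s v" "a ^ 3" w 0 0]
      by (simp add: vector_smult_assoc power3_eq_cube power2_eq_square)
    ultimately have "cross (G (a *s v)) (dG (a *s v) (cross (grad (a *s v)) e))
      = (a ^ d * a ^ 2 * a ^ d) *s cross (G v) (dG v w)"
      by (simp add: G local_rep_deriv_scale[OF rep] cross_scale vector_smult_assoc)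
    also have "\<dots> = (a ^ d * a ^ 2 * a ^ d * (h * dotp v e)) *s grad (G v)"
      using h by (simp add: multiplier_def w_def vector_smult_assoc)
    also have "\<dots> = (h * a / a ^ d * dotp (a *s v) e) *s grad (G (a *s v))"
      using \<open>a \<noteq> 0\<close> by (simp add: G grad_scale dotp_scale vector_smult_assoc field_simps power2_eq_square power3_eq_cube)
    finally show "cross (G (a *s v)) (dG (a *s v) (cross (grad (a *s v)) e))
      = (h * a / a ^ d * dotp (a *s v) e) *s grad (G (a *s v))" .
  qed
  then have "lift f (a *s v) = (h * a / a ^ d) *s G (a *s v)"
    by (rule lift_eq[OF 2 curve_cone_scale[OF \<open>a \<noteq> 0\<close> v] rep'])
  then show ?thesis
    using \<open>a \<noteq> 0\<close> by (simp add: lift_eq[OF 2 v rep h] G vector_smult_assoc mult.commute)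
qed

lemma local_rep_identity:
  assumes "v \<in> curve_cone" "\<And>u. u \<in> curve_cone \<Longrightarrow> f (proj u) = proj u"
  shows "local_rep f v 1 (\<lambda>_. 1) (\<lambda>v. v) (\<lambda>_ w. w)" "multiplier v (\<lambda>v. v) (\<lambda>_ w. w) 1"
proof -
  have "\<exists>m. \<forall>a::'a. 1 = a ^ m" by (rule exI[of _ 0]) simp
  then show "local_rep f v 1 (\<lambda>_. 1) (\<lambda>v. v) (\<lambda>_ w. w)"
    using assms by (simp add: local_rep_def polynomial_fun_intros polyfun.coord)
  show "multiplier v (\<lambda>v. v) (\<lambda>_ w. w) 1"
    using assms(1) by (simp add: multiplier_def cross_cross_grad curve_cone_def)
qed

lemma polynomial_fun_compose:
  assumes "polynomial_fun P" and "\<And>i. polynomial_fun (\<lambda>v. W v $ i)"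
  shows "polynomial_fun (\<lambda>v. P (W v))"
proof -
  obtain dP where "polyfun P dP" using assms(1) polynomial_fun_def by blast
  then show ?thesis
    by (induction rule: polyfun.induct) (simp_all add: polynomial_fun_intros assms(2))
qed

lemma local_rep_coord: "local_rep f v d L G dG \<Longrightarrow> polynomial_fun (\<lambda>v. G v $ i)"
  unfolding local_rep_def polynomial_fun_def by blast

lemma local_rep_compose:
  assumes f: "local_rep f v d L G dG" and g: "local_rep g (G v) d' L' G' dG'"
  shows "local_rep (\<lambda>p. g (f p)) v (d * d') (\<lambda>v. L v * L' (G v)) (\<lambda>v. G' (G v)) (\<lambda>v w. dG' (G v) (dG v w))"
  unfolding local_rep_def
proof (intro conjI allI ballI impI)
  show "L v * L' (G v) \<noteq> 0" using f g by (simp add: local_rep_def)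
  have "polynomial_fun L" "polynomial_fun L'" using f g by (simp_all add: local_rep_def)
  then show "polynomial_fun (\<lambda>v. L v * L' (G v))"
    using polynomial_fun_compose[of L' G] local_rep_coord[OF f] by (simp add: polynomial_fun_mult)
  have G: "G (a *s v) = a ^ d *s G v" and G': "G' (a *s v) = a ^ d' *s G' v" for a v
    using f g by (simp_all add: local_rep_def)
  obtain m m' where "\<And>a v. L (a *s v) = a ^ m * L v" "\<And>a v. L' (a *s v) = a ^ m' * L' v"
    using f g unfolding local_rep_def by blast
  then have "\<forall>a v. L (a *s v) * L' (G (a *s v)) = a ^ (m + d * m') * (L v * L' (G v))"
    by (simp add: G power_add power_mult)
  then show "\<exists>m. \<forall>a v. L (a *s v) * L' (G (a *s v)) = a ^ m * (L v * L' (G v))" by blast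
  show "G' (G (a *s v)) = a ^ (d * d') *s G' (G v)" for a v
    by (simp add: G G' power_mult)
  show "polyfun (\<lambda>v. G' (G v) $ i) (\<lambda>v w. dG' (G v) (dG v w) $ i)" for i
    using f g polyfun_compose[of "\<lambda>v. G' v $ i" "\<lambda>v w. dG' v w $ i" G dG] by (simp add: local_rep_def)
  fix u assume "u \<in> curve_cone" "L u * L' (G u) \<noteq> 0"
  then show "G' (G u) \<in> curve_cone" "g (f (proj u)) = proj (G' (G u))"
    using f g by (auto simp: local_rep_def)
qed

text \<open>The image w = dG(grad v x e) is tangent at u = G v but need not have the form grad u x
  e' required for \<open>h'\<close>. It agrees with such a vector up to a multiple of
  \<open>u\<close>, which Euler's relation makes harmless.\<close>

lemma multiplier_compose:
  fixes v :: "'k::alg_closed_field ^ 3"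
  assumes 2: "(2::'k) \<noteq> 0" and v: "v \<in> curve_cone"
    and f: "local_rep f v d L G dG" "multiplier v G dG h"
    and g: "local_rep g (G v) d' L' G' dG'" "multiplier (G v) G' dG' h'"
  shows "multiplier v (\<lambda>v. G' (G v)) (\<lambda>v w. dG' (G v) (dG v w)) (h * h')"
  unfolding multiplier_def
proof
  fix e
  define u where "u = G v"
  define w where "w = dG v (cross (grad v) e)"
  have u: "u \<noteq> 0" "quartic u = 0" using f v by (auto simp: local_rep_def curve_cone_def u_def)
  obtain e0 where e0: "dotp u e0 \<noteq> 0" using dotp_nondegenerate u(1) by blast
  \<comment> \<open>Scaled so that u . e' = h (v . e); then w and grad u x e' have the same cross
    product with \<open>u\<close>.\<close>
  define e' where "e' = (h * dotp v e / dotp u e0) *s e0"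
  have ue': "dotp u e' = h * dotp v e" using e0 by (simp add: e'_def dotp_scale_right)
  have "cross u w = (h * dotp v e) *s grad u"
    using f(2) by (simp add: multiplier_def u_def w_def)
  then have "cross u w = cross u (cross (grad u) e')"
    by (simp add: cross_cross_grad[OF u(2)] ue')
  then have "cross u (w - cross (grad u) e') = 0"
    by (simp add: cross_def vec_eq_iff forall_3 algebra_simps)
  then obtain m where m: "w - cross (grad u) e' = m *s u" using cross_eq_0_imp_parallel u(1) by blast
  have "w = 1 *s cross (grad u) e' + m *s u" by (simp flip: m)
  then have "dG' u w = dG' u (cross (grad u) e') + (m * of_nat d') *s G' u"
    using local_rep_deriv_linear[OF g(1), of u 1 "cross (grad u) e'" m u] local_rep_euler[OF g(1), of u]
    by (simp add: vector_smult_assoc)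
  then have "cross (G' u) (dG' u w) = cross (G' u) (dG' u (cross (grad u) e'))"
    by (simp add: cross_add cross_scale cross_self)
  also have "\<dots> = (h * h' * dotp v e) *s grad (G' u)"
    using g(2) by (simp add: multiplier_def ue' ac_simps flip: u_def)
  finally show "cross (G' (G v)) (dG' (G v) (dG v (cross (grad v) e))) = (h * h' * dotp v e) *s grad (G' (G v))"
    by (simp add: u_def w_def)
qed

text \<open>The composite representation and the identity both represent \<open>g\<close> after
  \<open>f\<close>, so uniqueness gives (h h') G'(G v) = v. This is where \<open>h\<close> is seen
  to be nonzero: existence of an inverse excludes maps such as Frobenius, whose derivative
  vanishes.\<close>

lemma lift_lift_inverse:
  fixes v :: "'k::alg_closed_field ^ 3"
  assumes 2: "(2::'k) \<noteq> 0" and v: "v \<in> curve_cone"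
    and f: "local_rep f v d L G dG" and g: "local_rep g (G v) d' L' G' dG'"
    and gf: "\<And>u. u \<in> curve_cone \<Longrightarrow> g (f (proj u)) = proj u"
  shows "lift g (lift f v) = v" "lift f v \<in> curve_cone" "proj (lift f v) = f (proj v)"
proof -
  have u: "G v \<in> curve_cone" "f (proj v) = proj (G v)" using f v by (auto simp: local_rep_def)
  obtain h where h: "multiplier v G dG h" using multiplier_exists[OF 2 v f] by blast
  obtain h' where h': "multiplier (G v) G' dG' h'" using multiplier_exists[OF 2 u(1) g] by blast
  have "(h * h') *s G' (G v) = 1 *s v"
    by (rule lift_unique[OF 2 v local_rep_compose[OF f g] local_rep_identity(1)[OF v gf]
          multiplier_compose[OF 2 v f h g h'] local_rep_identity(2)[OF v gf]])
  then have hh: "(h * h') *s G' (G v) = v" by simp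
  then have "h \<noteq> 0" using v by (auto simp: curve_cone_def)
  note l = lift_eq[OF 2 v f h]
  show "lift g (lift f v) = v"
    using hh by (simp add: l lift_scale[OF 2 u(1) g \<open>h \<noteq> 0\<close>] lift_eq[OF 2 u(1) g h'] vector_smult_assoc)
  show "lift f v \<in> curve_cone" "proj (lift f v) = f (proj v)"
    using u \<open>h \<noteq> 0\<close> by (simp_all add: l curve_cone_scale proj_scale)
qed

text \<open>Solve one coordinate \<open>j\<close> of the equation defining the multiplier for
  \<open>h\<close>, with \<open>e\<close> and \<open>j\<close> chosen so that the denominator is
  nonzero at \<open>p\<close>. The additional factor \<open>L\<close> makes both sides zero where
  \<open>G\<close> does not represent \<open>f\<close>, so the identity holds on the whole
  cone.\<close>

lemma lift_regular:
  fixes p :: "'k::alg_closed_field ^ 3"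
  assumes 2: "(2::'k) \<noteq> 0" and p: "p \<in> curve_cone" and rep: "local_rep f p d L G dG"
  shows "\<exists>Q P. polynomial_fun Q \<and> (\<forall>i. polynomial_fun (\<lambda>v. P v $ i)) \<and> Q p \<noteq> 0 \<and>
    (\<forall>v\<in>curve_cone. Q v *s lift f v = P v)"
proof -
  have v: "p \<noteq> 0" "G p \<noteq> 0" using p rep by (auto simp: curve_cone_def local_rep_def)
  obtain e where e: "dotp p e \<noteq> 0" using dotp_nondegenerate v(1) by blast
  obtain j where j: "grad (G p) $ j \<noteq> 0" using grad_nonzero[OF 2 v(2)] by (auto simp: vec_eq_iff)
  define Q where "Q v = L v * (dotp v e * grad (G v) $ j)" for v
  define P where "P v = (L v * cross (G v) (dG v (cross (grad v) e)) $ j) *s G v" for v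
  have G: "polynomial_fun (\<lambda>v. G v $ i)" for i using local_rep_coord[OF rep] .
  have L: "polynomial_fun L" using rep local_rep_def by blast
  have grad: "polynomial_fun (\<lambda>v::'k^3. grad v $ i)" for i
    using exhaust_3[of i] by (elim disjE) (simp_all add: grad_def polynomial_fun_intros)
  have cr: "polynomial_fun (\<lambda>v. cross (A v) (B v) $ i)"
    if "\<And>i. polynomial_fun (\<lambda>v. A v $ i)" "\<And>i. polynomial_fun (\<lambda>v. B v $ i)" for A B :: "'k^3 \<Rightarrow> 'k^3" and i
    using exhaust_3[of i] by (elim disjE) (simp_all add: cross_def polynomial_fun_mult polynomial_fun_diff that)
  have w: "polynomial_fun (\<lambda>v. cross (grad v) e $ i)" for i
    by (rule cr[OF grad polynomial_fun_const])
  have dG: "polynomial_fun (\<lambda>v. dG v (cross (grad v) e) $ i)" for i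
  proof -
    have "polyfun (\<lambda>v. G v $ i) (\<lambda>v w. dG v w $ i)" using rep by (simp add: local_rep_def)
    from polyfun_deriv_polynomial_fun[OF this w] show ?thesis .
  qed
  have gradG: "polynomial_fun (\<lambda>v. grad (G v) $ j)"
    using polynomial_fun_compose[of "\<lambda>v. grad v $ j" G] grad G by simp
  have crG: "polynomial_fun (\<lambda>v. cross (G v) (dG v (cross (grad v) e)) $ j)"
    by (rule cr[OF G dG])
  have "polynomial_fun Q"
    unfolding Q_def[abs_def] dotp_def
    by (intro polynomial_fun_mult polynomial_fun_add polynomial_fun_coord polynomial_fun_const L gradG)
  moreover have "polynomial_fun (\<lambda>v. P v $ i)" for i
    unfolding P_def[abs_def] vector_smult_component
    by (intro polynomial_fun_mult L crG G)
  moreover have "Q p \<noteq> 0" using e j rep by (simp add: Q_def local_rep_def)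
  moreover have "Q v *s lift f v = P v" if vc: "v \<in> curve_cone" for v
  proof (cases "L v = 0")
    case False
    note r = local_rep_near[OF rep False]
    obtain h where h: "multiplier v G dG h" using multiplier_exists[OF 2 vc r] by blast
    have "cross (G v) (dG v (cross (grad v) e)) $ j = h * dotp v e * grad (G v) $ j"
      using h by (simp add: multiplier_def)
    then show ?thesis
      by (simp add: Q_def P_def lift_eq[OF 2 vc r h] vector_smult_assoc ac_simps)
  qed (simp add: Q_def P_def)
  ultimately show ?thesis by (intro exI[of _ Q] exI[of _ P]) simp
qed

section \<open>Regular functions on affine charts\<close>

text \<open>Membership in the coordinate ring k[x, y] / (y^4 - f), written in the basis 1, y, y^2,
  y^3 over k[x]. Values off the affine curve are unconstrained.\<close>

definition reduced_on :: "'k::field poly \<Rightarrow> ('k \<Rightarrow> 'k \<Rightarrow> 'k) \<Rightarrow> bool" where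
  "reduced_on f g \<longleftrightarrow> (\<exists>q0 q1 q2 q3. \<forall>x y. y ^ 4 = poly f x \<longrightarrow>
     g x y = poly q0 x + poly q1 x * y + poly q2 x * y ^ 2 + poly q3 x * y ^ 3)"

lemma reduced_onI:
  assumes "\<And>x y. y ^ 4 = poly f x \<Longrightarrow> g x y = poly q0 x + poly q1 x * y + poly q2 x * y ^ 2 + poly q3 x * y ^ 3"
  shows "reduced_on f g"
  using assms unfolding reduced_on_def by blast

lemma reduced_on_cong:
  assumes "reduced_on f g" "\<And>x y. y ^ 4 = poly f x \<Longrightarrow> h x y = g x y"
  shows "reduced_on f h"
  using assms unfolding reduced_on_def by auto

lemma reduced_on_poly: "reduced_on f (\<lambda>x y. poly n x)"
  by (rule reduced_onI[of _ _ n 0 0 0]) simp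

lemma reduced_on_const: "reduced_on f (\<lambda>x y. c)"
  by (rule reduced_onI[of _ _ "[:c:]" 0 0 0]) simp

lemma reduced_on_fst: "reduced_on f (\<lambda>x y. x)"
  by (rule reduced_onI[of _ _ "[:0, 1:]" 0 0 0]) simp

lemma reduced_on_snd: "reduced_on f (\<lambda>x y. y)"
  by (rule reduced_onI[of _ _ 0 1 0 0]) simp

lemma reduced_on_add:
  assumes "reduced_on f g" "reduced_on f h"
  shows "reduced_on f (\<lambda>x y. g x y + h x y)"
proof -
  obtain q0 q1 q2 q3 where q: "\<And>x y. y ^ 4 = poly f x \<Longrightarrow>
     g x y = poly q0 x + poly q1 x * y + poly q2 x * y ^ 2 + poly q3 x * y ^ 3"
    using assms(1) unfolding reduced_on_def by metis
  obtain r0 r1 r2 r3 where r: "\<And>x y. y ^ 4 = poly f x \<Longrightarrow>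
     h x y = poly r0 x + poly r1 x * y + poly r2 x * y ^ 2 + poly r3 x * y ^ 3"
    using assms(2) unfolding reduced_on_def by metis
  show ?thesis
    by (rule reduced_onI[of _ _ "q0 + r0" "q1 + r1" "q2 + r2" "q3 + r3"]) (simp add: q r algebra_simps)
qed

lemma reduced_on_mult:
  assumes "reduced_on f g" "reduced_on f h"
  shows "reduced_on f (\<lambda>x y. g x y * h x y)"
proof -
  obtain q0 q1 q2 q3 where q: "\<And>x y. y ^ 4 = poly f x \<Longrightarrow>
     g x y = poly q0 x + poly q1 x * y + poly q2 x * y ^ 2 + poly q3 x * y ^ 3"
    using assms(1) unfolding reduced_on_def by metis
  obtain r0 r1 r2 r3 where r: "\<And>x y. y ^ 4 = poly f x \<Longrightarrow>
     h x y = poly r0 x + poly r1 x * y + poly r2 x * y ^ 2 + poly r3 x * y ^ 3"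
    using assms(2) unfolding reduced_on_def by metis
  have *: "(q0 + q1 * y + q2 * y\<^sup>2 + q3 * y ^ 3) * (r0 + r1 * y + r2 * y\<^sup>2 + r3 * y ^ 3) =
     (q0 * r0 + (q1 * r3 + q2 * r2 + q3 * r1) * c) + (q0 * r1 + q1 * r0 + (q2 * r3 + q3 * r2) * c) * y
     + (q0 * r2 + q1 * r1 + q2 * r0 + q3 * r3 * c) * y\<^sup>2 + (q0 * r3 + q1 * r2 + q2 * r1 + q3 * r0) * y ^ 3"
    if c: "y ^ 4 = c" for y c q0 q1 q2 q3 r0 r1 r2 r3 :: 'a
    unfolding c[symmetric] by algebra
  show ?thesis
    by (rule reduced_onI[of _ _ "q0 * r0 + (q1 * r3 + q2 * r2 + q3 * r1) * f" "q0 * r1 + q1 * r0 + (q2 * r3 + q3 * r2) * f"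
          "q0 * r2 + q1 * r1 + q2 * r0 + q3 * r3 * f" "q0 * r3 + q1 * r2 + q2 * r1 + q3 * r0"])
      (simp only: q r * poly_add poly_mult)
qed

lemma reduced_on_polynomial_fun:
  assumes "polynomial_fun P" "\<And>i. reduced_on f (\<lambda>x y. W x y $ i)"
  shows "reduced_on f (\<lambda>x y. P (W x y))"
proof -
  obtain dP where "polyfun P dP" using assms(1) polynomial_fun_def by blast
  then show ?thesis
    by (induction rule: polyfun.induct)
      (simp_all add: reduced_on_const assms(2) reduced_on_add reduced_on_mult)
qed

text \<open>The norm of \<open>q\<close> from the coordinate ring to k[x], with \<open>g\<close> the
  product of the other three conjugates. Its value at \<open>a\<close> is the product of the values
  of \<open>q\<close> at the points above \<open>a\<close>, which gives the last clause.\<close>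

lemma reduced_on_norm:
  fixes f :: "'k::alg_closed_field poly"
  assumes "reduced_on f q"
  shows "\<exists>n g. reduced_on f g \<and> (\<forall>x y. y ^ 4 = poly f x \<longrightarrow> poly n x = g x y * q x y) \<and>
    (\<forall>a. (\<forall>b. b ^ 4 = poly f a \<longrightarrow> q a b \<noteq> 0) \<longrightarrow> poly n a \<noteq> 0)"
proof -
  obtain q0 q1 q2 q3 where q: "\<And>x y. y ^ 4 = poly f x \<Longrightarrow>
     q x y = poly q0 x + poly q1 x * y + poly q2 x * y ^ 2 + poly q3 x * y ^ 3"
    using assms(1) unfolding reduced_on_def by metis
  obtain i :: 'k where i: "i ^ 2 = -1" using nth_root_exists[of 2 "-1 :: 'k"] by auto
  have i4: "i ^ 4 = 1" and i3: "i ^ 3 = - i"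
    using i by (simp_all add: power4_eq_xxxx power3_eq_cube power2_eq_square)
  \<comment> \<open>\<open>n\<close> is the norm \<open>q(x, y) q(x, - y) q(x, i y) q(x, - i y)\<close>, and \<open>e0 + e1 y\<^sup>2 = q(x, y) q(x, - y)\<close>\<close>
  define e0 where "e0 = q0 ^ 2 + q2 ^ 2 * f - smult 2 (q1 * q3 * f)"
  define e1 where "e1 = smult 2 (q0 * q2) - q1 ^ 2 - q3 ^ 2 * f"
  define n where "n = e0 ^ 2 - e1 ^ 2 * f"
  define g where "g x y = (poly q0 x + poly (- q1) x * y + poly q2 x * y ^ 2 + poly (- q3) x * y ^ 3) *
     (poly e0 x + poly 0 x * y + poly (- e1) x * y ^ 2 + poly 0 x * y ^ 3)" for x y
  have g: "reduced_on f g"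
    unfolding g_def[abs_def] by (intro reduced_on_mult; rule reduced_onI, rule refl)
  have e: "poly e0 x + poly e1 x * y ^ 2 = q x y * q x (- y)" if y: "y ^ 4 = poly f x" for x y
  proof -
    have "(- y) ^ 4 = poly f x" using y by simp
    have id: "(P0 ^ 2 + P2 ^ 2 * y ^ 4 - 2 * (P1 * P3 * y ^ 4)) + (2 * (P0 * P2) - P1 ^ 2 - P3 ^ 2 * y ^ 4) * y ^ 2
      = (P0 + P1 * y + P2 * y\<^sup>2 + P3 * y ^ 3) * (P0 + P1 * (- y) + P2 * (- y)\<^sup>2 + P3 * (- y) ^ 3)"
      for P0 P1 P2 P3 :: 'k by algebra
    have "poly e0 x = poly q0 x ^ 2 + poly q2 x ^ 2 * y ^ 4 - 2 * (poly q1 x * poly q3 x * y ^ 4)"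
      "poly e1 x = 2 * (poly q0 x * poly q2 x) - poly q1 x ^ 2 - poly q3 x ^ 2 * y ^ 4"
      by (simp_all add: e0_def e1_def poly_power y)
    then show ?thesis unfolding q[OF y] q[OF \<open>(- y) ^ 4 = _\<close>] by (simp only: id)
  qed
  have n: "poly n x = (poly e0 x - poly e1 x * y ^ 2) * (poly e0 x + poly e1 x * y ^ 2)"
    if "y ^ 4 = poly f x" for x y
  proof -
    have *: "poly n x = poly e0 x ^ 2 - poly e1 x ^ 2 * y ^ 4" using that by (simp add: n_def poly_power)
    show ?thesis unfolding * by algebra
  qed
  have "poly n x = g x y * q x y" if y: "y ^ 4 = poly f x" for x y
  proof -
    have "(- y) ^ 4 = poly f x" using y by simp
    from q[OF this] have "g x y = q x (- y) * (poly e0 x - poly e1 x * y ^ 2)"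
      by (simp add: g_def)
    then show ?thesis using n[OF y] e[OF y] by simp
  qed
  moreover have "poly n a \<noteq> 0" if q0: "\<forall>b. b ^ 4 = poly f a \<longrightarrow> q a b \<noteq> 0" for a
  proof -
    obtain b where b: "b ^ 4 = poly f a" using nth_root_exists[of 4 "poly f a"] by auto
    have ib: "(i * b) ^ 4 = poly f a" using b i4 by (simp add: power_mult_distrib)
    have m: "(- b) ^ 4 = poly f a" "(- (i * b)) ^ 4 = poly f a" using b ib by simp_all
    have "poly e0 a + poly e1 a * b ^ 2 \<noteq> 0" using e[OF b] q0 b m by simp
    moreover have "poly e0 a - poly e1 a * b ^ 2 \<noteq> 0"
      using e[OF ib] q0 ib m i by (simp add: power_mult_distrib)
    ultimately show ?thesis using n[OF b] by simp
  qed
  ultimately show ?thesis using g by blast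
qed

text \<open>Take \<open>g\<close> of least degree in \<open>J\<close>. If it had a root
  \<open>a\<close>, some \<open>n\<close> in \<open>J\<close> with n(a) nonzero would leave a
  nonzero remainder modulo \<open>g\<close>, of smaller degree and still in \<open>J\<close>. So
  \<open>g\<close> is constant.\<close>

lemma poly_ideal_without_zeros:
  fixes J :: "'k::alg_closed_field poly set"
  assumes mult: "\<And>p q. q \<in> J \<Longrightarrow> p * q \<in> J"
    and add: "\<And>p q. p \<in> J \<Longrightarrow> q \<in> J \<Longrightarrow> p + q \<in> J"
    and nz: "\<And>a. \<exists>n\<in>J. poly n a \<noteq> 0"
  shows "1 \<in> J"
proof -
  have "\<exists>g. g \<in> J \<and> g \<noteq> 0" using nz[of 0] by auto
  then obtain g where g: "g \<in> J" "g \<noteq> 0" and min: "\<And>p. p \<in> J \<Longrightarrow> p \<noteq> 0 \<Longrightarrow> degree g \<le> degree p"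
    using ex_has_least_nat[of "\<lambda>g. g \<in> J \<and> g \<noteq> 0" _ degree] by blast
  have "degree g = 0"
  proof (rule ccontr)
    assume "degree g \<noteq> 0"
    then obtain a where a: "poly g a = 0" using alg_closed_imp_poly_has_root by blast
    obtain n where n: "n \<in> J" "poly n a \<noteq> 0" using nz by blast
    have "n mod g = n + (- (n div g)) * g" by (simp add: minus_div_mult_eq_mod)
    then have "n mod g \<in> J" using add[OF n(1) mult[OF g(1)]] by metis
    moreover have "poly (n mod g) a \<noteq> 0"
      using n(2) a div_mult_mod_eq[of n g] by (metis add_0 mult_zero_right poly_add poly_mult)
    then have "n mod g \<noteq> 0" by auto
    ultimately show False using min degree_mod_less[of g n] g(2) by fastforce
  qed
  then obtain c where "g = [:c:]" by (metis degree_eq_zeroE)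
  then have "[:1 / c:] * g = 1" using g(2) by (simp add: one_pCons)
  then show ?thesis using mult[OF g(1)] by metis
qed

text \<open>With a denominator \<open>q\<close>, its norm to the polynomials in \<open>x\<close> is also a denominator of \<open>\<alpha>\<close>. At every
  \<open>a\<close> some denominator vanishes at none of the points above \<open>a\<close>, so the ideal of denominators in
  \<open>x\<close> alone has no zero.\<close>

lemma regular_imp_reduced_on:
  fixes f :: "'k::alg_closed_field poly"
  assumes reg: "\<And>a b. b ^ 4 = poly f a \<Longrightarrow> \<exists>q p. reduced_on f q \<and> reduced_on f p \<and> q a b \<noteq> 0 \<and>
    (\<forall>x y. y ^ 4 = poly f x \<longrightarrow> q x y * \<alpha> x y = p x y)"
  shows "reduced_on f \<alpha>"
proof -
  define I where "I = {q. reduced_on f q \<and> reduced_on f (\<lambda>x y. q x y * \<alpha> x y)}"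
  define J where "J = {n. reduced_on f (\<lambda>x y. poly n x * \<alpha> x y)}"
  have "1 \<in> J"
  proof (rule poly_ideal_without_zeros)
    show "p * q \<in> J" if "q \<in> J" for p q
      using that reduced_on_mult[OF reduced_on_poly[of f p]] by (simp add: J_def mult.assoc)
    show "p + q \<in> J" if "p \<in> J" "q \<in> J" for p q
      using that reduced_on_add[of f "\<lambda>x y. poly p x * \<alpha> x y" "\<lambda>x y. poly q x * \<alpha> x y"]
      by (simp add: J_def distrib_right)
    fix a
    \<comment> \<open>Prime avoidance over an infinite field: if \<open>q\<close> serves the points
      treated so far and \<open>r\<close> the new one, then q + t r serves all of them for every
      \<open>t\<close> outside finitely many ratios -q/r.\<close>
    have avoid: "\<exists>q\<in>I. \<forall>b\<in>Y. q a b \<noteq> 0" if "finite Y" "Y \<subseteq> {b. b ^ 4 = poly f a}" for Y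
      using that
    proof (induction Y rule: finite_induct)
      case empty
      have "(\<lambda>x y. 0) \<in> I" by (simp add: I_def reduced_on_const)
      then show ?case by blast
    next
      case (insert b Y)
      then obtain q where q: "q \<in> I" "\<And>b. b \<in> Y \<Longrightarrow> q a b \<noteq> 0" by auto
      have "b ^ 4 = poly f a" using insert.prems by simp
      from reg[OF this] obtain r p where r: "reduced_on f r" "reduced_on f p" "r a b \<noteq> 0"
        "\<And>x y. y ^ 4 = poly f x \<Longrightarrow> r x y * \<alpha> x y = p x y" by blast
      have "r \<in> I" using r(1) reduced_on_cong[OF r(2,4)] by (simp add: I_def)
      have fin: "finite ((\<lambda>y. - q a y / r a y) ` insert b Y)" using insert.hyps by simp
      obtain t where t: "t \<notin> (\<lambda>y. - q a y / r a y) ` insert b Y"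
        using ex_new_if_finite[OF infinite_UNIV_alg_closed fin] by blast
      have "q a y + t * r a y \<noteq> 0" if "y \<in> insert b Y" for y
      proof (cases "r a y = 0")
        case True
        then show ?thesis using that r(3) q(2) by auto
      next
        case False
        then have "t \<noteq> - q a y / r a y" using t that by blast
        then have "t * r a y \<noteq> - q a y" using nonzero_eq_divide_eq[OF False, of t "- q a y"] by blast
        then have "t * r a y + q a y \<noteq> 0" unfolding eq_neg_iff_add_eq_0 .
        then show ?thesis by (simp add: add.commute)
      qed
      moreover have "(\<lambda>x y. q x y + t * r x y) \<in> I"
      proof -
        have qr: "reduced_on f q" "reduced_on f (\<lambda>x y. q x y * \<alpha> x y)"
          "reduced_on f (\<lambda>x y. r x y * \<alpha> x y)"
          using q(1) \<open>r \<in> I\<close> by (simp_all add: I_def)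
        have "reduced_on f (\<lambda>x y. q x y * \<alpha> x y + t * (r x y * \<alpha> x y))"
          by (rule reduced_on_add[OF qr(2) reduced_on_mult[OF reduced_on_const qr(3)]])
        moreover have "reduced_on f (\<lambda>x y. q x y + t * r x y)"
          by (rule reduced_on_add[OF qr(1) reduced_on_mult[OF reduced_on_const r(1)]])
        moreover have "(\<lambda>x y. (q x y + t * r x y) * \<alpha> x y) = (\<lambda>x y. q x y * \<alpha> x y + t * (r x y * \<alpha> x y))"
          by (simp add: distrib_right mult.assoc)
        ultimately show ?thesis by (simp only: I_def mem_Collect_eq simp_thms)
      qed
      ultimately show ?case by (intro bexI[of _ "\<lambda>x y. q x y + t * r x y"] ballI)
    qed
    have fin: "finite {b. b ^ 4 = poly f a}"
    proof -
      have "finite {b. poly (monom 1 4 - [:poly f a:]) b = 0}"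
      proof (rule poly_roots_finite)
        have c: "coeff (monom 1 4 - [:poly f a:]) 4 = 1" by (simp add: coeff_eq_0)
        show "monom 1 4 - [:poly f a:] \<noteq> 0"
        proof
          assume "monom 1 4 - [:poly f a:] = 0"
          from c[unfolded this] show False by simp
        qed
      qed
      then show ?thesis by (simp add: poly_monom)
    qed
    obtain q where q: "q \<in> I" "\<And>b. b ^ 4 = poly f a \<Longrightarrow> q a b \<noteq> 0"
      using avoid[OF fin subset_refl] by auto
    then have "reduced_on f q" by (simp add: I_def)
    from reduced_on_norm[OF this] obtain n g where n: "reduced_on f g"
      "\<And>x y. y ^ 4 = poly f x \<Longrightarrow> poly n x = g x y * q x y" "poly n a \<noteq> 0"
      using q(2) by blast
    have "reduced_on f (\<lambda>x y. q x y * \<alpha> x y)" using q(1) by (simp add: I_def)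
    then have "reduced_on f (\<lambda>x y. g x y * (q x y * \<alpha> x y))"
      by (rule reduced_on_mult[OF n(1)])
    then have "reduced_on f (\<lambda>x y. poly n x * \<alpha> x y)"
    proof (rule reduced_on_cong)
      fix x y assume "y ^ 4 = poly f x"
      from n(2)[OF this] show "poly n x * \<alpha> x y = g x y * (q x y * \<alpha> x y)" by (simp add: mult.assoc)
    qed
    then show "\<exists>n\<in>J. poly n a \<noteq> 0" using n(3) by (auto simp: J_def)
  qed
  then show ?thesis by (simp add: J_def)
qed

section \<open>From regular functions on two charts to linear forms\<close>

lemma poly_eq_cofinite:
  fixes p q :: "'k::alg_closed_field poly"
  assumes "finite S" "\<And>x. x \<notin> S \<Longrightarrow> poly p x = poly q x"
  shows "p = q"
proof (rule ccontr)
  assume "p \<noteq> q"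
  then have "finite {x. poly (p - q) x = 0}" by (intro poly_roots_finite) simp
  then have "finite (S \<union> {x. poly (p - q) x = 0})" using assms(1) by simp
  moreover have "S \<union> {x. poly (p - q) x = 0} = UNIV" using assms(2) by auto
  ultimately show False using infinite_UNIV_alg_closed by metis
qed

text \<open>The right side has a pole of order at most 1 at infinity, the left side one of order
  degree p + j. Multiplying by x^(degree q) turns q(1/x) into \<open>reflect_poly q\<close>, after
  which degrees can be compared.\<close>

lemma degree_bound_at_infinity:
  fixes p q :: "'k::alg_closed_field poly"
  assumes S: "finite S" and eq: "\<And>x. x \<notin> S \<Longrightarrow> x \<noteq> 0 \<Longrightarrow> x ^ j * poly p x = x * poly q (inverse x)"
  shows "p = 0 \<or> degree p + j \<le> 1"
proof (cases "p = 0")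
  case False
  define n where "n = degree q"
  have "monom 1 (n + j) * p = monom 1 1 * reflect_poly q"
  proof (rule poly_eq_cofinite)
    show "finite (insert 0 S)" using S by simp
    fix x assume "x \<notin> insert 0 S"
    then have x: "x \<notin> S" "x \<noteq> 0" by auto
    then show "poly (monom 1 (n + j) * p) x = poly (monom 1 1 * reflect_poly q) x"
      using eq[OF x] by (simp add: poly_monom poly_reflect_poly_nz n_def power_add mult.assoc)
  qed
  then have "degree (monom 1 (n + j) * p) = degree (monom (1::'k) 1 * reflect_poly q)" by simp
  moreover have "degree (monom 1 (n + j) * p) = n + j + degree p"
    using False by (simp add: degree_mult_eq degree_monom_eq)
  moreover have "degree (monom (1::'k) 1 * reflect_poly q) \<le> 1 + n"
    using degree_mult_le[of "monom (1::'k) 1" "reflect_poly q"] degree_reflect_poly_le[of q]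
    by (simp add: degree_monom_eq n_def)
  ultimately show ?thesis by simp
qed simp

text \<open>The charts z = 1 and x = 1 cover the curve, since x = z = 0 forces y = 0. Passing from
  (x, y, 1) to (1, y/x, 1/x), the coefficients of y^j satisfy a_j(x) = x^(1-j) b_j(1/x). Hence a_0
  has degree at most 1, a_1 is constant and a_2 = a_3 = 0: global sections of O(1) are linear
  forms.\<close>

lemma linear_of_charts:
  fixes A :: "'k::alg_closed_field ^ 3 \<Rightarrow> 'k"
  assumes 2: "(2::'k) \<noteq> 0"
    and scale: "\<And>a v. v \<in> curve_cone \<Longrightarrow> a \<noteq> 0 \<Longrightarrow> A (a *s v) = a * A v"
    and z: "reduced_on [:2, 0, -4, 0, 1:] (\<lambda>x y. A (vector [x, y, 1]))"
    and x: "reduced_on [:1, 0, -4, 0, 2:] (\<lambda>z y. A (vector [1, y, z]))"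
  shows "\<exists>m. \<forall>v\<in>curve_cone. A v = dotp m v"
proof -
  have pz: "poly [:2, 0, -4, 0, 1:] x = cheb_form x 1" and px: "poly [:1, 0, -4, 0, 2:] z = cheb_form 1 z" for x z :: 'k
    by (simp_all add: cheb_form_def algebra_simps power4_eq_xxxx power2_eq_square)
  obtain a0 a1 a2 a3 where a: "\<And>x y. y ^ 4 = cheb_form x 1 \<Longrightarrow>
     A (vector [x, y, 1]) = poly a0 x + poly a1 x * y + poly a2 x * y ^ 2 + poly a3 x * y ^ 3"
    using z unfolding reduced_on_def pz by metis
  obtain b0 b1 b2 b3 where b: "\<And>z y. y ^ 4 = cheb_form 1 z \<Longrightarrow>
     A (vector [1, y, z]) = poly b0 z + poly b1 z * y + poly b2 z * y ^ 2 + poly b3 z * y ^ 3"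
    using x unfolding reduced_on_def px by metis
  \<comment> \<open>The branch points, where the four values of y collapse to y = 0 and coefficients
    cannot be compared; there are finitely many.\<close>
  define S where "S = {x::'k. cheb_form x 1 = 0}"
  have S: "finite S"
    unfolding S_def pz[symmetric] by (rule poly_roots_finite) simp
  have glue: "poly a0 x - x * poly b0 (inverse x) = 0 \<and> poly a1 x - poly b1 (inverse x) = 0 \<and>
      poly a2 x - inverse x * poly b2 (inverse x) = 0 \<and> poly a3 x - inverse x ^ 2 * poly b3 (inverse x) = 0"
    if x0: "x \<notin> S" "x \<noteq> 0" for x
  proof (rule cubic_vanishing_at_fourth_roots[OF 2])
    show "cheb_form x 1 \<noteq> 0" using x0 by (simp add: S_def)
    fix y assume y: "y ^ 4 = cheb_form x 1"
    have u: "(vector [1, y / x, inverse x] :: 'k ^ 3) = inverse x *s vector [x, y, 1]"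
      using x0 by (intro vec3_eqI) (simp_all add: divide_inverse mult.commute)
    moreover have c: "(vector [x, y, 1] :: 'k ^ 3) \<in> curve_cone"
      using y by (simp add: curve_cone_def vec3_nonzero quartic_def)
    moreover have y': "(y / x) ^ 4 = cheb_form 1 (inverse x)"
      using curve_cone_scale[OF _ c, of "inverse x"] x0(2) unfolding u[symmetric]
      by (simp add: curve_cone_def quartic_def)
    ultimately have "A (vector [1, y / x, inverse x]) = inverse x * A (vector [x, y, 1])"
      using scale[OF c, of "inverse x"] x0 by simp
    then have "x * A (vector [1, y / x, inverse x]) = A (vector [x, y, 1])"
      using x0 by simp
    then show "(poly a0 x - x * poly b0 (inverse x)) + (poly a1 x - poly b1 (inverse x)) * y +
      (poly a2 x - inverse x * poly b2 (inverse x)) * y\<^sup>2 +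
      (poly a3 x - inverse x ^ 2 * poly b3 (inverse x)) * y ^ 3 = 0"
      unfolding a[OF y] b[OF y'] using x0(2)
      by (simp add: field_simps power2_eq_square power3_eq_cube)
  qed
  define S' where "S' = inverse ` S"
  have S': "finite S'" using S by (simp add: S'_def)
  have inv: "inverse z \<notin> S \<and> inverse z \<noteq> 0" if "z \<notin> S'" "z \<noteq> 0" for z
    using that by (auto simp: S'_def image_iff)
  have "a0 = 0 \<or> degree a0 + 0 \<le> 1"
    by (rule degree_bound_at_infinity[OF S, of _ _ b0]) (use glue in auto)
  then have "degree a0 \<le> 1" by auto
  then have "a0 = [:coeff a0 0, coeff a0 1:]"
    by (intro poly_eqI) (auto simp: coeff_pCons coeff_eq_0 split: nat.split)
  then obtain c0 c1 where c: "a0 = [:c0, c1:]" by blast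
  have a1: "a1 = 0 \<or> degree a1 + 1 \<le> 1"
    by (rule degree_bound_at_infinity[OF S, of _ _ b1]) (use glue in auto)
  then obtain d where d: "a1 = [:d:]" by (metis add_le_same_cancel2 degree_0 degree_eq_zeroE le_zero_eq)
  have "a2 = 0 \<or> degree a2 + 2 \<le> 1"
    by (rule degree_bound_at_infinity[OF S, of _ _ b2]) (use glue in \<open>auto simp: field_simps power2_eq_square\<close>)
  then have a2: "a2 = 0" by simp
  have "a3 = 0 \<or> degree a3 + 3 \<le> 1"
    by (rule degree_bound_at_infinity[OF S, of _ _ b3]) (use glue in \<open>auto simp: field_simps power2_eq_square power3_eq_cube\<close>)
  then have a3: "a3 = 0" by simp
  \<comment> \<open>The second chart is computed back from the first, for the sake of the points
    with z = 0.\<close>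
  have b0: "b0 = [:c1, c0:]"
  proof (rule poly_eq_cofinite)
    show "finite (insert 0 S')" using S' by simp
    fix z assume z: "z \<notin> insert 0 S'"
    then have "poly a0 (inverse z) - inverse z * poly b0 z = 0"
      using inv[of z] glue[of "inverse z"] by auto
    then show "poly b0 z = poly [:c1, c0:] z" using z by (simp add: c field_simps)
  qed
  have b1: "b1 = [:d:]"
  proof (rule poly_eq_cofinite)
    show "finite (insert 0 S')" using S' by simp
    fix z assume z: "z \<notin> insert 0 S'"
    then have "poly a1 (inverse z) - poly b1 z = 0"
      using inv[of z] glue[of "inverse z"] by auto
    then show "poly b1 z = poly [:d:] z" by (simp add: d)
  qed
  have b2: "b2 = 0"
  proof (rule poly_eq_cofinite)
    show "finite (insert 0 S')" using S' by simp
    fix z assume z: "z \<notin> insert 0 S'"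
    then have "poly a2 (inverse z) - z * poly b2 z = 0"
      using inv[of z] glue[of "inverse z"] by auto
    then show "poly b2 z = poly 0 z" using z by (simp add: a2)
  qed
  have b3: "b3 = 0"
  proof (rule poly_eq_cofinite)
    show "finite (insert 0 S')" using S' by simp
    fix z assume z: "z \<notin> insert 0 S'"
    then have "poly a3 (inverse z) - z ^ 2 * poly b3 z = 0"
      using inv[of z] glue[of "inverse z"] by auto
    then show "poly b3 z = poly 0 z" using z by (simp add: a3)
  qed
  have "A v = dotp (vector [c1, d, c0]) v" if v: "v \<in> curve_cone" for v
  proof (cases "v $ 3 = 0")
    case False
    define u where "u = (vector [v $ 1 / v $ 3, v $ 2 / v $ 3, 1] :: 'k ^ 3)"
    have vu: "v = v $ 3 *s u" using False by (intro vec3_eqI) (simp_all add: u_def)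
    have "u = inverse (v $ 3) *s v" using False by (intro vec3_eqI) (simp_all add: u_def field_simps)
    then have uc: "u \<in> curve_cone" using curve_cone_scale[of "inverse (v $ 3)" v] False v by simp
    then have "(v $ 2 / v $ 3) ^ 4 = cheb_form (v $ 1 / v $ 3) 1"
      by (simp add: curve_cone_def quartic_def u_def)
    from a[OF this] have "A u = c0 + c1 * (v $ 1 / v $ 3) + d * (v $ 2 / v $ 3)"
      by (simp add: u_def c d a2 a3)
    moreover have "A v = v $ 3 * A u" using scale[OF uc False] vu by simp
    ultimately show ?thesis using False by (simp add: dotp_def field_simps)
  next
    case True
    then have 1: "v $ 1 \<noteq> 0"
      using v by (auto simp: curve_cone_def quartic_def cheb_form_def vec3_nonzero)
    define u where "u = (vector [1, v $ 2 / v $ 1, 0] :: 'k ^ 3)"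
    have vu: "v = v $ 1 *s u" using True 1 by (intro vec3_eqI) (simp_all add: u_def)
    have "u = inverse (v $ 1) *s v" using True 1 by (intro vec3_eqI) (simp_all add: u_def field_simps)
    then have uc: "u \<in> curve_cone" using curve_cone_scale[of "inverse (v $ 1)" v] 1 v by simp
    then have "(v $ 2 / v $ 1) ^ 4 = cheb_form 1 0"
      by (simp add: curve_cone_def quartic_def u_def)
    from b[OF this] have "A u = c1 + d * (v $ 2 / v $ 1)"
      by (simp add: u_def b0 b1 b2 b3)
    moreover have "A v = v $ 1 * A u" using scale[OF uc 1] vu by simp
    ultimately show ?thesis using 1 True by (simp add: dotp_def field_simps)
  qed
  then show ?thesis by blast
qed

lemma lift_linear:
  fixes f :: "('k::alg_closed_field ^ 3) set \<Rightarrow> ('k ^ 3) set"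
  assumes 2: "(2::'k) \<noteq> 0"
    and rep: "\<And>v. v \<in> curve_cone \<Longrightarrow> \<exists>d L G dG. local_rep f v d L G dG"
  shows "\<exists>M :: 'k ^ 3 ^ 3. \<forall>v\<in>curve_cone. lift f v = M *v v"
proof -
  have comp: "\<exists>m. \<forall>v\<in>curve_cone. lift f v $ i = dotp m v" for i
  proof (rule linear_of_charts[OF 2])
    show "lift f (a *s v) $ i = a * lift f v $ i" if "v \<in> curve_cone" "a \<noteq> 0" for a v
    proof -
      obtain d L G dG where "local_rep f v d L G dG" using rep[OF \<open>v \<in> _\<close>] by blast
      from lift_scale[OF 2 \<open>v \<in> _\<close> this \<open>a \<noteq> 0\<close>] show ?thesis by simp
    qed
    \<comment> \<open>\<open>W\<close> parametrises an affine chart of the cone; the local fractions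
      from \<open>lift_regular\<close> pull back along it to fractions in the coordinate ring of the
      chart.\<close>
    have chart: "reduced_on \<phi> (\<lambda>x y. lift f (W x y) $ i)"
      if W: "\<And>x y. y ^ 4 = poly \<phi> x \<Longrightarrow> W x y \<in> curve_cone" "\<And>j. reduced_on \<phi> (\<lambda>x y. W x y $ j)" for \<phi> W
    proof (rule regular_imp_reduced_on)
      fix a b assume ab: "b ^ 4 = poly \<phi> a"
      have c: "W a b \<in> curve_cone" using W(1)[OF ab] .
      obtain d L G dG where r: "local_rep f (W a b) d L G dG" using rep[OF c] by blast
      obtain Q P where Q: "polynomial_fun Q" "\<And>i. polynomial_fun (\<lambda>v. P v $ i)" "Q (W a b) \<noteq> 0"
        "\<And>v. v \<in> curve_cone \<Longrightarrow> Q v *s lift f v = P v"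
        using lift_regular[OF 2 c r] by blast
      have 1: "reduced_on \<phi> (\<lambda>x y. Q (W x y))" using reduced_on_polynomial_fun[of Q] Q(1) W(2) by simp
      have 2: "reduced_on \<phi> (\<lambda>x y. P (W x y) $ i)"
        using reduced_on_polynomial_fun[of "\<lambda>v. P v $ i"] Q(2) W(2) by simp
      have 3: "Q (W x y) * lift f (W x y) $ i = P (W x y) $ i" if "y ^ 4 = poly \<phi> x" for x y
        using Q(4)[OF W(1)[OF that]] by (metis vector_smult_component)
      show "\<exists>q p. reduced_on \<phi> q \<and> reduced_on \<phi> p \<and> q a b \<noteq> 0 \<and>
        (\<forall>x y. y ^ 4 = poly \<phi> x \<longrightarrow> q x y * lift f (W x y) $ i = p x y)"
        by (rule exI[of _ "\<lambda>x y. Q (W x y)"], rule exI[of _ "\<lambda>x y. P (W x y) $ i"])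
          (simp add: 1 2 3 Q(3))
    qed
    have pz: "poly [:2, 0, -4, 0, 1:] x = cheb_form x 1" and px: "poly [:1, 0, -4, 0, 2:] z = cheb_form 1 z" for x z :: 'k
      by (simp_all add: cheb_form_def algebra_simps power4_eq_xxxx power2_eq_square)
    show "reduced_on [:2, 0, -4, 0, 1:] (\<lambda>x y. lift f (vector [x, y, 1]) $ i)"
    proof (rule chart)
      show "vector [x, y, 1] \<in> (curve_cone :: ('k ^ 3) set)" if "y ^ 4 = poly [:2, 0, -4, 0, 1:] x" for x y
        using that unfolding pz by (simp add: curve_cone_def quartic_def vec3_nonzero)
      show "reduced_on [:2, 0, -4, 0, 1:] (\<lambda>x y. (vector [x, y, 1] :: 'k ^ 3) $ j)" for j
        using exhaust_3[of j] by (elim disjE) (simp_all add: reduced_on_const reduced_on_fst reduced_on_snd)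
    qed
    show "reduced_on [:1, 0, -4, 0, 2:] (\<lambda>z y. lift f (vector [1, y, z]) $ i)"
    proof (rule chart)
      show "vector [1, y, z] \<in> (curve_cone :: ('k ^ 3) set)" if "y ^ 4 = poly [:1, 0, -4, 0, 2:] z" for z y
        using that unfolding px by (simp add: curve_cone_def quartic_def vec3_nonzero)
      show "reduced_on [:1, 0, -4, 0, 2:] (\<lambda>z y. (vector [1, y, z] :: 'k ^ 3) $ j)" for j
        using exhaust_3[of j] by (elim disjE) (simp_all add: reduced_on_const reduced_on_fst reduced_on_snd)
    qed
  qed
  then obtain m where m: "\<And>i v. v \<in> curve_cone \<Longrightarrow> lift f v $ i = dotp (m i) v" by metis
  have "lift f v = (\<chi> i. m i) *v v" if "v \<in> curve_cone" for v
    using m[OF that] by (simp add: vec_eq_iff matrix_vector_mult_def sum_3 dotp_def)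
  then show ?thesis by blast
qed

section \<open>Automorphisms are linear\<close>

lemma proj_in_curveD:
  assumes "proj v \<in> proj ` curve_cone" "v \<noteq> 0"
  shows "v \<in> curve_cone"
proof -
  obtain u where u: "u \<in> curve_cone" "proj v = proj u" using assms(1) by blast
  obtain c where "c \<noteq> 0" "v = c *s u" using proj_eqD[OF u(2) assms(2)] by blast
  then show ?thesis using curve_cone_scale u(1) by blast
qed

text \<open>The complement of \<open>U\<close> is cut out by forms, one of which does not vanish at
  \<open>v\<close>. The set where that form \<open>L\<close> is nonzero lies in \<open>U\<close>, so
  \<open>F\<close> represents \<open>f\<close> on it.\<close>

lemma morphism_local_rep:
  fixes v :: "'k::alg_closed_field ^ 3"
  assumes f: "proj_morphism (proj ` curve_cone) (proj ` curve_cone) f" and v: "v \<in> curve_cone"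
  shows "\<exists>d L G dG. local_rep f v d L G dG"
proof -
  have "proj v \<in> proj ` curve_cone" using v by blast
  then obtain U d F where U: "zariski_open U" "proj v \<in> U"
    and F: "\<And>i. ternary_form d (\<lambda>v. F v $ i)"
    and fF: "\<And>u. u \<noteq> 0 \<Longrightarrow> proj u \<in> U \<inter> proj ` curve_cone \<Longrightarrow> F u \<noteq> 0 \<and> f (proj u) = proj (F u)"
    using f unfolding proj_morphism_def by meson
  obtain \<F> where \<F>: "\<And>L. L \<in> \<F> \<Longrightarrow> \<exists>d. ternary_form d L" "proj_plane - U = zero_locus \<F>"
    using U(1) unfolding zariski_open_def zariski_closed_def by blast
  have v0: "v \<noteq> 0" using v by (simp add: curve_cone_def)
  have "proj v \<notin> zero_locus \<F>" using U(2) \<F>(2) by blast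
  then obtain L where L: "L \<in> \<F>" "L v \<noteq> 0" using proj_mem_zero_locus[OF \<F>(1) v0] by blast
  obtain m where m: "ternary_form m L" using \<F>(1) L(1) by blast
  have "\<exists>dP. polyfun (\<lambda>v. F v $ i) dP" for i
    using ternary_form_polynomial_fun[OF F[of i]] by (simp add: polynomial_fun_def)
  then obtain dF where dF: "\<And>i. polyfun (\<lambda>v. F v $ i) (dF i)" by metis
  have "local_rep f v d L F (\<lambda>v w. \<chi> i. dF i v w)"
    unfolding local_rep_def
  proof (intro conjI allI ballI impI)
    show "polynomial_fun L" by (rule ternary_form_polynomial_fun[OF m])
    show "\<exists>m. \<forall>a v. L (a *s v) = a ^ m * L v" using ternary_form_scale[OF m] by blast
    show "polyfun (\<lambda>v. F v $ i) (\<lambda>v w. (\<chi> i. dF i v w) $ i)" for i using dF[of i] by simp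
    show "F (a *s v) = a ^ d *s F v" for a v
      using ternary_form_scale[OF F] by (simp add: vec_eq_iff)
    fix u :: "'k ^ 3" assume u: "u \<in> curve_cone" "L u \<noteq> 0"
    then have u0: "u \<noteq> 0" by (simp add: curve_cone_def)
    have "proj u \<notin> zero_locus \<F>" using proj_mem_zero_locus[OF \<F>(1) u0] u(2) L(1) by blast
    moreover have "proj u \<in> proj_plane" using u0 by (auto simp: proj_plane_def)
    ultimately have "proj u \<in> U \<inter> proj ` curve_cone" using \<F>(2) u(1) by blast
    then have Fu: "F u \<noteq> 0" "f (proj u) = proj (F u)" using fF[OF u0] by auto
    then show "f (proj u) = proj (F u)" by blast
    have "f (proj u) \<in> proj ` curve_cone"
      using f u(1) unfolding proj_morphism_def by blast
    then show "F u \<in> curve_cone" using proj_in_curveD Fu by metis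
  qed (rule L(2))
  then show ?thesis by blast
qed

lemma matrix_vector_mult_3:
  "((M :: 'a::semiring_1 ^ 3 ^ 3) *v v) $ i = M $ i $ 1 * v $ 1 + M $ i $ 2 * v $ 2 + M $ i $ 3 * v $ 3"
  by (simp add: matrix_vector_mult_def sum_3)

lemma matrix_vector_scale: "(M :: 'a::field ^ 3 ^ 3) *v (c *s v) = c *s (M *v v)"
  by (intro vec3_eqI) (simp_all add: matrix_vector_mult_3 algebra_simps)

text \<open>The cone spans the space: (1, 1, 0), (1, -1, 0) and (0, y, 1) with y^4 = 2 lie on it,
  and their determinant is -2.\<close>

lemma identity_on_cone:
  fixes M :: "'k::alg_closed_field ^ 3 ^ 3"
  assumes 2: "(2::'k) \<noteq> 0" and id: "\<And>v. v \<in> curve_cone \<Longrightarrow> M *v v = v"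
  shows "M = mat 1"
proof -
  obtain y :: 'k where y: "y ^ 4 = 2" using nth_root_exists[of 4 2] by auto
  have "vector [1, 1, 0] \<in> (curve_cone :: ('k ^ 3) set)" "vector [1, -1, 0] \<in> (curve_cone :: ('k ^ 3) set)"
    "vector [0, y, 1] \<in> (curve_cone :: ('k ^ 3) set)"
    by (simp_all add: curve_cone_def quartic_def cheb_form_def vec3_nonzero y)
  note v = this[THEN id]
  have e: "M $ i $ 1 + M $ i $ 2 = (vector [1, 1, 0] :: 'k ^ 3) $ i"
    "M $ i $ 1 - M $ i $ 2 = (vector [1, -1, 0] :: 'k ^ 3) $ i"
    "M $ i $ 2 * y + M $ i $ 3 = (vector [0, y, 1] :: 'k ^ 3) $ i" for i
    using v[THEN arg_cong, of "\<lambda>u. u $ i"] by (simp_all add: matrix_vector_mult_3)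
  have half: "a = b" if "a + a = b + b" for a b :: 'k
  proof -
    have "2 * a = 2 * b" using that by (simp only: mult_2)
    then show ?thesis using 2 by simp
  qed
  have s: "M $ i $ 1 + M $ i $ 1 = (vector [1, 1, 0] :: 'k ^ 3) $ i + (vector [1, -1, 0] :: 'k ^ 3) $ i" for i
    unfolding e(1,2)[of i, symmetric] by simp
  have "M $ 1 $ 1 = 1" "M $ 2 $ 1 = 0" "M $ 3 $ 1 = 0"
  proof -
    have "M $ 1 $ 1 + M $ 1 $ 1 = 1 + 1" "M $ 2 $ 1 + M $ 2 $ 1 = 0 + 0" "M $ 3 $ 1 + M $ 3 $ 1 = 0 + 0"
      using s[of 1] s[of 2] s[of 3] by (simp_all only: vector_3) simp_all
    from this[THEN half] show "M $ 1 $ 1 = 1" "M $ 2 $ 1 = 0" "M $ 3 $ 1 = 0" by blast+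
  qed
  moreover from this have "M $ 1 $ 2 = 0" "M $ 2 $ 2 = 1" "M $ 3 $ 2 = 0"
    using e(1)[of 1] e(1)[of 2] e(1)[of 3] by simp_all
  moreover from this have "M $ 1 $ 3 = 0" "M $ 2 $ 3 = 0" "M $ 3 $ 3 = 1"
    using e(3)[of 1] e(3)[of 2] e(3)[of 3] by simp_all
  ultimately show ?thesis by (simp add: vec_eq_iff forall_3 mat_def)
qed

text \<open>The map and its inverse both lift to restrictions of linear maps, and the lifts are
  inverse to each other on the cone. Since the cone spans, the matrices themselves are
  inverse.\<close>

lemma automorphism_linear:
  fixes f :: "('k::alg_closed_field ^ 3) set \<Rightarrow> ('k ^ 3) set"
  assumes 2: "(2::'k) \<noteq> 0" and f: "f \<in> variety_aut (proj ` curve_cone)"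
  shows "\<exists>M M'. M' ** M = mat 1 \<and> (\<forall>v\<in>curve_cone. M *v v \<in> curve_cone \<and> f (proj v) = proj (M *v v))"
proof -
  let ?C = "proj ` (curve_cone :: ('k ^ 3) set)"
  define g where "g = inv_into ?C f"
  have bij: "bij_betw f ?C ?C" and fm: "proj_morphism ?C ?C f" and gm: "proj_morphism ?C ?C g"
    using f by (auto simp: variety_aut_def Bij_def g_def)
  note rep = morphism_local_rep[OF fm] morphism_local_rep[OF gm]
  have gf: "g (f (proj u)) = proj u" if "u \<in> curve_cone" for u
    using bij that by (simp add: g_def bij_betw_def)
  obtain M :: "'k ^ 3 ^ 3" where M: "\<And>v. v \<in> curve_cone \<Longrightarrow> lift f v = M *v v"
    using lift_linear[OF 2 rep(1)] by blast
  obtain M' :: "'k ^ 3 ^ 3" where M': "\<And>v. v \<in> curve_cone \<Longrightarrow> lift g v = M' *v v"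
    using lift_linear[OF 2 rep(2)] by blast
  have *: "lift g (lift f v) = v \<and> lift f v \<in> curve_cone \<and> proj (lift f v) = f (proj v)" if v: "v \<in> curve_cone" for v
  proof -
    obtain d L G dG where r: "local_rep f v d L G dG" using rep(1)[OF v] by blast
    have "G v \<in> curve_cone" using r v by (simp add: local_rep_def)
    then obtain d' L' G' dG' where r': "local_rep g (G v) d' L' G' dG'" using rep(2) by blast
    show ?thesis by (intro conjI lift_lift_inverse[OF 2 v r r' gf])
  qed
  have "(M' ** M) *v v = v" if "v \<in> curve_cone" for v
  proof -
    have "M' *v (M *v v) = v" using *[OF that] M'[of "M *v v"] unfolding M[OF that] by simp
    then show ?thesis by (simp only: matrix_vector_mul_assoc)
  qed
  then have "M' ** M = mat 1" by (rule identity_on_cone[OF 2])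
  moreover have "M *v v \<in> curve_cone \<and> f (proj v) = proj (M *v v)" if "v \<in> curve_cone" for v
    using *[OF that] unfolding M[OF that] by simp
  ultimately show ?thesis by (intro exI[of _ M] exI[of _ M'] conjI ballI) blast+
qed

text \<open>The pullback vanishes on the cone, hence is \<open>Q * quartic\<close>. Both sides scale
  by t^4, so \<open>Q\<close> is constant on each line through the origin off the cone, with value
  \<open>Q 0\<close>. It is nonzero because \<open>M\<close> is onto and \<open>quartic\<close> is
  not identically zero.\<close>

lemma quartic_scaled_by_matrix:
  fixes M :: "'k::alg_closed_field ^ 3 ^ 3"
  assumes 2: "(2::'k) \<noteq> 0" and inv: "M ** M' = mat 1"
    and cone: "\<And>v. v \<in> curve_cone \<Longrightarrow> M *v v \<in> curve_cone"
  shows "\<exists>c. c \<noteq> 0 \<and> (\<forall>v. quartic (M *v v) = c * quartic v)"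
proof -
  have pM: "polynomial_fun (\<lambda>v. (M *v v) $ i)" for i
    unfolding matrix_vector_mult_3 by (simp add: polynomial_fun_intros)
  have "\<exists>Q. polynomial_fun Q \<and> (\<forall>v. quartic (M *v v) = Q v * quartic v)"
  proof (rule quartic_divides[OF 2])
    show "polynomial_fun (\<lambda>v. quartic (M *v v))"
      using polynomial_fun_compose[OF polynomial_fun_quartic, of "\<lambda>v. M *v v"] pM by simp
    show "yfree (\<lambda>v::'k^3. v $ 1)" by (rule yfree_intros)
    show "(axis 1 1 :: 'k ^ 3) $ 1 \<noteq> 0" by simp
    show "quartic (M *v v) = 0" if "quartic v = 0" "v $ 1 \<noteq> 0" for v
      using cone[of v] that by (auto simp: curve_cone_def vec3_nonzero)
  qed
  then obtain Q where Q: "polynomial_fun Q" "\<And>v. quartic (M *v v) = Q v * quartic v" by blast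
  obtain dQ where dQ: "polyfun Q dQ" using Q(1) polynomial_fun_def by blast
  have const: "Q v = Q 0" if v: "quartic v \<noteq> 0" for v
  proof -
    obtain q where q: "\<And>t. Q (0 + t *s v) = poly q t" using polyfun_line[OF dQ, of 0 v] by blast
    have "q = [:Q v:]"
    proof (rule poly_eq_cofinite)
      show "finite {0::'k}" by simp
      fix t :: 'k assume t: "t \<notin> {0}"
      have "t ^ 4 * (Q (t *s v) * quartic v) = t ^ 4 * (Q v * quartic v)"
        using Q(2)[of "t *s v"] Q(2)[of v] by (auto simp: matrix_vector_scale quartic_scale)
      then have "Q (t *s v) = Q v" using t v by simp
      then show "poly q t = poly [:Q v:] t" using q[of t] by simp
    qed
    then show ?thesis using q[of 0] by simp
  qed
  have *: "quartic (M *v v) = Q 0 * quartic v" for v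
    using Q(2)[of v] const[of v] by (cases "quartic v = 0") auto
  have "Q 0 \<noteq> 0"
  proof
    assume "Q 0 = 0"
    moreover have "M *v (M' *v axis 2 1) = axis 2 1"
      by (simp add: matrix_vector_mul_assoc inv)
    ultimately have "quartic (axis 2 1 :: 'k ^ 3) = 0" using *[of "M' *v axis 2 1"] by simp
    then show False by (simp add: quartic_def cheb_form_def axis_def)
  qed
  then show ?thesis using * by blast
qed

section \<open>Linear symmetries of the quartic\<close>

text \<open>The hypotheses are the coefficients, divided by 4, of p (8 x z^2 - 4 x^3) + r (8 x^2 z -
  8 z^3) = 4 l (a x + c z)^3. Eliminating \<open>p\<close> and \<open>r\<close> gives a (3 c^2 + 2
  a^2) = 0 and c (c^2 + 3 a^2) = 0; for \<open>a\<close> nonzero these leave 2 a^2 = 0 or 7 a^2 =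
  0.\<close>

lemma cube_polar_zero:
  fixes a c l p r :: "'k::field"
  assumes "(2::'k) \<noteq> 0" "(7::'k) \<noteq> 0" "l \<noteq> 0"
    and "- 2 * r = l * c ^ 3" "2 * p = 3 * l * c ^ 2 * a" "2 * r = 3 * l * c * a ^ 2" "- p = l * a ^ 3"
  shows "p = 0 \<and> r = 0"
proof -
  have "l * (a * (3 * c ^ 2 + 2 * a ^ 2)) = 3 * l * c ^ 2 * a + 2 * (l * a ^ 3)" by algebra
  also have "\<dots> = 2 * p + 2 * (- p)" using assms(5,7) by simp
  finally have "l * (a * (3 * c ^ 2 + 2 * a ^ 2)) = 0" by simp
  then have 1: "a = 0 \<or> 3 * c ^ 2 + 2 * a ^ 2 = 0" using assms(3) by simp
  have "l * (c * (c ^ 2 + 3 * a ^ 2)) = l * c ^ 3 + 3 * l * c * a ^ 2" by algebra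
  also have "\<dots> = - 2 * r + 2 * r" using assms(4,6) by simp
  finally have "l * (c * (c ^ 2 + 3 * a ^ 2)) = 0" by simp
  then have 2: "c = 0 \<or> c ^ 2 + 3 * a ^ 2 = 0" using assms(3) by simp
  have "a = 0"
  proof (rule ccontr)
    assume a: "a \<noteq> 0"
    then have e: "3 * c ^ 2 + 2 * a ^ 2 = 0" using 1 by simp
    have "7 * a ^ 2 = 0 \<or> 2 * a ^ 2 = 0" using 2
    proof
      assume "c ^ 2 + 3 * a ^ 2 = 0"
      moreover have "7 * a ^ 2 = 3 * (c ^ 2 + 3 * a ^ 2) - (3 * c ^ 2 + 2 * a ^ 2)" by algebra
      ultimately show ?thesis using e by simp
    qed (use e in simp)
    then show False using a assms(1,2) by simp
  qed
  then show ?thesis using assms by simp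
qed

lemma matrix_block_form:
  fixes M :: "'k::alg_closed_field ^ 3 ^ 3"
  assumes 2: "(2::'k) \<noteq> 0" and 7: "(7::'k) \<noteq> 0" and inv: "M ** M' = mat 1" "M' ** M = mat 1"
    and "l \<noteq> 0" and q: "\<And>v. quartic (M *v v) = l * quartic v"
  shows "M $ 1 $ 2 = 0 \<and> M $ 3 $ 2 = 0 \<and> M $ 2 $ 1 = 0 \<and> M $ 2 $ 3 = 0 \<and> M $ 2 $ 2 \<noteq> 0 \<and>
    (\<forall>x z. cheb_form (M $ 1 $ 1 * x + M $ 1 $ 3 * z) (M $ 3 $ 1 * x + M $ 3 $ 3 * z) = (M $ 2 $ 2) ^ 4 * cheb_form x z)"
proof -
  have 4: "(4::'k) \<noteq> 0"
    using 2 by (metis mult_eq_0_iff mult_2 numeral_Bit0)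
  define p r where "p = M $ 1 $ 2" and "r = M $ 3 $ 2"
  \<comment> \<open>On the line y = 0 the second coordinate of M' u is a x + c z, the linear form
    whose cube appears below.\<close>
  define a c where "a = M' $ 2 $ 1" and "c = M' $ 2 $ 3"
  have "polyfun (\<lambda>v. (M *v v) $ i) (\<lambda>v w. (M *v w) $ i)" for i
  proof -
    have "polyfun (\<lambda>v. M $ i $ 1 * v $ 1 + M $ i $ 2 * v $ 2 + M $ i $ 3 * v $ 3)
      (\<lambda>v w. M $ i $ 1 * w $ 1 + M $ i $ 2 * w $ 2 + M $ i $ 3 * w $ 3)"
      by (intro polyfun.add polyfun_cmult polyfun.coord)
    then show ?thesis by (simp add: matrix_vector_mult_3)
  qed
  from polyfun_compose[OF polyfun_quartic this]
  have d1: "polyfun (\<lambda>v. quartic (M *v v)) (\<lambda>v w. dotp (grad (M *v v)) (M *v w))" .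
  have d2: "polyfun (\<lambda>v. quartic (M *v v)) (\<lambda>v w. l * dotp (grad v) w)"
    unfolding q by (rule polyfun_cmult[OF polyfun_quartic])
  \<comment> \<open>the polar cubic of the image of \<open>(0 : 1 : 0)\<close> is the cube of a linear form\<close>
  have polar: "dotp (grad u) (M *v axis 2 1) = 4 * l * (M' *v u) $ 2 ^ 3" for u
  proof -
    have u: "M *v (M' *v u) = u" by (simp add: matrix_vector_mul_assoc inv)
    have "dotp (grad (M *v (M' *v u))) (M *v axis 2 1) = l * dotp (grad (M' *v u)) (axis 2 1)"
      by (rule polyfun_deriv_unique[OF d1 d2])
    then show ?thesis unfolding u by (simp add: dotp_def grad_def axis_def)
  qed
  have "[:- (8 * r) - 4 * l * c ^ 3, 8 * p - 12 * l * c ^ 2 * a, 8 * r - 12 * l * c * a ^ 2, - (4 * p) - 4 * l * a ^ 3:] = 0"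
  proof (rule poly_ext_alg_closed)
    fix x
    have "p * (8 * x - 4 * x ^ 3) + r * (8 * x ^ 2 - 8) = 4 * l * (a * x + c) ^ 3"
      using polar[of "vector [x, 0, 1]"]
      by (simp add: dotp_def grad_def matrix_vector_mult_3 axis_def p_def r_def a_def c_def mult.commute)
    then show "poly [:- (8 * r) - 4 * l * c ^ 3, 8 * p - 12 * l * c ^ 2 * a, 8 * r - 12 * l * c * a ^ 2, - (4 * p) - 4 * l * a ^ 3:] x = poly 0 x"
      by simp algebra
  qed
  then have "- (8 * r) - 4 * l * c ^ 3 = 0" "8 * p - 12 * l * c ^ 2 * a = 0"
    "8 * r - 12 * l * c * a ^ 2 = 0" "- (4 * p) - 4 * l * a ^ 3 = 0" unfolding pCons_eq_0_iff by blast+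
  then have "4 * (- 2 * r - l * c ^ 3) = 0" "4 * (2 * p - 3 * l * c ^ 2 * a) = 0"
    "4 * (2 * r - 3 * l * c * a ^ 2) = 0" "4 * (- p - l * a ^ 3) = 0" by algebra+
  then have "- 2 * r = l * c ^ 3" "2 * p = 3 * l * c ^ 2 * a" "2 * r = 3 * l * c * a ^ 2" "- p = l * a ^ 3"
    unfolding mult_eq_0_iff right_minus_eq using 4 by blast+
  from cube_polar_zero[OF 2 7 \<open>l \<noteq> 0\<close> this] have pr: "M $ 1 $ 2 = 0" "M $ 3 $ 2 = 0"
    by (simp_all add: p_def r_def)
  have "(M' ** M) $ 2 $ 2 = 1" by (simp add: inv mat_def)
  then have c: "M $ 2 $ 2 \<noteq> 0" by (auto simp: matrix_matrix_mult_def sum_3 pr)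
  have key: "M $ 2 $ 1 * x + M $ 2 $ 3 * z = 0 \<and>
     cheb_form (M $ 1 $ 1 * x + M $ 1 $ 3 * z) (M $ 3 $ 1 * x + M $ 3 $ 3 * z) = (M $ 2 $ 2) ^ 4 * cheb_form x z" for x z
  proof -
    define s where "s = M $ 2 $ 1 * x + M $ 2 $ 3 * z"
    define B where "B = cheb_form (M $ 1 $ 1 * x + M $ 1 $ 3 * z) (M $ 3 $ 1 * x + M $ 3 $ 3 * z)"
    define k where "k = M $ 2 $ 2"
    \<comment> \<open>The scaling identity expanded in powers of y. The coefficient of y^3 kills
      \<open>s\<close>, that of y^4 gives l = k^4, and the constant term is then the claim about
      \<open>cheb_form\<close>.\<close>
    have "[:s ^ 4 - B + l * cheb_form x z, 4 * s ^ 3 * k, 6 * s ^ 2 * k ^ 2, 4 * (s * k ^ 3), k ^ 4 - l:] = 0"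
    proof (rule poly_ext_alg_closed)
      fix y
      have "(s + k * y) ^ 4 - B = l * (y ^ 4 - cheb_form x z)"
        using q[of "vector [x, y, z]"]
        by (simp add: quartic_def matrix_vector_mult_3 pr s_def B_def k_def add_ac)
      then show "poly [:s ^ 4 - B + l * cheb_form x z, 4 * s ^ 3 * k, 6 * s ^ 2 * k ^ 2, 4 * (s * k ^ 3), k ^ 4 - l:] y = poly 0 y"
        by simp algebra
    qed
    then have "s ^ 4 - B + l * cheb_form x z = 0" "4 * (s * k ^ 3) = 0" "k ^ 4 - l = 0" by simp_all
    moreover from this have "s = 0" using 4 c by (simp add: k_def)
    ultimately show ?thesis by (simp add: s_def B_def k_def)
  qed
  have "M $ 2 $ 1 = 0" "M $ 2 $ 3 = 0" using key[of 1 0] key[of 0 1] by simp_all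
  then show ?thesis using pr c key by blast
qed

text \<open>The image (p, r) of (1, 0) determines (q, s) up to the determinant \<open>D\<close>, and
  the remaining equations force p = 0, r = 0 or p^4 = 2 r^4. The last case is that of additional
  symmetries of the four roots and survives only if 5 or 7 vanishes.\<close>

lemma cheb_form_symmetries:
  fixes p q r s :: "'k::alg_closed_field"
  assumes 2: "(2::'k) \<noteq> 0" and 5: "(5::'k) \<noteq> 0" and 7: "(7::'k) \<noteq> 0"
    and inv: "\<And>x z. cheb_form (p * x + q * z) (r * x + s * z) = cheb_form x z"
  shows "(q = 0 \<and> r = 0 \<and> p ^ 4 = 1 \<and> s ^ 2 = p ^ 2) \<or>
    (p = 0 \<and> s = 0 \<and> 2 * r ^ 4 = 1 \<and> q ^ 2 * r ^ 2 = 1)"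
proof -
  have 4: "(4::'k) \<noteq> 0"
    using 2 by (metis mult_eq_0_iff mult_2 numeral_Bit0)
  \<comment> \<open>Coefficients in x of the difference of the two forms at z = 1, with the factor 4
    removed from those of x and x^3.\<close>
  define e4 where "e4 = p ^ 4 - 4 * p ^ 2 * r ^ 2 + 2 * r ^ 4 - 1"
  define e3 where "e3 = p ^ 3 * q - 2 * p * r * (p * s + q * r) + 2 * r ^ 3 * s"
  define e2 where "e2 = 6 * p ^ 2 * q ^ 2 - 4 * (p ^ 2 * s ^ 2 + q ^ 2 * r ^ 2 + 4 * p * q * r * s) + 12 * r ^ 2 * s ^ 2 + 4"
  define e1 where "e1 = p * q ^ 3 - 2 * q * s * (p * s + q * r) + 2 * r * s ^ 3"
  define e0 where "e0 = q ^ 4 - 4 * q ^ 2 * s ^ 2 + 2 * s ^ 4 - 2"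
  have "[:e0, 4 * e1, e2, 4 * e3, e4:] = 0"
  proof (rule poly_ext_alg_closed)
    fix x
    have "poly [:e0, 4 * e1, e2, 4 * e3, e4:] x = cheb_form (p * x + q * 1) (r * x + s * 1) - cheb_form x 1"
      unfolding e0_def e1_def e2_def e3_def e4_def cheb_form_def by simp algebra
    then show "poly [:e0, 4 * e1, e2, 4 * e3, e4:] x = poly 0 x" unfolding inv by simp
  qed
  then have e: "e0 = 0" "e1 = 0" "e2 = 0" "e3 = 0" "e4 = 0" using 4 by simp_all
  define D where "D = p * s - q * r"
  have pr: "p ^ 4 - 4 * p ^ 2 * r ^ 2 + 2 * r ^ 4 = 1" using e(5) by (simp add: e4_def)
  \<comment> \<open>by \<open>e3 = 0\<close>, \<open>(q, s)\<close> is a multiple of the vector orthogonal to the gradient of the form at \<open>(p, r)\<close>\<close>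
  have "q * (p ^ 4 - 4 * p ^ 2 * r ^ 2 + 2 * r ^ 4) = 2 * D * r * (p ^ 2 - r ^ 2) + p * e3"
    unfolding D_def e3_def by algebra
  then have q: "q = 2 * D * r * (p ^ 2 - r ^ 2)" unfolding pr e(4) by simp
  have "s * (p ^ 4 - 4 * p ^ 2 * r ^ 2 + 2 * r ^ 4) = D * p * (p ^ 2 - 2 * r ^ 2) + r * e3"
    unfolding D_def e3_def by algebra
  then have s: "s = D * p * (p ^ 2 - 2 * r ^ 2)" unfolding pr e(4) by simp
  \<comment> \<open>Up to a constant, p r (p^4 - 2 r^4) is the sextic covariant of the binary
    quartic at (p, r); its three quadratic factors give the three cases.\<close>
  have "e1 = - (2 * D ^ 3 * (p * r * (p ^ 4 - 2 * r ^ 4)) * (p ^ 4 - 4 * p ^ 2 * r ^ 2 + 2 * r ^ 4))"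
    unfolding e1_def q s by algebra
  then have "2 * D ^ 3 * (p * r * (p ^ 4 - 2 * r ^ 4)) = 0" unfolding e(2) pr by simp
  moreover have "D \<noteq> 0" using e(1) q s 2 by (auto simp: e0_def)
  ultimately consider "p = 0" | "r = 0" | "p \<noteq> 0" "r \<noteq> 0" "p ^ 4 = 2 * r ^ 4" using 2 by auto
  then show ?thesis
  proof cases
    case 1
    then have "s = 0" "2 * r ^ 4 = 1" using s pr by simp_all
    moreover have "4 * (1 - q ^ 2 * r ^ 2) = 0" using e(3) 1 \<open>s = 0\<close> by (simp add: e2_def algebra_simps)
    then have "q ^ 2 * r ^ 2 = 1" using 4 by simp
    ultimately show ?thesis using 1 by simp
  next
    case 2
    then have "q = 0" "p ^ 4 = 1" using q pr by simp_all
    have "4 * (1 - p ^ 2 * s ^ 2) = 0" using e(3) 2 \<open>q = 0\<close> by (simp add: e2_def algebra_simps)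
    then have ps: "p ^ 2 * s ^ 2 = 1" using 4 by simp
    have "s ^ 2 = p ^ 4 * s ^ 2" using \<open>p ^ 4 = 1\<close> by simp
    also have "\<dots> = p ^ 2 * (p ^ 2 * s ^ 2)" by algebra
    also have "\<dots> = p ^ 2" by (simp add: ps)
    finally show ?thesis using 2 \<open>q = 0\<close> \<open>p ^ 4 = 1\<close> by simp
  next
    case 3
    \<comment> \<open>Here \<kappa> is a square root of 2. In terms of \<kappa>, \<open>E\<close>
      and r^4 the equations for \<open>e4\<close>, \<open>e0\<close>, \<open>e2\<close> become 4 r^4
      (1 - \<kappa>) = 1, 4 E^4 = 1 and E^2 r^4 (12 \<kappa> + 8) = -1. Squaring the last and
      eliminating gives (3 \<kappa> + 2)^2 = 4 (1 - \<kappa>)^2, that is 10 (1 + 2 \<kappa>) = 0, so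
      4 \<kappa>^2 = 1 against \<kappa>^2 = 2.\<close>
    define \<kappa> where "\<kappa> = p ^ 2 / r ^ 2"
    define E where "E = D * (p ^ 2 - r ^ 2)"
    have p2: "p ^ 2 = \<kappa> * r ^ 2" using 3(2) by (simp add: \<kappa>_def)
    have p4: "p ^ 4 = \<kappa> ^ 2 * r ^ 4" using p2 by algebra
    then have k2: "\<kappa> ^ 2 = 2" using 3 by simp
    have qE: "q = 2 * E * r" using q by (simp add: E_def algebra_simps)
    have "\<kappa> * (p ^ 2 - r ^ 2) = 2 * r ^ 2 - p ^ 2"
      using p2 k2 by algebra
    moreover have "s = - (D * p * (2 * r ^ 2 - p ^ 2))" unfolding s by algebra
    ultimately have "s = - (D * p * (\<kappa> * (p ^ 2 - r ^ 2)))" by simp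
    then have sE: "s = - (E * \<kappa> * p)" unfolding E_def by (simp only: mult_ac)
    have 1: "4 * r ^ 4 * (1 - \<kappa>) = 1"
    proof -
      have "p ^ 4 - 4 * p ^ 2 * r ^ 2 + 2 * r ^ 4 = \<kappa> ^ 2 * r ^ 4 - 4 * (\<kappa> * r ^ 2) * r ^ 2 + 2 * r ^ 4"
        unfolding p4 p2 by simp
      also have "\<dots> = 4 * r ^ 4 * (1 - \<kappa>)" unfolding k2 by algebra
      finally show ?thesis using pr by simp
    qed
    have q2: "q ^ 2 = 4 * E ^ 2 * r ^ 2" and s2: "s ^ 2 = 2 * E ^ 2 * \<kappa> * r ^ 2"
    proof -
      show "q ^ 2 = 4 * E ^ 2 * r ^ 2" unfolding qE by algebra
      have "s ^ 2 = E ^ 2 * \<kappa> ^ 2 * p ^ 2" unfolding sE by algebra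
      then show "s ^ 2 = 2 * E ^ 2 * \<kappa> * r ^ 2" unfolding k2 p2 by simp
    qed
    have pqrs: "p * q * r * s = - (4 * E ^ 2 * r ^ 4)"
    proof -
      have "p * q * r * s = - (2 * E ^ 2 * \<kappa> * r ^ 2 * p ^ 2)" unfolding qE sE by algebra
      also have "\<dots> = - (2 * E ^ 2 * \<kappa> ^ 2 * r ^ 4)" unfolding p2 by algebra
      finally show ?thesis unfolding k2 by simp
    qed
    have "4 * E ^ 4 = 1"
    proof -
      have "e0 = (q ^ 2) ^ 2 - 4 * q ^ 2 * s ^ 2 + 2 * (s ^ 2) ^ 2 - 2" unfolding e0_def by algebra
      also have "\<dots> = 16 * E ^ 4 * r ^ 4 - 32 * E ^ 4 * \<kappa> * r ^ 4 + 8 * \<kappa> ^ 2 * E ^ 4 * r ^ 4 - 2"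
        unfolding q2 s2 by algebra
      also have "\<dots> = 8 * E ^ 4 * (4 * r ^ 4 * (1 - \<kappa>)) - 2" unfolding k2 by algebra
      also have "\<dots> = 2 * (4 * E ^ 4 - 1)" unfolding 1 by algebra
      finally have "2 * (4 * E ^ 4 - 1) = 0" unfolding e(1) by (rule sym)
      then have "4 * E ^ 4 - 1 = 0" using 2 unfolding mult_eq_0_iff by blast
      then show ?thesis by (simp only: right_minus_eq)
    qed
    have "E ^ 2 * r ^ 4 * (12 * \<kappa> + 8) = - 1"
    proof -
      have "e2 = 6 * p ^ 2 * q ^ 2 - 4 * (p ^ 2 * s ^ 2 + q ^ 2 * r ^ 2 + 4 * (p * q * r * s)) + 12 * r ^ 2 * s ^ 2 + 4"
        unfolding e2_def by algebra
      also have "\<dots> = 24 * \<kappa> * E ^ 2 * r ^ 4 - 8 * \<kappa> ^ 2 * E ^ 2 * r ^ 4 + 48 * E ^ 2 * r ^ 4 + 24 * \<kappa> * E ^ 2 * r ^ 4 + 4"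
        unfolding p2 q2 s2 pqrs by algebra
      also have "\<dots> = 4 * (E ^ 2 * r ^ 4 * (12 * \<kappa> + 8) + 1)" unfolding k2 by algebra
      finally have "4 * (E ^ 2 * r ^ 4 * (12 * \<kappa> + 8) + 1) = 0" unfolding e(3) by (rule sym)
      then have "E ^ 2 * r ^ 4 * (12 * \<kappa> + 8) + 1 = 0" using 4 unfolding mult_eq_0_iff by blast
      then show ?thesis by (simp only: eq_neg_iff_add_eq_0)
    qed
    then have "(E ^ 2 * r ^ 4 * (12 * \<kappa> + 8)) ^ 2 = 1" by simp
    then have "4 * E ^ 4 * (4 * (r ^ 8 * (3 * \<kappa> + 2) ^ 2)) = 1" by algebra
    then have a: "4 * (r ^ 8 * (3 * \<kappa> + 2) ^ 2) = 1" unfolding \<open>4 * E ^ 4 = 1\<close> by simp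
    have "(4 * r ^ 4 * (1 - \<kappa>)) ^ 2 = 1" unfolding 1 by simp
    then have "4 * (r ^ 8 * (4 * (1 - \<kappa>) ^ 2)) = 1" by algebra
    then have "r ^ 8 * (4 * ((3 * \<kappa> + 2) ^ 2 - 4 * (1 - \<kappa>) ^ 2)) = 0" using a by algebra
    moreover have "r ^ 8 \<noteq> 0" using 3(2) by simp
    ultimately have "(3 * \<kappa> + 2) ^ 2 - 4 * (1 - \<kappa>) ^ 2 = 0" using 4 unfolding mult_eq_0_iff by blast
    moreover have "(3 * \<kappa> + 2) ^ 2 - 4 * (1 - \<kappa>) ^ 2 = 5 * \<kappa> ^ 2 + 20 * \<kappa>" by algebra
    ultimately have "5 * (2 * (1 + 2 * \<kappa>)) = 0" unfolding k2 by simp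
    then have "1 + 2 * \<kappa> = 0" using 5 2 unfolding mult_eq_0_iff by blast
    then have "(2 * \<kappa>) ^ 2 = 1" by algebra
    then have "4 * \<kappa> ^ 2 = 1" by algebra
    moreover have "(7::'k) = 4 * \<kappa> ^ 2 - 1" unfolding k2 by simp
    ultimately have "(7::'k) = 0" by simp
    then show ?thesis using 7 by simp
  qed
qed

section \<open>The automorphism group\<close>

lemma klein_four_iso:
  assumes "group H" and card: "card (carrier H) = 4" and sq: "\<And>x. x \<in> carrier H \<Longrightarrow> x \<otimes>\<^bsub>H\<^esub> x = \<one>\<^bsub>H\<^esub>"
  shows "H \<cong> integer_mod_group 2 \<times>\<times> integer_mod_group 2"
proof -
  interpret group H by fact
  have comm: "x \<otimes>\<^bsub>H\<^esub> y = y \<otimes>\<^bsub>H\<^esub> x" if xy: "x \<in> carrier H" "y \<in> carrier H" for x y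
  proof -
    have i: "inv\<^bsub>H\<^esub> u = u" if "u \<in> carrier H" for u
      using inv_equality[OF sq[OF that] that that] .
    have "x \<otimes>\<^bsub>H\<^esub> y = inv\<^bsub>H\<^esub> (x \<otimes>\<^bsub>H\<^esub> y)" using i xy by simp
    also have "\<dots> = inv\<^bsub>H\<^esub> y \<otimes>\<^bsub>H\<^esub> inv\<^bsub>H\<^esub> x" using xy by (rule inv_mult_group)
    finally show ?thesis using i xy by simp
  qed
  have fin: "finite (carrier H)" using card by (simp add: card_ge_0_finite)
  have "\<exists>a\<in>carrier H. a \<notin> {\<one>\<^bsub>H\<^esub>}"
  proof (rule ccontr)
    assume "\<not> ?thesis"
    then have "carrier H \<subseteq> {\<one>\<^bsub>H\<^esub>}" by blast
    then have "card (carrier H) \<le> card {\<one>\<^bsub>H\<^esub>}" by (intro card_mono) auto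
    then show False using card by simp
  qed
  then obtain a where a: "a \<in> carrier H" "a \<noteq> \<one>\<^bsub>H\<^esub>" by blast
  have "\<exists>b\<in>carrier H. b \<notin> {\<one>\<^bsub>H\<^esub>, a}"
  proof (rule ccontr)
    assume "\<not> ?thesis"
    then have "carrier H \<subseteq> {\<one>\<^bsub>H\<^esub>, a}" by blast
    then have "card (carrier H) \<le> card {\<one>\<^bsub>H\<^esub>, a}" by (intro card_mono) auto
    then show False using card a by simp
  qed
  then obtain b where b: "b \<in> carrier H" "b \<noteq> \<one>\<^bsub>H\<^esub>" "b \<noteq> a" by blast
  have cancel: "a \<otimes>\<^bsub>H\<^esub> (a \<otimes>\<^bsub>H\<^esub> b) = b" "b \<otimes>\<^bsub>H\<^esub> (a \<otimes>\<^bsub>H\<^esub> b) = a"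
    "(a \<otimes>\<^bsub>H\<^esub> b) \<otimes>\<^bsub>H\<^esub> a = b" "(a \<otimes>\<^bsub>H\<^esub> b) \<otimes>\<^bsub>H\<^esub> b = a"
  proof -
    show 1: "a \<otimes>\<^bsub>H\<^esub> (a \<otimes>\<^bsub>H\<^esub> b) = b"
      using a b sq[OF a(1)] m_assoc[of a a b] by simp
    show 2: "(a \<otimes>\<^bsub>H\<^esub> b) \<otimes>\<^bsub>H\<^esub> b = a"
      using a b sq[OF b(1)] m_assoc[of a b b] by simp
    show "b \<otimes>\<^bsub>H\<^esub> (a \<otimes>\<^bsub>H\<^esub> b) = a" using 2 comm[of b "a \<otimes>\<^bsub>H\<^esub> b"] a b by simp
    show "(a \<otimes>\<^bsub>H\<^esub> b) \<otimes>\<^bsub>H\<^esub> a = b" using 1 comm[of a "a \<otimes>\<^bsub>H\<^esub> b"] a b by simp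
  qed
  have ab: "a \<otimes>\<^bsub>H\<^esub> b \<noteq> \<one>\<^bsub>H\<^esub>" "a \<otimes>\<^bsub>H\<^esub> b \<noteq> a" "a \<otimes>\<^bsub>H\<^esub> b \<noteq> b"
    using a b cancel sq[OF a(1)] sq[OF b(1)] by auto
  define h where "h = (\<lambda>(m::int, n::int). (if m = 0 then \<one>\<^bsub>H\<^esub> else a) \<otimes>\<^bsub>H\<^esub> (if n = 0 then \<one>\<^bsub>H\<^esub> else b))"
  let ?K = "integer_mod_group 2 \<times>\<times> integer_mod_group 2"
  have K: "carrier ?K = {(0, 0), (0, 1), (1, 0), (1, 1)}"
    by (auto simp: carrier_integer_mod_group)
  have "group ?K" by (intro DirProd_group group_integer_mod_group)
  have vals: "h (0, 0) = \<one>\<^bsub>H\<^esub>" "h (1, 0) = a" "h (0, 1) = b" "h (1, 1) = a \<otimes>\<^bsub>H\<^esub> b"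
    using a b by (simp_all add: h_def)
  have "h ` carrier ?K = {\<one>\<^bsub>H\<^esub>, b, a, a \<otimes>\<^bsub>H\<^esub> b}" unfolding K by (auto simp: vals)
  moreover have "{\<one>\<^bsub>H\<^esub>, b, a, a \<otimes>\<^bsub>H\<^esub> b} \<subseteq> carrier H" using a b by simp
  moreover have "card {\<one>\<^bsub>H\<^esub>, b, a, a \<otimes>\<^bsub>H\<^esub> b} = 4" using a b ab by (auto simp: card_insert_if)
  ultimately have im: "h ` carrier ?K = carrier H" using card card_subset_eq[OF fin] by metis
  moreover have "inj_on h (carrier ?K)"
    using a b ab unfolding K by (auto simp: inj_on_def vals)
  moreover have "h \<in> hom ?K H"
  proof (rule homI)
    show "h x \<in> carrier H" if "x \<in> carrier ?K" for x using im that by blast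
    show "h (x \<otimes>\<^bsub>?K\<^esub> y) = h x \<otimes>\<^bsub>H\<^esub> h y" if "x \<in> carrier ?K" "y \<in> carrier ?K" for x y
      using that a b sq[of a] sq[of b] sq[of "a \<otimes>\<^bsub>H\<^esub> b"] comm[of b a] cancel unfolding K
      by (elim insertE emptyE) (simp_all add: vals DirProd_def)
  qed
  ultimately have "h \<in> iso ?K H" by (simp add: iso_def bij_betw_def)
  then have "?K \<cong> H" by (auto simp: is_iso_def)
  then show ?thesis by (rule group.iso_sym[OF \<open>group ?K\<close>])
qed

text \<open>The powers of \<open>z\<close> form a normal subgroup because \<open>z\<close> is
  central, and its order is exactly 4. All squares lie in it, so the quotient has exponent 2 and
  order 16 / 4, which leaves only the Klein four-group.\<close>

lemma central_cyclic_subgroup: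
  assumes "group G" and order: "Coset.order G = 16" and z: "z \<in> carrier G"
    and central: "\<And>x. x \<in> carrier G \<Longrightarrow> x \<otimes>\<^bsub>G\<^esub> z = z \<otimes>\<^bsub>G\<^esub> x"
    and z2: "z \<otimes>\<^bsub>G\<^esub> z \<noteq> \<one>\<^bsub>G\<^esub>" and z4: "(z \<otimes>\<^bsub>G\<^esub> z) \<otimes>\<^bsub>G\<^esub> (z \<otimes>\<^bsub>G\<^esub> z) = \<one>\<^bsub>G\<^esub>"
    and sq: "\<And>x. x \<in> carrier G \<Longrightarrow> \<exists>n::nat. x \<otimes>\<^bsub>G\<^esub> x = z [^]\<^bsub>G\<^esub> n"
  shows "\<exists>N. N \<lhd> G \<and> card N = 4 \<and> G\<lparr>carrier := N\<rparr> \<cong> integer_mod_group 4 \<and>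
    G Mod N \<cong> integer_mod_group 2 \<times>\<times> integer_mod_group 2"
proof -
  interpret group G by fact
  define N where "N = range (\<lambda>n::nat. z [^]\<^bsub>G\<^esub> n)"
  have p4: "z [^]\<^bsub>G\<^esub> (4::nat) = \<one>\<^bsub>G\<^esub>"
    using z z4 by (simp add: numeral_eq_Suc m_assoc)
  have red: "z [^]\<^bsub>G\<^esub> (n mod 4) = z [^]\<^bsub>G\<^esub> n" for n :: nat
  proof -
    have "z [^]\<^bsub>G\<^esub> n = z [^]\<^bsub>G\<^esub> (4 * (n div 4) + n mod 4)" by simp
    also have "\<dots> = (z [^]\<^bsub>G\<^esub> (4::nat)) [^]\<^bsub>G\<^esub> (n div 4) \<otimes>\<^bsub>G\<^esub> z [^]\<^bsub>G\<^esub> (n mod 4)"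
      using z by (simp only: nat_pow_mult[symmetric] nat_pow_pow nat_pow_closed)
    finally show ?thesis using z by (simp add: p4)
  qed
  have small: "n = 0" if n: "z [^]\<^bsub>G\<^esub> n = \<one>\<^bsub>G\<^esub>" "n < 4" for n :: nat
  proof -
    have "n = 0 \<or> n = 1 \<or> n = 2 \<or> n = 3" using n(2) by auto
    moreover have "n \<noteq> 1" using n z2 z by auto
    moreover have "n \<noteq> 2" using n z2 z by (auto simp: numeral_eq_Suc)
    moreover have "n \<noteq> 3"
    proof
      assume "n = 3"
      then have "z [^]\<^bsub>G\<^esub> (3::nat) \<otimes>\<^bsub>G\<^esub> z = z" using n z by simp
      moreover have "z [^]\<^bsub>G\<^esub> (3::nat) \<otimes>\<^bsub>G\<^esub> z = z [^]\<^bsub>G\<^esub> (4::nat)" by (simp add: numeral_eq_Suc)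
      ultimately show False using p4 z2 z by simp
    qed
    ultimately show ?thesis by blast
  qed
  have NG: "N \<subseteq> carrier G" using z by (auto simp: N_def)
  have cent: "x \<otimes>\<^bsub>G\<^esub> z [^]\<^bsub>G\<^esub> n = z [^]\<^bsub>G\<^esub> n \<otimes>\<^bsub>G\<^esub> x" if x: "x \<in> carrier G" for x and n :: nat
  proof (induction n)
    case (Suc n)
    have "x \<otimes>\<^bsub>G\<^esub> (z [^]\<^bsub>G\<^esub> n \<otimes>\<^bsub>G\<^esub> z) = z [^]\<^bsub>G\<^esub> n \<otimes>\<^bsub>G\<^esub> x \<otimes>\<^bsub>G\<^esub> z"
      using x z Suc by (simp flip: m_assoc)
    also have "\<dots> = z [^]\<^bsub>G\<^esub> n \<otimes>\<^bsub>G\<^esub> z \<otimes>\<^bsub>G\<^esub> x"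
      using x z central[OF x] by (simp add: m_assoc)
    finally show ?case by simp
  qed (use x in simp)
  have sub: "subgroup N G"
  proof (rule subgroupI)
    show "N \<subseteq> carrier G" "N \<noteq> {}" using NG by (auto simp: N_def)
    show "a \<otimes>\<^bsub>G\<^esub> b \<in> N" if "a \<in> N" "b \<in> N" for a b
      using that z by (auto simp: N_def nat_pow_mult)
    show "inv\<^bsub>G\<^esub> a \<in> N" if a: "a \<in> N" for a
    proof -
      obtain n :: nat where n: "a = z [^]\<^bsub>G\<^esub> n" using a unfolding N_def by blast
      have "z [^]\<^bsub>G\<^esub> (3 * n) \<otimes>\<^bsub>G\<^esub> a = (z [^]\<^bsub>G\<^esub> (4::nat)) [^]\<^bsub>G\<^esub> n"
        using z by (simp add: n nat_pow_mult nat_pow_pow)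
      then have "inv\<^bsub>G\<^esub> a = z [^]\<^bsub>G\<^esub> (3 * n)"
        using z n by (intro inv_equality) (simp_all add: p4)
      then show ?thesis by (auto simp: N_def)
    qed
  qed
  have normal: "N \<lhd> G"
    unfolding normal_inv_iff
  proof (intro conjI sub ballI)
    fix x h assume x: "x \<in> carrier G" and h: "h \<in> N"
    have "x \<otimes>\<^bsub>G\<^esub> h = h \<otimes>\<^bsub>G\<^esub> x" using cent[OF x] h by (auto simp: N_def)
    then have "x \<otimes>\<^bsub>G\<^esub> h \<otimes>\<^bsub>G\<^esub> inv\<^bsub>G\<^esub> x = h" using x h NG by (simp add: m_assoc subset_iff)
    then show "x \<otimes>\<^bsub>G\<^esub> h \<otimes>\<^bsub>G\<^esub> inv\<^bsub>G\<^esub> x \<in> N" using h by simp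
  qed
  define h where "h k = z [^]\<^bsub>G\<^esub> (nat k)" for k :: int
  have carr: "carrier (integer_mod_group 4) = {0..<4}" by (simp add: carrier_integer_mod_group)
  have bij: "bij_betw h (carrier (integer_mod_group 4)) N"
    unfolding bij_betw_def
  proof (intro conjI inj_onI)
    fix k l assume kl: "k \<in> carrier (integer_mod_group 4)" "l \<in> carrier (integer_mod_group 4)" "h k = h l"
    have "nat k - nat l = 0" "nat l - nat k = 0"
      using kl pow_eq_div2[OF z, of "nat k" "nat l"] pow_eq_div2[OF z, of "nat l" "nat k"]
      by (intro small; auto simp: h_def carr)+
    then have "int (nat k) = int (nat l)" by simp
    then show "k = l" using kl(1,2) by (simp add: carr)
  next
    have "z [^]\<^bsub>G\<^esub> n \<in> h ` {0..<4}" for n :: nat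
      by (rule image_eqI[of _ _ "int (n mod 4)"]) (simp_all add: h_def red)
    then have "N \<subseteq> h ` {0..<4}" unfolding N_def by blast
    moreover have "h ` {0..<4} \<subseteq> N" unfolding N_def h_def by blast
    ultimately show "h ` carrier (integer_mod_group 4) = N" unfolding carr by blast
  qed
  have "h \<in> hom (integer_mod_group 4) (G\<lparr>carrier := N\<rparr>)"
  proof (rule homI)
    fix k l assume kl: "k \<in> carrier (integer_mod_group 4)" "l \<in> carrier (integer_mod_group 4)"
    have "nat ((k + l) mod 4) = (nat k + nat l) mod 4"
      using kl by (simp add: carr nat_mod_distrib nat_add_distrib)
    then show "h (k \<otimes>\<^bsub>integer_mod_group 4\<^esub> l) = h k \<otimes>\<^bsub>G\<lparr>carrier := N\<rparr>\<^esub> h l"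
      using z by (simp add: h_def red nat_pow_mult)
  qed (simp add: h_def N_def)
  then have "h \<in> iso (integer_mod_group 4) (G\<lparr>carrier := N\<rparr>)" using bij by (simp add: iso_def)
  then have "integer_mod_group 4 \<cong> G\<lparr>carrier := N\<rparr>" by (auto simp: is_iso_def)
  then have iso4: "G\<lparr>carrier := N\<rparr> \<cong> integer_mod_group 4"
    by (rule group.iso_sym[OF group_integer_mod_group])
  have cardN: "card N = 4" using bij_betw_same_card[OF bij] by (simp add: carr)
  have "card (rcosets\<^bsub>G\<^esub> N) * card N = 16" using lagrange[OF sub] order by simp
  then have card: "card (carrier (G Mod N)) = 4" by (simp add: cardN FactGroup_def)
  have "X \<otimes>\<^bsub>G Mod N\<^esub> X = \<one>\<^bsub>G Mod N\<^esub>" if X: "X \<in> carrier (G Mod N)" for X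
  proof -
    obtain g where g: "g \<in> carrier G" "X = N #>\<^bsub>G\<^esub> g" using X by (auto simp: carrier_FactGroup)
    have "g \<otimes>\<^bsub>G\<^esub> g \<in> N" using sq[OF g(1)] by (auto simp: N_def)
    then have "N #>\<^bsub>G\<^esub> (g \<otimes>\<^bsub>G\<^esub> g) = N" using coset_join2 sub g by simp
    then show ?thesis using normal.rcos_sum[OF normal g(1) g(1)] by (simp add: g(2))
  qed
  from klein_four_iso[OF normal.factorgroup_is_group[OF normal] card this]
  show ?thesis using normal cardN iso4 by blast
qed

text \<open>The entry 1 in the middle normalises the projective scalar, so that distinct symmetries
  give distinct maps of the curve.\<close>

definition tmat :: "'k::field \<Rightarrow> 'k \<Rightarrow> 'k \<Rightarrow> 'k \<Rightarrow> 'k ^ 3 ^ 3" where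
  "tmat p q r s = vector [vector [p, 0, q], vector [0, 1, 0], vector [r, 0, s]]"

lemma tmat_component:
  "tmat p q r s $ 1 $ 1 = p" "tmat p q r s $ 1 $ 2 = 0" "tmat p q r s $ 1 $ 3 = q"
  "tmat p q r s $ 2 $ 1 = 0" "tmat p q r s $ 2 $ 2 = 1" "tmat p q r s $ 2 $ 3 = 0"
  "tmat p q r s $ 3 $ 1 = r" "tmat p q r s $ 3 $ 2 = 0" "tmat p q r s $ 3 $ 3 = s"
  by (simp_all add: tmat_def)

lemma tmat_apply: "tmat p q r s *v v = vector [p * v $ 1 + q * v $ 3, v $ 2, r * v $ 1 + s * v $ 3]"
  by (intro vec3_eqI) (simp_all add: matrix_vector_mult_3 tmat_component)

lemma tmat_mult:
  "tmat p q r s ** tmat p' q' r' s' = tmat (p * p' + q * r') (p * q' + q * s') (r * p' + s * r') (r * q' + s * s')"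
  by (simp add: vec_eq_iff forall_3 matrix_matrix_mult_def sum_3 tmat_component)

lemma tmat_one: "tmat 1 0 0 1 = mat 1"
  by (simp add: vec_eq_iff forall_3 tmat_component mat_def)

lemma tmat_inject: "tmat p q r s = tmat p' q' r' s' \<longleftrightarrow> p = p' \<and> q = q' \<and> r = r' \<and> s = s'"
  by (auto simp: vec_eq_iff forall_3 tmat_component)

definition diagonal_symmetries :: "('k::field ^ 3 ^ 3) set" where
  "diagonal_symmetries = {tmat p 0 0 s | p s. p ^ 4 = 1 \<and> s ^ 2 = p ^ 2}"

text \<open>The conditions match the x^4 and x^2 z^2 coefficients of
  \<open>cheb_form (q * z) (r * x)\<close>. The z^4 coefficient follows: q^4 = q^4 (2 r^4) =
  2.\<close>

definition antidiagonal_symmetries :: "('k::field ^ 3 ^ 3) set" where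
  "antidiagonal_symmetries = {tmat 0 q r 0 | q r. 2 * r ^ 4 = 1 \<and> q ^ 2 * r ^ 2 = 1}"

definition symmetries :: "('k::field ^ 3 ^ 3) set" where
  "symmetries = diagonal_symmetries \<union> antidiagonal_symmetries"

lemma symmetries_cases:
  assumes "T \<in> symmetries"
  obtains p s where "T = tmat p 0 0 s" "p ^ 4 = 1" "s ^ 2 = p ^ 2"
  | q r where "T = tmat 0 q r 0" "2 * r ^ 4 = 1" "q ^ 2 * r ^ 2 = 1"
  using assms unfolding symmetries_def diagonal_symmetries_def antidiagonal_symmetries_def by blast

lemma diagonal_in_symmetries: "p ^ 4 = 1 \<Longrightarrow> s ^ 2 = p ^ 2 \<Longrightarrow> tmat p 0 0 s \<in> symmetries"
  unfolding symmetries_def diagonal_symmetries_def by blast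

lemma antidiagonal_in_symmetries: "2 * r ^ 4 = 1 \<Longrightarrow> q ^ 2 * r ^ 2 = 1 \<Longrightarrow> tmat 0 q r 0 \<in> symmetries"
  unfolding symmetries_def antidiagonal_symmetries_def by blast

lemma one_in_symmetries: "mat 1 \<in> symmetries"
  unfolding tmat_one[symmetric] by (rule diagonal_in_symmetries) simp_all

lemma symmetries_mult:
  fixes S T :: "'k::field ^ 3 ^ 3"
  assumes "S \<in> symmetries" "T \<in> symmetries"
  shows "S ** T \<in> symmetries"
  using assms(1)
proof (cases rule: symmetries_cases)
  case (1 p s)
  show ?thesis using assms(2)
  proof (cases rule: symmetries_cases)
    case 2: (1 p' s')
    show ?thesis using 1 2 by (auto simp: tmat_mult power_mult_distrib intro!: diagonal_in_symmetries)
  next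
    case 2: (2 q r)
    have s4: "s ^ 4 = 1"
    proof -
      have "s ^ 4 = (s ^ 2) ^ 2" by (simp flip: power_mult)
      also have "\<dots> = p ^ 4" unfolding 1(3) by (simp flip: power_mult)
      finally show ?thesis using 1(2) by simp
    qed
    have "(p * q) ^ 2 * (s * r) ^ 2 = p ^ 2 * s ^ 2 * (q ^ 2 * r ^ 2)" by algebra
    also have "\<dots> = p ^ 4" unfolding 1(3) 2(3) by algebra
    finally show ?thesis using 1 2 s4
      by (auto simp: tmat_mult intro!: antidiagonal_in_symmetries) (simp add: power_mult_distrib)
  qed
next
  case (2 q r)
  show ?thesis using assms(2)
  proof (cases rule: symmetries_cases)
    case 1: (1 p s)
    have s4: "s ^ 4 = 1"
    proof -
      have "s ^ 4 = (s ^ 2) ^ 2" by (simp flip: power_mult)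
      also have "\<dots> = p ^ 4" unfolding 1(3) by (simp flip: power_mult)
      finally show ?thesis using 1(2) by simp
    qed
    have "(q * s) ^ 2 * (r * p) ^ 2 = p ^ 2 * s ^ 2 * (q ^ 2 * r ^ 2)" by algebra
    also have "\<dots> = p ^ 4" unfolding 1(3) 2(3) by algebra
    finally show ?thesis using 1 2 s4
      by (auto simp: tmat_mult intro!: antidiagonal_in_symmetries) (simp add: power_mult_distrib)
  next
    case 1: (2 q' r')
    have rr: "2 * r ^ 4 = 1" "2 * r' ^ 4 = 1" using 1 2 by auto
    have q4: "q ^ 4 * r ^ 4 = 1" "q' ^ 4 * r' ^ 4 = 1"
      using 2(3) 1(3) by algebra+
    have "q ^ 4 = q ^ 4 * (2 * r ^ 4)" using rr by simp
    also have "\<dots> = 2 * (q ^ 4 * r ^ 4)" by algebra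
    finally have qq: "q ^ 4 = 2" using q4 by simp
    have "q ^ 4 * r' ^ 4 = 1" using qq rr by simp
    then have a: "(q * r') ^ 4 = 1" by (simp add: power_mult_distrib)
    have "(r * q') ^ 2 = (r * q') ^ 2 * (q ^ 4 * r' ^ 4)" using \<open>q ^ 4 * r' ^ 4 = 1\<close> by simp
    also have "\<dots> = (q ^ 2 * r ^ 2) * (q' ^ 2 * r' ^ 2) * (q * r') ^ 2" by algebra
    finally have "(r * q') ^ 2 = (q * r') ^ 2" unfolding 1(3) 2(3) by simp
    with a show ?thesis using 1 2
      by (auto simp: tmat_mult intro!: diagonal_in_symmetries)
  qed
qed

lemma symmetries_inverse:
  fixes T :: "'k::field ^ 3 ^ 3"
  assumes "T \<in> symmetries"
  shows "\<exists>T'\<in>symmetries. T ** T' = mat 1 \<and> T' ** T = mat 1"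
  using assms
proof (cases rule: symmetries_cases)
  case (1 p s)
  have nz: "p \<noteq> 0" "s \<noteq> 0" using 1 by auto
  have "tmat (1 / p) 0 0 (1 / s) \<in> symmetries"
    using 1 by (intro diagonal_in_symmetries) (simp_all add: power_divide)
  then show ?thesis using 1(1) nz
    by (intro bexI[of _ "tmat (1 / p) 0 0 (1 / s)"]) (simp_all add: tmat_mult flip: tmat_one)
next
  case (2 q r)
  have nz: "q \<noteq> 0" "r \<noteq> 0" using 2 by auto
  have "q ^ 4 * r ^ 4 = 1" using 2(3) by algebra
  then have "(1 / q) ^ 4 = r ^ 4" using nz by (simp add: power_divide divide_eq_eq mult.commute)
  moreover have "(1 / r) ^ 2 * (1 / q) ^ 2 = 1" using 2(3) by (simp add: power_divide mult.commute)
  ultimately have "tmat 0 (1 / r) (1 / q) 0 \<in> symmetries"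
    using 2(2) by (intro antidiagonal_in_symmetries) simp_all
  then show ?thesis using 2(1) nz
    by (intro bexI[of _ "tmat 0 (1 / r) (1 / q) 0"]) (simp_all add: tmat_mult flip: tmat_one)
qed

lemma quartic_symmetry:
  fixes T :: "'k::field ^ 3 ^ 3"
  assumes "T \<in> symmetries"
  shows "quartic (T *v v) = quartic v"
  using assms
proof (cases rule: symmetries_cases)
  case (1 p s)
  have "cheb_form (p * x) (s * z) = p ^ 4 * x ^ 4 - 4 * (p ^ 2 * s ^ 2) * x ^ 2 * z ^ 2 + 2 * (s ^ 2) ^ 2 * z ^ 4" for x z
    unfolding cheb_form_def by algebra
  moreover have "p ^ 2 * p ^ 2 = 1" "(p ^ 2) ^ 2 = 1" using 1(2) by algebra+
  ultimately have "cheb_form (p * x) (s * z) = cheb_form x z" for x z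
    unfolding 1(2,3) by (simp add: cheb_form_def)
  then show ?thesis by (simp add: 1(1) tmat_apply quartic_def)
next
  case (2 q r)
  have "cheb_form (q * z) (r * x) = q ^ 4 * z ^ 4 - 4 * (q ^ 2 * r ^ 2) * x ^ 2 * z ^ 2 + (2 * r ^ 4) * x ^ 4" for x z
    unfolding cheb_form_def by algebra
  moreover have "q ^ 4 = 2"
  proof -
    have "q ^ 4 * r ^ 4 = 1" using 2(3) by algebra
    have "q ^ 4 = q ^ 4 * (2 * r ^ 4)" using 2(2) by simp
    also have "\<dots> = 2 * (q ^ 4 * r ^ 4)" by algebra
    finally show ?thesis using \<open>q ^ 4 * r ^ 4 = 1\<close> by simp
  qed
  ultimately have "cheb_form (q * z) (r * x) = cheb_form x z" for x z
    unfolding 2(2,3) by (simp add: cheb_form_def)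
  then show ?thesis by (simp add: 2(1) tmat_apply quartic_def)
qed

lemma symmetry_curve_cone:
  assumes "T \<in> symmetries" "v \<in> curve_cone"
  shows "T *v v \<in> curve_cone"
proof -
  obtain T' where "T' ** T = mat 1" using symmetries_inverse[OF assms(1)] by blast
  then have "T' *v (T *v v) = v" by (simp add: matrix_vector_mul_assoc)
  then have "T *v v \<noteq> 0" using assms(2) by (auto simp: curve_cone_def)
  then show ?thesis using assms by (simp add: curve_cone_def quartic_symmetry)
qed

section \<open>The symmetries as automorphisms of the projective curve\<close>

definition act :: "'k::field ^ 3 ^ 3 \<Rightarrow> ('k ^ 3) set \<Rightarrow> ('k ^ 3) set" where
  "act T = (\<lambda>P\<in>proj ` curve_cone. (*v) T ` P)"

lemma act_proj: "v \<in> curve_cone \<Longrightarrow> act T (proj v) = proj (T *v v)"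
  by (simp add: act_def proj_eq_range image_image matrix_vector_scale)

text \<open>One triple of linear forms works on the whole plane, which is open because its
  complement is the zero locus of the constant 1. Leaving \<open>f\<close> free allows the same
  lemma to treat the inverse map.\<close>

lemma linear_morphism:
  assumes "T \<in> symmetries" and f: "\<And>v. v \<in> curve_cone \<Longrightarrow> f (proj v) = proj (T *v v)"
  shows "proj_morphism (proj ` curve_cone) (proj ` curve_cone) f"
  unfolding proj_morphism_def
proof (intro conjI ballI)
  show "f \<in> proj ` curve_cone \<rightarrow> proj ` curve_cone"
    using symmetry_curve_cone[OF assms(1)] f by auto
  fix P :: "('a ^ 3) set" assume "P \<in> proj ` curve_cone"
  then have P: "P \<in> proj_plane" by (auto simp: proj_plane_def curve_cone_def)
  have "ternary_form 0 (\<lambda>_ :: 'a ^ 3. 1)" by (auto simp: ternary_form_def intro!: exI[of _ "\<lambda>_ _. 1"])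
  moreover have "proj_plane - proj_plane = zero_locus {\<lambda>_ :: 'a ^ 3. 1}"
    using proj_self by (fastforce simp: zero_locus_def proj_plane_def)
  ultimately have "zariski_open (proj_plane :: ('a ^ 3) set set)"
    unfolding zariski_open_def zariski_closed_def by (metis order_refl singletonD)
  moreover have "ternary_form 1 (\<lambda>v. (T *v v) $ i)" for i
    unfolding ternary_form_def
  proof (intro exI[of _ "\<lambda>j k. if j = 1 then T $ i $ 1 else if k = 1 then T $ i $ 2 else T $ i $ 3"] allI)
    fix v
    have *: "{..1} = {0, 1::nat}" by auto
    show "(T *v v) $ i = (\<Sum>j\<le>1. \<Sum>k\<le>1 - j. (if j = 1 then T $ i $ 1 else if k = 1 then T $ i $ 2 else T $ i $ 3) *
      v $ 1 ^ j * v $ 2 ^ k * v $ 3 ^ (1 - j - k))"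
      by (simp add: * matrix_vector_mult_3)
  qed
  moreover have "T *v v \<noteq> 0 \<and> f (proj v) = proj (T *v v)"
    if v: "v \<noteq> 0" "proj v \<in> proj_plane \<inter> proj ` curve_cone" for v
  proof -
    have "v \<in> curve_cone" using proj_in_curveD v by blast
    then show ?thesis using symmetry_curve_cone[OF assms(1)] f by (auto simp: curve_cone_def)
  qed
  ultimately show "\<exists>U d F. zariski_open U \<and> P \<in> U \<and> (\<forall>i :: 3. ternary_form d (\<lambda>v. F v $ i)) \<and>
      (\<forall>v. v \<noteq> 0 \<and> proj v \<in> U \<inter> proj ` curve_cone \<longrightarrow> F v \<noteq> 0 \<and> f (proj v) = proj (F v))"
    using P by (intro exI[of _ proj_plane] exI[of _ 1] exI[of _ "\<lambda>v. T *v v"]) simp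
qed

lemma act_inverse:
  assumes "T' ** T = mat 1" "T \<in> symmetries" "P \<in> proj ` curve_cone"
  shows "act T' (act T P) = P"
proof -
  obtain v where v: "v \<in> curve_cone" "P = proj v" using assms(3) by blast
  then show ?thesis
    using symmetry_curve_cone[OF assms(2)] assms(1) by (simp add: act_proj matrix_vector_mul_assoc)
qed

lemma act_closed: "T \<in> symmetries \<Longrightarrow> P \<in> proj ` curve_cone \<Longrightarrow> act T P \<in> proj ` curve_cone"
  using symmetry_curve_cone[of T] by (fastforce simp: act_proj)

lemma act_variety_aut:
  fixes T :: "'k::field ^ 3 ^ 3"
  assumes "T \<in> symmetries"
  shows "act T \<in> variety_aut (proj ` curve_cone)"
proof -
  let ?C = "proj ` (curve_cone :: ('k ^ 3) set)"
  obtain T' where T': "T' \<in> symmetries" "T ** T' = mat 1" "T' ** T = mat 1"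
    using symmetries_inverse[OF assms] by blast
  have bij: "bij_betw (act T) ?C ?C"
  proof (rule bij_betwI)
    show "act T \<in> ?C \<rightarrow> ?C" "act T' \<in> ?C \<rightarrow> ?C"
      using act_closed[OF assms] act_closed[OF T'(1)] by blast+
    show "act T' (act T P) = P" if "P \<in> ?C" for P by (rule act_inverse[OF T'(3) assms that])
    show "act T (act T' P) = P" if "P \<in> ?C" for P by (rule act_inverse[OF T'(2,1) that])
  qed
  then have "act T \<in> Bij ?C" by (simp add: Bij_def act_def)
  moreover have "proj_morphism ?C ?C (act T)"
    using linear_morphism[OF assms] act_proj by blast
  moreover have "proj_morphism ?C ?C (inv_into ?C (act T))"
  proof (rule linear_morphism[OF T'(1)])
    fix v :: "'k ^ 3" assume v: "v \<in> curve_cone"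
    have "inv_into ?C (act T) (act T (act T' (proj v))) = act T' (proj v)"
      using bij act_closed[OF T'(1)] v by (intro inv_into_f_f) (auto simp: bij_betw_def)
    moreover have "act T (act T' (proj v)) = proj v" using act_inverse[OF T'(2,1)] v by blast
    ultimately show "inv_into ?C (act T) (proj v) = proj (T' *v v)" using act_proj[OF v] by metis
  qed
  ultimately show ?thesis by (simp add: variety_aut_def)
qed

lemma variety_aut_curve:
  assumes 2: "(2::'k::alg_closed_field) \<noteq> 0" and 5: "(5::'k) \<noteq> 0" and 7: "(7::'k) \<noteq> 0"
  shows "variety_aut (proj ` (curve_cone :: ('k ^ 3) set)) = act ` symmetries"
proof (intro equalityI subsetI)
  fix f :: "('k ^ 3) set \<Rightarrow> ('k ^ 3) set"
  assume "f \<in> act ` symmetries"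
  then show "f \<in> variety_aut (proj ` curve_cone)" using act_variety_aut by blast
next
  fix f :: "('k ^ 3) set \<Rightarrow> ('k ^ 3) set"
  assume f: "f \<in> variety_aut (proj ` curve_cone)"
  obtain M M' where inv: "M' ** M = mat 1" and M: "\<And>v. v \<in> curve_cone \<Longrightarrow> M *v v \<in> curve_cone"
    "\<And>v. v \<in> curve_cone \<Longrightarrow> f (proj v) = proj (M *v v)"
    using automorphism_linear[OF 2 f] by blast
  have inv': "M ** M' = mat 1" using inv by (simp add: matrix_left_right_inverse)
  obtain l where l: "l \<noteq> 0" "\<And>v. quartic (M *v v) = l * quartic v"
    using quartic_scaled_by_matrix[OF 2 inv' M(1)] by blast
  \<comment> \<open>Dividing by the middle entry leaves the projective map unchanged and turns the
    factor c^4 of the block form into 1.\<close>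
  define c where "c = M $ 2 $ 2"
  define T where "T = tmat (M $ 1 $ 1 / c) (M $ 1 $ 3 / c) (M $ 3 $ 1 / c) (M $ 3 $ 3 / c)"
  note block = matrix_block_form[OF 2 7 inv' inv l]
  have c: "c \<noteq> 0" using block by (simp add: c_def)
  have MT: "M *v v = c *s (T *v v)" for v
    using block c by (intro vec3_eqI) (simp_all add: T_def tmat_apply matrix_vector_mult_3 field_simps flip: c_def)
  have "cheb_form (M $ 1 $ 1 / c * x + M $ 1 $ 3 / c * z) (M $ 3 $ 1 / c * x + M $ 3 $ 3 / c * z) = cheb_form x z" for x z
  proof -
    have b: "cheb_form (a / c) (b / c) = cheb_form a b / c ^ 4" for a b
    proof -
      have "c ^ 4 * cheb_form (a / c) (b / c) = cheb_form (c * (a / c)) (c * (b / c))"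
        unfolding cheb_form_def by algebra
      then show ?thesis using c by (simp add: eq_divide_eq mult.commute)
    qed
    have "M $ 1 $ 1 / c * x + M $ 1 $ 3 / c * z = (M $ 1 $ 1 * x + M $ 1 $ 3 * z) / c"
      "M $ 3 $ 1 / c * x + M $ 3 $ 3 / c * z = (M $ 3 $ 1 * x + M $ 3 $ 3 * z) / c"
      by (simp_all add: add_divide_distrib)
    moreover have "cheb_form (M $ 1 $ 1 * x + M $ 1 $ 3 * z) (M $ 3 $ 1 * x + M $ 3 $ 3 * z) = c ^ 4 * cheb_form x z"
      using block by (simp add: c_def)
    ultimately show ?thesis using c by (simp only: b) simp
  qed
  from cheb_form_symmetries[OF 2 5 7 this] have T: "T \<in> symmetries"
    unfolding T_def by (auto intro: diagonal_in_symmetries antidiagonal_in_symmetries)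
  have "f = act T"
  proof (rule extensionalityI[where A = "proj ` curve_cone"])
    show "f \<in> extensional (proj ` curve_cone)" using f by (simp add: variety_aut_def Bij_def)
    show "act T \<in> extensional (proj ` curve_cone)" by (simp add: act_def)
    fix P :: "('k ^ 3) set" assume "P \<in> proj ` curve_cone"
    then obtain v where "v \<in> curve_cone" "P = proj v" by blast
    then show "f P = act T P" using M(2) c by (simp add: MT proj_scale act_proj)
  qed
  then show "f \<in> act ` symmetries" using T by blast
qed

text \<open>Equal projective maps give S v = c T v. The middle coordinate, fixed by both matrices,
  forces c = 1 where it is nonzero, and the points (1, 1, 0) and (0, y, 1) then reveal all
  entries.\<close>

lemma act_inject:
  fixes S T :: "'k::alg_closed_field ^ 3 ^ 3"
  assumes 2: "(2::'k) \<noteq> 0" and "S \<in> symmetries" "T \<in> symmetries" "act S = act T"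
  shows "S = T"
proof -
  obtain p q r s where S: "S = tmat p q r s" using assms(2) by (elim symmetries_cases) auto
  obtain p' q' r' s' where T: "T = tmat p' q' r' s'" using assms(3) by (elim symmetries_cases) auto
  have eq: "S *v v = T *v v" if v: "v \<in> curve_cone" "v $ 2 \<noteq> 0" for v
  proof -
    have "proj (S *v v) = proj (T *v v)" using assms(4) act_proj[OF v(1)] by metis
    moreover have "S *v v \<noteq> 0" using symmetry_curve_cone[OF assms(2) v(1)] by (simp add: curve_cone_def)
    ultimately obtain c where c: "S *v v = c *s (T *v v)" using proj_eqD by blast
    have "v $ 2 = c * v $ 2" using arg_cong[OF c, of "\<lambda>u. u $ 2"] by (simp add: S T tmat_apply)
    then have "c = 1" using v(2) by simp
    then show ?thesis using c by simp
  qed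
  obtain y :: 'k where y: "y ^ 4 = 2" using nth_root_exists[of 4 2] by auto
  then have y0: "y \<noteq> 0" using 2 by auto
  have "vector [1, 1, 0] \<in> (curve_cone :: ('k ^ 3) set)" "vector [0, y, 1] \<in> (curve_cone :: ('k ^ 3) set)"
    by (simp_all add: curve_cone_def quartic_def cheb_form_def vec3_nonzero y)
  from eq[OF this(1)] eq[OF this(2)] show ?thesis
    using y0 by (simp add: S T tmat_apply vec_eq_iff forall_3 tmat_component)
qed

lemma char_not_dividing:
  assumes "CHAR('k::field) \<noteq> p" "prime p"
  shows "of_nat p \<noteq> (0::'k)"
proof
  assume "of_nat p = (0::'k)"
  then have "CHAR('k) dvd p" by (simp add: of_nat_eq_0_iff_char_dvd)
  then have "CHAR('k) = 1" using assms by (meson prime_nat_iff)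
  then show False by simp
qed

section \<open>Counting the symmetries and computing their squares\<close>

lemma fourth_roots:
  fixes b i :: "'k::field"
  assumes "i ^ 2 = -1"
  shows "{y. y ^ 4 = b ^ 4} = {b, - b, i * b, - (i * b)}"
proof -
  have "y ^ 4 - b ^ 4 = (y - b) * (y + b) * ((y - i * b) * (y + i * b))" for y
  proof -
    have "(y - b) * (y + b) * ((y - i * b) * (y + i * b)) = (y ^ 2 - b ^ 2) * (y ^ 2 - i ^ 2 * b ^ 2)" by algebra
    also have "\<dots> = y ^ 4 - b ^ 4" unfolding assms by algebra
    finally show ?thesis by simp
  qed
  then have "y ^ 4 = b ^ 4 \<longleftrightarrow> y = b \<or> y = - b \<or> y = i * b \<or> y = - (i * b)" for y
    by (metis (no_types, lifting) add_eq_0_iff2 mult_eq_0_iff right_minus_eq)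
  then show ?thesis by auto
qed

lemma neq_uminus:
  fixes x :: "'k::field"
  assumes "(2::'k) \<noteq> 0" "x \<noteq> 0"
  shows "x \<noteq> - x"
proof
  assume "x = - x"
  then have "x + x = 0" unfolding eq_neg_iff_add_eq_0 .
  then have "2 * x = 0" by (simp only: mult_2)
  then show False using assms by simp
qed

lemma card_fourth_roots:
  fixes c :: "'k::alg_closed_field"
  assumes 2: "(2::'k) \<noteq> 0" and "c \<noteq> 0"
  shows "card {y. y ^ 4 = c} = 4"
proof -
  obtain b where b: "b ^ 4 = c" using nth_root_exists[of 4 c] by auto
  obtain i :: 'k where i: "i ^ 2 = -1" using nth_root_exists[of 2 "-1 :: 'k"] by auto
  have "b \<noteq> 0" using b assms by auto
  note neg = neq_uminus[OF 2]
  have sq: "u ^ 2 \<noteq> (- 1 :: 'k)" if "u = 1 \<or> u = - 1" for u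
    using that neg[of 1] by auto
  have "(- i) ^ 2 = - 1" using i by simp
  then have "i \<noteq> 1" "i \<noteq> - 1" "- i \<noteq> 1" "- i \<noteq> - 1" using sq[of i] sq[of "- i"] i by blast+
  note ne = this this[symmetric]
  have "i \<noteq> 0" using i by auto
  then have "card {1, - 1, i, - i} = 4"
    using neg[of 1] neg[of i] ne by (simp add: card_insert_if)
  moreover have "inj_on (\<lambda>u. u * b) {1, - 1, i, - i}"
    using \<open>b \<noteq> 0\<close> by (intro inj_onI) simp
  then have "card ((\<lambda>u. u * b) ` {1, - 1, i, - i}) = card {1, - 1, i, - i}" by (rule card_image)
  ultimately have "card ((\<lambda>u. u * b) ` {1, - 1, i, - i}) = 4" by (simp only:)
  then show ?thesis using fourth_roots[OF i, of b] b by simp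
qed

lemma card_signs: "(2::'k::field) \<noteq> 0 \<Longrightarrow> card {1, - 1 :: 'k} = 2"
  using neq_uminus[of "1 :: 'k"] by simp

lemma card_symmetries:
  assumes 2: "(2::'k::alg_closed_field) \<noteq> 0"
  shows "card (symmetries :: ('k ^ 3 ^ 3) set) = 16"
proof -
  let ?E = "{1, - 1 :: 'k}"
  have half: "2 * r ^ 4 = 1 \<longleftrightarrow> r ^ 4 = 1 / 2" for r :: 'k
    using nonzero_eq_divide_eq[OF 2, of "r ^ 4" 1] unfolding mult.commute[of "r ^ 4" 2] by blast
  have d: "diagonal_symmetries = (\<lambda>(p, e). tmat p 0 0 (e * p)) ` ({p :: 'k. p ^ 4 = 1} \<times> ?E)"
  proof (intro equalityI subsetI)
    fix T :: "'k ^ 3 ^ 3"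
    assume "T \<in> diagonal_symmetries"
    then obtain p s where T: "T = tmat p 0 0 s" "p ^ 4 = 1" "s = p \<or> s = - p"
      by (auto simp: diagonal_symmetries_def power2_eq_iff)
    then have "T = (\<lambda>(p, e). tmat p 0 0 (e * p)) (p, 1) \<or> T = (\<lambda>(p, e). tmat p 0 0 (e * p)) (p, - 1)"
      by auto
    then show "T \<in> (\<lambda>(p, e). tmat p 0 0 (e * p)) ` ({p. p ^ 4 = 1} \<times> ?E)" using T(2) by blast
  qed (auto simp: diagonal_symmetries_def tmat_inject)
  define R where "R = {r :: 'k. 2 * r ^ 4 = 1}"
  have R: "2 * r ^ 4 = 1" "r \<noteq> 0" if "r \<in> R" for r using that by (auto simp: R_def)
  have cR: "card R = 4"
  proof -
    have "R = {r. r ^ 4 = 1 / 2}" unfolding R_def using half by blast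
    moreover have "(1 / 2 :: 'k) \<noteq> 0" using 2 by simp
    ultimately show ?thesis using card_fourth_roots[OF 2, of "1 / 2"] by (simp only: simp_thms)
  qed
  \<comment> \<open>The condition on \<open>q\<close> says that e = q r is a sign, so
    \<open>r\<close> and \<open>e\<close> are free parameters, with 4 times 2 choices.\<close>
  have a: "antidiagonal_symmetries = (\<lambda>(r, e). tmat 0 (e / r) r 0) ` (R \<times> ?E)"
  proof (intro equalityI subsetI)
    fix T :: "'k ^ 3 ^ 3"
    assume "T \<in> antidiagonal_symmetries"
    then obtain q r where T: "T = tmat 0 q r 0" "2 * r ^ 4 = 1" "(q * r) ^ 2 = 1"
      by (auto simp: antidiagonal_symmetries_def power_mult_distrib)
    have r: "r \<in> R" using T(2) by (simp add: R_def)
    moreover have "q * r \<in> ?E" using T(3) by (simp add: power2_eq_1_iff)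
    ultimately have "(r, q * r) \<in> R \<times> ?E" by blast
    moreover have "T = (\<lambda>(r, e). tmat 0 (e / r) r 0) (r, q * r)" using R(2)[OF r] by (simp add: T(1))
    ultimately show "T \<in> (\<lambda>(r, e). tmat 0 (e / r) r 0) ` (R \<times> ?E)" by (rule rev_image_eqI)
  next
    fix T :: "'k ^ 3 ^ 3"
    assume "T \<in> (\<lambda>(r, e). tmat 0 (e / r) r 0) ` (R \<times> ?E)"
    then obtain r e where T: "T = tmat 0 (e / r) r 0" "r \<in> R" "e \<in> ?E" by auto
    have "(e / r) ^ 2 * r ^ 2 = 1" using T(3) R(2)[OF T(2)] by (auto simp: power_divide)
    then show "T \<in> antidiagonal_symmetries"
      using R(1)[OF T(2)] unfolding antidiagonal_symmetries_def T(1) by blast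
  qed
  have "card (diagonal_symmetries :: ('k ^ 3 ^ 3) set) = card ({p :: 'k. p ^ 4 = 1} \<times> ?E)"
    unfolding d by (rule card_image) (auto simp: inj_on_def tmat_inject)
  then have cd: "card (diagonal_symmetries :: ('k ^ 3 ^ 3) set) = 8"
    unfolding card_cartesian_product card_signs[OF 2] card_fourth_roots[OF 2 one_neq_zero] by simp
  have "inj_on (\<lambda>(r, e). tmat 0 (e / r) r 0) (R \<times> ?E)"
    by (rule inj_onI) (auto simp: tmat_inject R(2))
  then have c: "card (antidiagonal_symmetries :: ('k ^ 3 ^ 3) set) = card (R \<times> ?E)"
    unfolding a by (rule card_image)
  from c have ca: "card (antidiagonal_symmetries :: ('k ^ 3 ^ 3) set) = 8"
    unfolding card_cartesian_product card_signs[OF 2] cR by simp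
  have "diagonal_symmetries \<inter> antidiagonal_symmetries = ({} :: ('k ^ 3 ^ 3) set)"
    by (auto simp: diagonal_symmetries_def antidiagonal_symmetries_def tmat_inject)
  moreover have "finite (diagonal_symmetries :: ('k ^ 3 ^ 3) set)" "finite (antidiagonal_symmetries :: ('k ^ 3 ^ 3) set)"
    using ca cd by (simp_all add: card_ge_0_finite)
  ultimately show ?thesis using ca cd by (simp add: symmetries_def card_Un_disjoint)
qed

text \<open>A diagonal square has entries p^2 and s^2, which agree; an antidiagonal square has q r
  in both places, and (q r)^2 = 1.\<close>

lemma symmetries_square:
  fixes T :: "'k::field ^ 3 ^ 3"
  assumes "T \<in> symmetries"
  shows "\<exists>k. k ^ 4 = 1 \<and> T ** T = tmat k 0 0 k"
  using assms
proof (cases rule: symmetries_cases)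
  case (1 p s)
  have "(p * p) ^ 4 = (p ^ 4) ^ 2" by algebra
  moreover have "s * s = p * p" using 1(3) by (simp only: power2_eq_square)
  ultimately have "(p * p) ^ 4 = 1 \<and> T ** T = tmat (p * p) 0 0 (p * p)"
    unfolding 1(1,2) tmat_mult tmat_inject by simp
  then show ?thesis by blast
next
  case (2 q r)
  have "(q * r) ^ 4 = (q ^ 2 * r ^ 2) ^ 2" by algebra
  then have "(q * r) ^ 4 = 1 \<and> T ** T = tmat (q * r) 0 0 (q * r)"
    unfolding 2(1,3) tmat_mult tmat_inject by simp
  then show ?thesis by blast
qed

lemma scalar_symmetry_commute:
  fixes T :: "'k::field ^ 3 ^ 3"
  assumes "T \<in> symmetries"
  shows "T ** tmat k 0 0 k = tmat k 0 0 k ** T"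
proof -
  obtain p q r s where T: "T = tmat p q r s" using assms by (elim symmetries_cases) auto
  have "T ** tmat k 0 0 k = tmat (p * k) (q * k) (r * k) (s * k)" by (simp add: T tmat_mult)
  also have "\<dots> = tmat (k * p) (k * q) (k * r) (k * s)" by (simp only: mult.commute)
  also have "\<dots> = tmat k 0 0 k ** T" by (simp add: T tmat_mult)
  finally show ?thesis .
qed

theorem theorem3p10:
  fixes C :: "('k::alg_closed_field ^ 3) set set"
    and G :: "(('k ^ 3) set \<Rightarrow> ('k ^ 3) set) monoid"
  assumes "CHAR('k) \<notin> {2, 5, 7}"
  defines "C \<equiv> proj_curve 4 (chebyshev 4)"
  defines "G \<equiv> VarietyAutGroup C"
  shows "group G \<and> Coset.order G = 16 \<and>
    (\<exists>N. N \<lhd> G \<and> card N = 4 \<and>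
         G\<lparr>carrier := N\<rparr> \<cong> integer_mod_group 4 \<and>
         G Mod N \<cong> integer_mod_group 2 \<times>\<times> integer_mod_group 2)"
proof -
  have 2: "(2::'k) \<noteq> 0" and 5: "(5::'k) \<noteq> 0" and 7: "(7::'k) \<noteq> 0"
    using char_not_dividing[where 'k='k, of 2] char_not_dividing[where 'k='k, of 5]
      char_not_dividing[where 'k='k, of 7] assms(1) by simp_all
  have C: "C = proj ` curve_cone"
    unfolding C_def chebyshev_curve[OF 2] by (auto simp: curve_cone_def)
  have carrier: "carrier G = act ` symmetries"
    by (simp add: G_def VarietyAutGroup_def C variety_aut_curve[OF 2 5 7])
  have Bij: "act T \<in> Bij C" if "T \<in> symmetries" for T :: "'k ^ 3 ^ 3"
    using act_variety_aut[OF that] by (simp add: C variety_aut_def)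
  have one: "\<one>\<^bsub>G\<^esub> = act (mat 1)"
    by (simp add: G_def VarietyAutGroup_def BijGroup_def C act_def)
  have mult: "act S \<otimes>\<^bsub>G\<^esub> act T = act (S ** T)" if "S \<in> symmetries" "T \<in> symmetries" for S T :: "'k ^ 3 ^ 3"
  proof -
    have "act S \<otimes>\<^bsub>G\<^esub> act T = compose C (act S) (act T)"
      unfolding G_def VarietyAutGroup_def BijGroup_def
      by (simp add: Bij[OF that(1)] Bij[OF that(2)])
    also have "\<dots> = act (S ** T)"
    proof (rule extensionalityI[where A = C])
      show "compose C (act S) (act T) \<in> extensional C" by (rule compose_extensional)
      show "act (S ** T) \<in> extensional C" unfolding act_def C by (rule restrict_extensional)
      fix P assume P: "P \<in> C"
      then obtain v where v: "v \<in> curve_cone" "P = proj v" unfolding C by blast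
      have "compose C (act S) (act T) P = act S (act T P)" using P by (rule compose_eq)
      also have "\<dots> = proj (S *v (T *v v))"
        unfolding v(2) act_proj[OF v(1)] by (rule act_proj[OF symmetry_curve_cone[OF that(2) v(1)]])
      also have "\<dots> = act (S ** T) P"
        unfolding v(2) act_proj[OF v(1)] matrix_vector_mul_assoc ..
      finally show "compose C (act S) (act T) P = act (S ** T) P" .
    qed
    finally show ?thesis .
  qed
  have group: "group G"
  proof (rule groupI)
    fix x y assume x: "x \<in> carrier G" and y: "y \<in> carrier G"
    obtain S T where S: "S \<in> symmetries" "x = act S" and T: "T \<in> symmetries" "y = act T"
      using x y unfolding carrier by blast
    show "x \<otimes>\<^bsub>G\<^esub> y \<in> carrier G"
      unfolding S(2) T(2) mult[OF S(1) T(1)] carrier by (intro imageI symmetries_mult S T)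
    show "x \<otimes>\<^bsub>G\<^esub> y \<otimes>\<^bsub>G\<^esub> z = x \<otimes>\<^bsub>G\<^esub> (y \<otimes>\<^bsub>G\<^esub> z)" if z: "z \<in> carrier G" for z
    proof -
      obtain U where U: "U \<in> symmetries" "z = act U" using z unfolding carrier by blast
      show ?thesis
        unfolding S(2) T(2) U(2) mult[OF S(1) T(1)] mult[OF T(1) U(1)]
          mult[OF symmetries_mult[OF S(1) T(1)] U(1)] mult[OF S(1) symmetries_mult[OF T(1) U(1)]]
        by (simp add: matrix_mul_assoc)
    qed
    show "\<one>\<^bsub>G\<^esub> \<otimes>\<^bsub>G\<^esub> x = x"
      unfolding S(2) one mult[OF one_in_symmetries S(1)] by simp
  next
    show "\<one>\<^bsub>G\<^esub> \<in> carrier G" using one_in_symmetries unfolding carrier one by blast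
    show "\<exists>y\<in>carrier G. y \<otimes>\<^bsub>G\<^esub> x = \<one>\<^bsub>G\<^esub>" if x: "x \<in> carrier G" for x
    proof -
      obtain T where T: "T \<in> symmetries" "x = act T" using x carrier by blast
      obtain T' where "T' \<in> symmetries" "T' ** T = mat 1" using symmetries_inverse[OF T(1)] by blast
      note T' = this
      have "act T' \<otimes>\<^bsub>G\<^esub> x = \<one>\<^bsub>G\<^esub>" unfolding T(2) mult[OF T'(1) T(1)] T'(2) one ..
      moreover have "act T' \<in> carrier G" using T'(1) unfolding carrier by blast
      ultimately show ?thesis by blast
    qed
  qed
  have inj: "inj_on act (symmetries :: ('k ^ 3 ^ 3) set)"
    using act_inject[OF 2] by (auto simp: inj_on_def)
  have order: "Coset.order G = 16"
    using card_symmetries[OF 2] card_image[OF inj] by (simp add: order_def carrier)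
  obtain i :: 'k where i: "i ^ 2 = -1" using nth_root_exists[of 2 "-1 :: 'k"] by auto
  \<comment> \<open>Projectively \<open>Z k\<close> is y -> y / k, so these are the deck
    transformations of the fourfold cover (x : y : z) -> (x : z) given by the y-coordinate. The
    generator is taken at a primitive fourth root of unity \<open>i\<close>.\<close>
  define Z where "Z k = tmat k 0 0 k" for k :: 'k
  have Z: "Z k \<in> symmetries" if "k ^ 4 = 1" for k
    unfolding Z_def by (rule diagonal_in_symmetries[OF that]) simp
  have ZZ: "Z a ** Z b = Z (a * b)" for a b by (simp add: Z_def tmat_mult)
  have Z1: "Z 1 = mat 1" by (simp add: Z_def tmat_one)
  have ii: "i * i = - 1" using i by (simp add: power2_eq_square)
  have i4: "i ^ 4 = 1" using i by algebra
  note Zi = Z[OF i4]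
  have Zm: "Z (- 1) \<in> symmetries" by (rule Z) simp
  have pow: "act (Z i) [^]\<^bsub>G\<^esub> n = act (Z (i ^ n))" for n :: nat
  proof (induction n)
    case 0
    then show ?case by (simp add: one Z1)
  next
    case (Suc n)
    have "(i ^ n) ^ 4 = (i ^ 4) ^ n" by (simp only: power_mult[symmetric] mult.commute)
    then have "(i ^ n) ^ 4 = 1" by (simp add: i4)
    then show ?case using Suc mult[OF Z Zi, of "i ^ n"] by (simp add: ZZ mult.commute)
  qed
  show ?thesis
  proof (intro conjI group order central_cyclic_subgroup[OF group order, of "act (Z i)"])
    show "act (Z i) \<in> carrier G" using Zi carrier by blast
    show "x \<otimes>\<^bsub>G\<^esub> act (Z i) = act (Z i) \<otimes>\<^bsub>G\<^esub> x" if x: "x \<in> carrier G" for x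
    proof -
      obtain T where T: "T \<in> symmetries" "x = act T" using x unfolding carrier by blast
      have "T ** Z i = Z i ** T" unfolding Z_def by (rule scalar_symmetry_commute[OF T(1)])
      then show ?thesis unfolding T(2) mult[OF T(1) Zi] mult[OF Zi T(1)] by simp
    qed
    show "act (Z i) \<otimes>\<^bsub>G\<^esub> act (Z i) \<noteq> \<one>\<^bsub>G\<^esub>"
    proof
      assume "act (Z i) \<otimes>\<^bsub>G\<^esub> act (Z i) = \<one>\<^bsub>G\<^esub>"
      then have "act (Z (- 1)) = act (Z 1)" unfolding mult[OF Zi Zi] ZZ ii one Z1 .
      from act_inject[OF 2 Zm Z[OF power_one] this] have "Z (- 1) = Z 1" .
      then have "(1::'k) = - 1" unfolding Z_def tmat_inject by (elim conjE) (rule sym)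
      then show False using neq_uminus[OF 2 one_neq_zero] by blast
    qed
    show "(act (Z i) \<otimes>\<^bsub>G\<^esub> act (Z i)) \<otimes>\<^bsub>G\<^esub> (act (Z i) \<otimes>\<^bsub>G\<^esub> act (Z i)) = \<one>\<^bsub>G\<^esub>"
      unfolding mult[OF Zi Zi] ZZ ii mult[OF Zm Zm] one by (simp add: Z1)
    show "\<exists>n::nat. x \<otimes>\<^bsub>G\<^esub> x = act (Z i) [^]\<^bsub>G\<^esub> n" if x: "x \<in> carrier G" for x
    proof -
      obtain T where T: "T \<in> symmetries" "x = act T" using x unfolding carrier by blast
      obtain k where k: "k ^ 4 = 1" "T ** T = Z k" using symmetries_square[OF T(1)] by (auto simp: Z_def)
      have "k \<in> {y. y ^ 4 = 1 ^ 4}" using k(1) by simp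
      then have "k = 1 \<or> k = - 1 \<or> k = i \<or> k = - i" unfolding fourth_roots[OF i] by simp
      moreover have "i ^ 0 = 1" "i ^ 1 = i" "i ^ 3 = - i" using ii by (simp_all add: power3_eq_cube)
      ultimately have "k = i ^ 0 \<or> k = i ^ 2 \<or> k = i ^ 1 \<or> k = i ^ 3" using i by (elim disjE) simp_all
      then obtain n where "k = i ^ n" by blast
      then show ?thesis unfolding T(2) mult[OF T(1) T(1)] k(2) pow by blast
    qed
  qed
qed

end
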